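(* Let $N$ be the group of real unipotent upper triangular $\ell\times\ell$ matrices and $m = [\ell/2]$. Let $0\ne\lambda_r\in\mathfrak{z}_r^*$ for $1\le r\le m$ and set $\lambda = \lambda_1+\dots+\lambda_m$. Denote $\deg(\pi_\lambda) = \deg(\pi_{\lambda_1})\cdots\deg(\pi_{\lambda_m})$. Then the coefficients $f_{z,w}(x) = \langle z,\pi_\lambda(x)w\rangle$ of the irreducible unitary representation $\pi_\lambda$ of $N$ are in $L^2(N/S)$ and satisfy $$\|f_{z,w}\|^2_{L^2(N/S)} = \frac{\|z\|^2\|w\|^2}{\deg(\pi_\lambda)} = \frac{\|z\|^2\|w\|^2}{\prod_{r=1}^m|\lambda_r|^{\ell-2r}}.$$
   Context: $\mathfrak{n}$ is the Lie algebra of real $\ell\times\ell$ matrices with zeroes on and below the diagonal; $e_{i,j}$ are the matrix units. For $1\le r\le m = [\ell/2]$, $\mathfrak{m}_r$ is the span of $\{e_{r,s}\mid r+1\le s\le\ell-r\}$, $\{e_{q,\ell-r+1}\mid r+1\le q\le\ell-r\}$ and $e_{r,\ell-r+1}$: a Heisenberg algebra of dimension $2(\ell-2r)+1$ (one-dimensional abelian if $\ell=2r$) with center $\mathfrak{z}_r = \mathbb{R}e_{r,\ell-r+1}$. $\mathfrak{n}_r = \mathfrak{m}_1+\dots+\mathfrak{m}_r$. $M_r,N_r,Z_r$ are the corresponding analytic subgroups, $N_r = N_{r-1}\rtimes M_r$, and $S = Z_1Z_2\cdots Z_m$. $\lambda_r\in\mathfrak{z}_r^*$ is identified with the number $\lambda_r(e_{r,\ell-r+1})$,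 and is extended by $0$ on the other $e_{i,j}$. $\pi_{\lambda_r}$ is the irreducible unitary representation of $M_r$ with central character $\exp(\zeta)\mapsto e^{2\pi\sqrt{-1}\lambda_r(\zeta)}$; its coefficients are square integrable modulo $Z_r$, and $\deg(\pi_{\lambda_r})$ is its formal degree: $\int_{M_r/Z_r}|\langle u,\pi_{\lambda_r}(x)v\rangle|^2d(xZ_r) = \|u\|^2\|v\|^2/\deg(\pi_{\lambda_r})$, with measures normalized so that $\deg(\pi_{\lambda_r}) = |\lambda_r|^{\ell-2r}$. Recursively, $\pi_{\lambda_1+\dots+\lambda_r}\in\widehat{N_r}$ extends to a representation $\pi'_{\lambda_1+\dots+\lambda_r}$ of $N_{r+1}$ on the same Hilbert space, namely the irreducible representation attached (Kirillov) to the functional equal to $\lambda_1+\dots+\lambda_r$ on $\mathfrak{n}_r$ and vanishing on $\mathfrak{m}_{r+1}$; then $\pi_{\lambda_1+\dots+\lambda_{r+1}} = \pi'_{\lambda_1+\dots+\lambda_r}\widehat\otimes\pi_{\lambda_{r+1}}$, with $\pi_{\lambda_{r+1}}$ lifted via $N_{r+1}/N_r\cong M_{r+1}$; $\pi_\lambda = \pi_{\lambda_1+\dots+\lambda_m}$. Integration over $N/S$ uses the measure-preserving decomposition $N/S = (M_1/Z_1)\times\dots\times(M_m/Z_m)$. *)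

theory Defs
  imports "HOL-Analysis.Analysis"
begin

section \<open>Complex Hilbert spaces\<close>

text \<open>
  The norm of \<^class>\<open>real_inner\<close> is the one coming from the real part of the Hermitian product.
  Individual Hilbert spaces are closed complex subspaces of one ambient Hilbert space \<open>'h\<close>, so that
  families of different Hilbert spaces can be treated within a single type.
\<close>

class complex_hilbert_space = real_inner + complete_space +
  fixes scaleC :: "complex \<Rightarrow> 'a \<Rightarrow> 'a" (infixr "*\<^sub>C" 75)
    and cinner :: "'a \<Rightarrow> 'a \<Rightarrow> complex"
  assumes scaleC_add_right: "c *\<^sub>C (x + y) = c *\<^sub>C x + c *\<^sub>C y"
    and scaleC_add_left: "(c + d) *\<^sub>C x = c *\<^sub>C x + d *\<^sub>C x"
    and scaleC_scaleC: "c *\<^sub>C (d *\<^sub>C x) = (c * d) *\<^sub>C x"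
    and scaleR_scaleC: "r *\<^sub>R x = complex_of_real r *\<^sub>C x"
    and cinner_commute: "cinner x y = cnj (cinner y x)"
    and cinner_add_left: "cinner (x + y) z = cinner x z + cinner y z"
    and cinner_scaleC_left: "cinner (c *\<^sub>C x) y = c * cinner x y"
    and inner_eq_Re_cinner: "inner x y = Re (cinner x y)"

definition csubspace :: "'h::complex_hilbert_space set \<Rightarrow> bool" where
  "csubspace H \<longleftrightarrow> 0 \<in> H \<and> (\<forall>u\<in>H. \<forall>v\<in>H. u + v \<in> H) \<and> (\<forall>c. \<forall>u\<in>H. c *\<^sub>C u \<in> H)"

definition closed_csubspace :: "'h::complex_hilbert_space set \<Rightarrow> bool" where
  "closed_csubspace H \<longleftrightarrow> csubspace H \<and> closed H"

text \<open>\<open>K'\<close>, with \<open>t a b\<close> in the role of \<open>a \<otimes> b\<close>, is the Hilbert space tensor product of \<open>K\<close> and \<open>H\<close>.\<close>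

definition hilbert_tensor ::
  "'h::complex_hilbert_space set \<Rightarrow> 'h set \<Rightarrow> 'h set \<Rightarrow> ('h \<Rightarrow> 'h \<Rightarrow> 'h) \<Rightarrow> bool" where
  "hilbert_tensor K H K' t \<longleftrightarrow>
     (\<forall>a\<in>K. \<forall>b\<in>H. \<forall>b'\<in>H. \<forall>c. t a (b + b') = t a b + t a b' \<and> t a (c *\<^sub>C b) = c *\<^sub>C t a b) \<and>
     (\<forall>a\<in>K. \<forall>a'\<in>K. \<forall>b\<in>H. \<forall>c. t (a + a') b = t a b + t a' b \<and> t (c *\<^sub>C a) b = c *\<^sub>C t a b) \<and>
     (\<forall>a\<in>K. \<forall>a'\<in>K. \<forall>b\<in>H. \<forall>b'\<in>H. cinner (t a b) (t a' b') = cinner a a' * cinner b b') \<and>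
     K' = closure (csubspace hull {t a b | a b. a \<in> K \<and> b \<in> H})"


section \<open>Matrix groups and their Lie algebras\<close>

text \<open>
  The size of the matrices is \<open>\<ell> = CARD('n)\<close>; rows and columns are indexed by a finite linear order,
  whose elements are numbered \<open>1, \<dots>, \<ell>\<close> by \<open>pos\<close>.
\<close>

type_synonym 'n sqmat = "real^'n^'n"

definition pos :: "'n::{finite,linorder} \<Rightarrow> nat" where
  "pos a = card {..a}"

definition E :: "nat \<Rightarrow> nat \<Rightarrow> ('n::{finite,linorder}) sqmat" where
  "E i j = (\<chi> a b. if pos a = i \<and> pos b = j then 1 else 0)"

definition mexp :: "('n::finite) sqmat \<Rightarrow> 'n sqmat" where
  "mexp A = (\<Sum>k. (1 / fact k) *\<^sub>R (((**) A ^^ k) (mat 1)))"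

definition bracket :: "('n::finite) sqmat \<Rightarrow> 'n sqmat \<Rightarrow> 'n sqmat" where
  "bracket A B = A ** B - B ** A"

definition matrix_group :: "('n::finite) sqmat set \<Rightarrow> bool" where
  "matrix_group G \<longleftrightarrow> mat 1 \<in> G \<and> (\<forall>x\<in>G. \<forall>y\<in>G. x ** y \<in> G) \<and>
     (\<forall>x\<in>G. \<exists>y\<in>G. x ** y = mat 1 \<and> y ** x = mat 1)"

definition analytic_subgroup :: "('n::finite) sqmat set \<Rightarrow> 'n sqmat set" where
  "analytic_subgroup \<hh> = matrix_group hull (mexp ` \<hh>)"

definition unipotent_group :: "('n::{finite,linorder}) sqmat set" where
  "unipotent_group = {A. (\<forall>i. A $ i $ i = 1) \<and> (\<forall>i j. j < i \<longrightarrow> A $ i $ j = 0)}"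

text \<open>Positions of the non-central basis elements of \<open>\<mm>\<^sub>r\<close>, for matrices of size \<open>k\<close>.\<close>

definition noncentral :: "nat \<Rightarrow> nat \<Rightarrow> (nat \<times> nat) set" where
  "noncentral k r = {(r, s) | s. r + 1 \<le> s \<and> s \<le> k - r} \<union>
                    {(q, k - r + 1) | q. r + 1 \<le> q \<and> q \<le> k - r}"

definition E_central :: "nat \<Rightarrow> ('n::{finite,linorder}) sqmat" where
  "E_central r = E r (CARD('n) - r + 1)"

definition z_lie :: "nat \<Rightarrow> ('n::{finite,linorder}) sqmat set" where
  "z_lie r = span {E_central r}"

definition m_lie :: "nat \<Rightarrow> ('n::{finite,linorder}) sqmat set" where
  "m_lie r = span (insert (E_central r) ((\<lambda>(i, j). E i j) ` noncentral CARD('n) r))"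

definition n_lie :: "nat \<Rightarrow> ('n::{finite,linorder}) sqmat set" where
  "n_lie r = span (\<Union>k\<in>{1..r}. m_lie k)"

definition Z_grp :: "nat \<Rightarrow> ('n::{finite,linorder}) sqmat set" where
  "Z_grp r = analytic_subgroup (z_lie r)"

definition M_grp :: "nat \<Rightarrow> ('n::{finite,linorder}) sqmat set" where
  "M_grp r = analytic_subgroup (m_lie r)"

definition N_grp :: "nat \<Rightarrow> ('n::{finite,linorder}) sqmat set" where
  "N_grp r = analytic_subgroup (n_lie r)"

text \<open>
  The functional \<open>\<lambda>\<^sub>1 + \<dots> + \<lambda>\<^sub>r\<close>, where each \<open>\<lambda>\<^sub>k\<close> is given as a number and extended by \<open>0\<close> to the other
  matrix units: the inner product with a matrix unit is the corresponding entry.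
\<close>

definition sum_functional :: "(nat \<Rightarrow> real) \<Rightarrow> nat \<Rightarrow> ('n::{finite,linorder}) sqmat \<Rightarrow> real" where
  "sum_functional l r A = (\<Sum>k=1..r. l k * (E_central k \<bullet> A))"


section \<open>Coset spaces and measures on them\<close>

definition left_cosets :: "('n::finite) sqmat set \<Rightarrow> 'n sqmat set \<Rightarrow> 'n sqmat set set" where
  "left_cosets G Z = (\<lambda>x. (\<lambda>z. x ** z) ` Z) ` G"

definition right_cosets :: "('n::finite) sqmat set \<Rightarrow> 'n sqmat set \<Rightarrow> 'n sqmat set set" where
  "right_cosets P G = (\<lambda>x. (\<lambda>p. p ** x) ` P) ` G"

text \<open>The quotient Borel structure on a set of cosets.\<close>

definition coset_borel :: "('n::finite) sqmat set set \<Rightarrow> 'n sqmat set measure" where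
  "coset_borel Q = sigma Q {A. A \<subseteq> Q \<and> \<Union>A \<in> sets borel}"

text \<open>
  The invariant measure on \<open>M\<^sub>r/Z\<^sub>r\<close>: Lebesgue measure in the coordinates given by the non-central
  matrix units. With this normalization, the formal degree of the representation of \<open>M\<^sub>r\<close> with central
  character \<open>exp \<zeta> \<mapsto> exp (2\<pi>i \<lambda>\<^sub>r(\<zeta>))\<close> is \<open>|\<lambda>\<^sub>r|\<close> to the power \<open>\<ell> - 2r\<close>.
\<close>

definition MZ_measure :: "nat \<Rightarrow> ('n::{finite,linorder}) sqmat set measure" where
  "MZ_measure r =
     distr (\<Pi>\<^sub>M p\<in>noncentral CARD('n) r. lborel)
       (coset_borel (left_cosets (M_grp r) (Z_grp r)))
       (\<lambda>c. (\<lambda>z. mexp (\<Sum>(i, j)\<in>noncentral CARD('n) r. c (i, j) *\<^sub>R E i j) ** z) ` Z_grp r)"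

text \<open>\<open>N/S = (M\<^sub>1/Z\<^sub>1) \<times> \<dots> \<times> (M\<^sub>m/Z\<^sub>m)\<close>, where \<open>S = Z\<^sub>1 \<cdots> Z\<^sub>m\<close> and \<open>m = \<lfloor>\<ell>/2\<rfloor>\<close>.\<close>

definition NS_measure :: "(nat \<Rightarrow> ('n::{finite,linorder}) sqmat set) measure" where
  "NS_measure = (\<Pi>\<^sub>M r\<in>{1..CARD('n) div 2}. MZ_measure r)"

text \<open>
  Although \<open>|\<langle>u, \<pi>(x)v\<rangle>|\<close> is constant on the cosets of \<open>Z\<^sub>r\<close> for the representations of \<open>M\<^sub>r\<close>, in general
  \<open>|\<langle>z, \<pi>\<^sub>\<lambda>(x)w\<rangle>|\<close> is not constant on the cosets of \<open>S\<close> in \<open>N\<close>, because \<open>Z\<^sub>r\<close> is not central in \<open>N\<close> for \<open>r > 1\<close>.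
  A function on \<open>N\<close> is integrated over \<open>N/S\<close> through Borel choices of representatives
  \<open>x\<^sub>r \<in> M\<^sub>r\<close> of the factors in \<open>M\<^sub>r/Z\<^sub>r\<close>, by evaluating it at \<open>x\<^sub>1 x\<^sub>2 \<cdots> x\<^sub>m\<close>.
\<close>

definition borel_section ::
  "nat \<Rightarrow> (('n::{finite,linorder}) sqmat set \<Rightarrow> 'n sqmat) \<Rightarrow> bool" where
  "borel_section r s \<longleftrightarrow> s \<in> borel_measurable (MZ_measure r) \<and>
     (\<forall>C\<in>left_cosets (M_grp r) (Z_grp r). s C \<in> C)"

primrec ordered_prod :: "(nat \<Rightarrow> ('n::finite) sqmat) \<Rightarrow> nat \<Rightarrow> 'n sqmat" where
  "ordered_prod x 0 = mat 1"
| "ordered_prod x (Suc r) = ordered_prod x r ** x (Suc r)"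

definition on_NS :: "(nat \<Rightarrow> ('n::{finite,linorder}) sqmat set \<Rightarrow> 'n sqmat) \<Rightarrow>
    ('n sqmat \<Rightarrow> complex) \<Rightarrow> (nat \<Rightarrow> 'n sqmat set) \<Rightarrow> complex" where
  "on_NS s f = (\<lambda>C. f (ordered_prod (\<lambda>r. s r (C r)) (CARD('n) div 2)))"

definition in_L2 :: "'a measure \<Rightarrow> ('a \<Rightarrow> complex) \<Rightarrow> bool" where
  "in_L2 M f \<longleftrightarrow> f \<in> borel_measurable M \<and> integrable M (\<lambda>x. (cmod (f x))\<^sup>2)"

definition L2_norm :: "'a measure \<Rightarrow> ('a \<Rightarrow> complex) \<Rightarrow> real" where
  "L2_norm M f = sqrt (LINT x|M. (cmod (f x))\<^sup>2)"


section \<open>Unitary representations\<close>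

definition unitary_rep :: "('n::finite) sqmat set \<Rightarrow> 'h::complex_hilbert_space set \<Rightarrow>
    ('n sqmat \<Rightarrow> 'h \<Rightarrow> 'h) \<Rightarrow> bool" where
  "unitary_rep G H \<pi> \<longleftrightarrow> closed_csubspace H \<and>
     (\<forall>x\<in>G. \<pi> x ` H = H \<and>
        (\<forall>u\<in>H. \<forall>v\<in>H. \<pi> x (u + v) = \<pi> x u + \<pi> x v) \<and>
        (\<forall>c. \<forall>u\<in>H. \<pi> x (c *\<^sub>C u) = c *\<^sub>C \<pi> x u) \<and>
        (\<forall>u\<in>H. norm (\<pi> x u) = norm u)) \<and>
     (\<forall>x\<in>G. \<forall>y\<in>G. \<forall>u\<in>H. \<pi> (x ** y) u = \<pi> x (\<pi> y u)) \<and>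
     (\<forall>u\<in>H. continuous_on G (\<lambda>x. \<pi> x u))"

definition irreducible_unitary_rep :: "('n::finite) sqmat set \<Rightarrow>
    'h::complex_hilbert_space set \<Rightarrow> ('n sqmat \<Rightarrow> 'h \<Rightarrow> 'h) \<Rightarrow> bool" where
  "irreducible_unitary_rep G H \<pi> \<longleftrightarrow> unitary_rep G H \<pi> \<and> H \<noteq> {0} \<and>
     (\<forall>W. closed_csubspace W \<and> W \<subseteq> H \<and> (\<forall>x\<in>G. \<pi> x ` W \<subseteq> W) \<longrightarrow> W = {0} \<or> W = H)"

definition matrix_coeff :: "('g \<Rightarrow> 'h::complex_hilbert_space \<Rightarrow> 'h) \<Rightarrow> 'h \<Rightarrow> 'h \<Rightarrow> 'g \<Rightarrow> complex" where
  "matrix_coeff \<pi> z w x = cinner z (\<pi> x w)"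

text \<open>\<open>(H, \<pi>)\<close> is the representation \<open>\<pi>\<^bsub>\<lambda>\<^sub>r\<^esub>\<close> of \<open>M\<^sub>r\<close>, where \<open>l\<close> is the number \<open>\<lambda>\<^sub>r\<close>.\<close>

definition heisenberg_rep :: "nat \<Rightarrow> real \<Rightarrow> 'h::complex_hilbert_space set \<Rightarrow>
    (('n::{finite,linorder}) sqmat \<Rightarrow> 'h \<Rightarrow> 'h) \<Rightarrow> bool" where
  "heisenberg_rep r l H \<pi> \<longleftrightarrow> irreducible_unitary_rep (M_grp r) H \<pi> \<and>
     (\<forall>t. \<forall>u\<in>H. \<pi> (mexp (t *\<^sub>R E_central r)) u = cis (2 * pi * (l * t)) *\<^sub>C u)"

text \<open>
  The integrand does not depend on the representative of the coset \<open>C\<close>, as \<open>Z\<^sub>r\<close> acts by scalars of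
  modulus one.
\<close>

definition formal_degree :: "nat \<Rightarrow> 'h::complex_hilbert_space set \<Rightarrow>
    (('n::{finite,linorder}) sqmat \<Rightarrow> 'h \<Rightarrow> 'h) \<Rightarrow> real" where
  "formal_degree r H \<pi> = (THE d. d > 0 \<and> (\<forall>u\<in>H. \<forall>v\<in>H.
     integrable (MZ_measure r) (\<lambda>C. (cmod (matrix_coeff \<pi> u v (SOME x. x \<in> C)))\<^sup>2) \<and>
     (LINT C|MZ_measure r. (cmod (matrix_coeff \<pi> u v (SOME x. x \<in> C)))\<^sup>2)
       = (norm u)\<^sup>2 * (norm v)\<^sup>2 / d))"


section \<open>Kirillov's representation attached to a functional\<close>

text \<open>A polarization: a subalgebra of \<open>\<gg>\<close> that is maximal isotropic for \<open>(X, Y) \<mapsto> f [X, Y]\<close>.\<close>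

definition polarization :: "('n::finite) sqmat set \<Rightarrow> ('n sqmat \<Rightarrow> real) \<Rightarrow>
    'n sqmat set \<Rightarrow> bool" where
  "polarization \<gg> f \<pp> \<longleftrightarrow> subspace \<pp> \<and> \<pp> \<subseteq> \<gg> \<and>
     (\<forall>X\<in>\<pp>. \<forall>Y\<in>\<pp>. bracket X Y \<in> \<pp> \<and> f (bracket X Y) = 0) \<and>
     (\<forall>X\<in>\<gg>. (\<forall>Y\<in>\<pp>. f (bracket X Y) = 0) \<longrightarrow> X \<in> \<pp>)"

text \<open>\<open>\<mu>\<close> is a nonzero \<open>G\<close>-invariant Radon measure on \<open>P\G\<close>.\<close>

definition invariant_coset_measure :: "('n::finite) sqmat set \<Rightarrow> 'n sqmat set \<Rightarrow>
    'n sqmat set measure \<Rightarrow> bool" where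
  "invariant_coset_measure P G \<mu> \<longleftrightarrow>
     sets \<mu> = sets (coset_borel (right_cosets P G)) \<and>
     emeasure \<mu> (space \<mu>) \<noteq> 0 \<and>
     (\<forall>K. compact K \<and> K \<subseteq> G \<longrightarrow> emeasure \<mu> (right_cosets P K) < \<infinity>) \<and>
     (\<forall>g\<in>G. \<forall>A\<in>sets \<mu>. emeasure \<mu> ((\<lambda>C. (\<lambda>x. x ** g) ` C) ` A) = emeasure \<mu> A)"

text \<open>
  The functions \<open>\<phi>\<close> on \<open>G\<close> with \<open>\<phi>(px) = \<chi>(p)\<phi>(x)\<close> for \<open>p \<in> P = exp \<pp>\<close>, where \<open>\<chi>(exp X) = exp (2\<pi>i f(X))\<close>,
  and \<open>|\<phi>|\<^sup>2\<close> integrable over \<open>P\G\<close>; the latter function is constant on the cosets.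
\<close>

definition induced_functions :: "('n::finite) sqmat set \<Rightarrow> 'n sqmat set \<Rightarrow>
    ('n sqmat \<Rightarrow> real) \<Rightarrow> 'n sqmat set measure \<Rightarrow> ('n sqmat \<Rightarrow> complex) set" where
  "induced_functions G \<pp> f \<mu> = {\<phi>. \<phi> \<in> borel_measurable (restrict_space borel G) \<and>
     (\<forall>X\<in>\<pp>. \<forall>x\<in>G. \<phi> (mexp X ** x) = cis (2 * pi * f X) * \<phi> x) \<and>
     integrable \<mu> (\<lambda>C. (cmod (\<phi> (SOME x. x \<in> C)))\<^sup>2)}"

text \<open>
  \<open>(H, \<pi>)\<close> is unitarily equivalent, via \<open>V\<close>, to the representation of \<open>G\<close> induced from the character
  \<open>\<chi>\<close> of \<open>P\<close>, i.e. to right translation on the above functions modulo equality almost everywhere.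
\<close>

definition equiv_induced :: "('n::finite) sqmat set \<Rightarrow> 'n sqmat set \<Rightarrow>
    ('n sqmat \<Rightarrow> real) \<Rightarrow> 'h::complex_hilbert_space set \<Rightarrow> ('n sqmat \<Rightarrow> 'h \<Rightarrow> 'h) \<Rightarrow> bool" where
  "equiv_induced G \<pp> f H \<pi> \<longleftrightarrow> (\<exists>\<mu> V.
     invariant_coset_measure (analytic_subgroup \<pp>) G \<mu> \<and>
     (\<forall>u\<in>H. V u \<in> induced_functions G \<pp> f \<mu>) \<and>
     (\<forall>u\<in>H. \<forall>v\<in>H. AE C in \<mu>. \<forall>x\<in>C. V (u + v) x = V u x + V v x) \<and>
     (\<forall>c. \<forall>u\<in>H. AE C in \<mu>. \<forall>x\<in>C. V (c *\<^sub>C u) x = c * V u x) \<and>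
     (\<forall>u\<in>H. (LINT C|\<mu>. (cmod (V u (SOME x. x \<in> C)))\<^sup>2) = (norm u)\<^sup>2) \<and>
     (\<forall>\<phi>\<in>induced_functions G \<pp> f \<mu>. \<exists>u\<in>H. AE C in \<mu>. \<forall>x\<in>C. V u x = \<phi> x) \<and>
     (\<forall>g\<in>G. \<forall>u\<in>H. AE C in \<mu>. \<forall>x\<in>C. V (\<pi> g u) x = V u (x ** g)))"

definition kirillov_rep :: "('n::finite) sqmat set \<Rightarrow> ('n sqmat \<Rightarrow> real) \<Rightarrow>
    'h::complex_hilbert_space set \<Rightarrow> ('n sqmat \<Rightarrow> 'h \<Rightarrow> 'h) \<Rightarrow> bool" where
  "kirillov_rep \<gg> f H \<pi> \<longleftrightarrow> irreducible_unitary_rep (analytic_subgroup \<gg>) H \<pi> \<and>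
     (\<exists>\<pp>. polarization \<gg> f \<pp> \<and> equiv_induced (analytic_subgroup \<gg>) \<pp> f H \<pi>)"


section \<open>The stepwise construction\<close>

text \<open>
  \<open>stepwise_rep l H \<pi> r K \<rho>\<close>: the representation \<open>\<rho>\<close> of \<open>N\<^sub>r\<close> on \<open>K\<close> is \<open>\<pi>\<^bsub>\<lambda>\<^sub>1 + \<dots> + \<lambda>\<^sub>r\<^esub>\<close>, built from the
  representations \<open>\<pi>\<^bsub>\<lambda>\<^sub>k\<^esub>\<close> of \<open>M\<^sub>k\<close> given by the families \<open>H k\<close> and \<open>\<pi> k\<close>. In the step, \<open>\<rho>'\<close> is the
  extension of \<open>\<rho>\<close> to \<open>N\<^bsub>r+1\<^esub>\<close>. Its elements are written \<open>n ** y\<close> with \<open>n \<in> N\<^sub>r\<close> and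
  \<open>y \<in> M\<^bsub>r+1\<^esub>\<close>, so that \<open>y\<close> is the image under \<open>N\<^bsub>r+1\<^esub>/N\<^sub>r \<cong> M\<^bsub>r+1\<^esub>\<close>. The trivial case only serves
  matrices of size \<open>\<ell> = 1\<close>, where \<open>m = 0\<close> and \<open>N\<close> is trivial.
\<close>

inductive stepwise_rep :: "(nat \<Rightarrow> real) \<Rightarrow> (nat \<Rightarrow> 'h::complex_hilbert_space set) \<Rightarrow>
    (nat \<Rightarrow> ('n::{finite,linorder}) sqmat \<Rightarrow> 'h \<Rightarrow> 'h) \<Rightarrow>
    nat \<Rightarrow> 'h set \<Rightarrow> ('n sqmat \<Rightarrow> 'h \<Rightarrow> 'h) \<Rightarrow> bool"
  for l :: "nat \<Rightarrow> real" and H :: "nat \<Rightarrow> 'h set"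
    and \<pi> :: "nat \<Rightarrow> 'n sqmat \<Rightarrow> 'h \<Rightarrow> 'h"
where
  trivial: "irreducible_unitary_rep (N_grp 0) K \<rho> \<Longrightarrow> stepwise_rep l H \<pi> 0 K \<rho>"
| first: "stepwise_rep l H \<pi> 1 (H 1) (\<pi> 1)"
| step: "\<lbrakk>stepwise_rep l H \<pi> r K \<rho>; 1 \<le> r;
     kirillov_rep (n_lie (r + 1)) (sum_functional l r) K \<rho>';
     \<forall>x\<in>N_grp r. \<forall>u\<in>K. \<rho>' x u = \<rho> x u;
     hilbert_tensor K (H (r + 1)) K' t;
     unitary_rep (N_grp (r + 1)) K' \<sigma>;
     \<forall>n\<in>N_grp r. \<forall>y\<in>M_grp (r + 1). \<forall>a\<in>K. \<forall>b\<in>H (r + 1).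
       \<sigma> (n ** y) (t a b) = t (\<rho>' (n ** y) a) (\<pi> (r + 1) y b)\<rbrakk>
   \<Longrightarrow> stepwise_rep l H \<pi> (r + 1) K' \<sigma>"

definition stepwise_degree :: "(nat \<Rightarrow> 'h::complex_hilbert_space set) \<Rightarrow>
    (nat \<Rightarrow> ('n::{finite,linorder}) sqmat \<Rightarrow> 'h \<Rightarrow> 'h) \<Rightarrow> real" where
  "stepwise_degree H \<pi> = (\<Prod>r=1..CARD('n) div 2. formal_degree r (H r) (\<pi> r))"

end

theory Submission
  imports Defs "HOL-Probability.Characteristic_Functions" "HOL-Real_Asymp.Real_Asymp"
begin

text \<open>
  For a Heisenberg group, the operators \<open>W(c) = \<pi>(exp (\<Sum> c\<^sub>p E\<^sub>p))\<close> form an irreducible Weyl system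
  \<open>W(x) W(y) = e\<^bsup>\<pi>i\<lambda>\<omega>(x,y)\<^esup> W(x + y)\<close>. As in von Neumann's proof of the Stone-von Neumann theorem, a Gaussian average
  of the \<open>W(x)\<close> produces a unit vector \<open>e\<close> with \<open>\<langle>e, W(y)e\<rangle> = e\<^bsup>-\<pi>|\<lambda>||y|\<^sup>2/2\<^esup>\<close>. The vectors \<open>W(p)e\<close> span a dense
  subspace, and the orthogonality relations for them are explicit Gaussian integrals; this yields the formal
  degree \<open>|\<lambda>|\<^bsup>\<ell>-2r\<^esup>\<close> without any model of the representation.

  In the step from \<open>N\<^sub>r\<close> to \<open>N\<^bsub>r+1\<^esub>\<close>, the coefficient of \<open>a \<otimes> b\<close> and \<open>c \<otimes> d\<close> at \<open>n y\<close> is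
  \<open>\<langle>a, \<rho>(n) \<rho>'(y) c\<rangle> \<langle>b, \<pi>(y) d\<rangle>\<close>. The integral over \<open>n\<close> does not depend on \<open>y\<close>, since \<open>\<rho>'(y)\<close> is unitary, so the
  relations multiply. Only the unitarity of the extension \<open>\<rho>'\<close> matters, not its construction. Irreducibility of the
  result is a consequence of the relations.
\<close>

section \<open>Complex Hilbert spaces\<close>

text \<open>The Gaussian average of the Weyl operators is formed weakly, as a bounded form that the
  Riesz theorem turns into a vector, so only scalar integrals occur. Its Gaussian has the width for
  which a shift and a Fourier transform contribute equal exponents. Averaging twice then reproduces
  the average, and the constant \<kappa> that normalises it is the formal degree. Without a model,
  vectors are reached only through spans and closures, so the orthogonality relations are kept in
  two forms: the polarised form passes from generators to linear combinations, the form with squared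
  moduli passes to closures. The obstacle in the induction is that another representative of a coset
  in M_{r+1}/Z_{r+1} alters the extension \<open>\<rho>'\<close> by a unitary operator that need not
  be scalar. The relations are therefore proved for all Borel sections at once, and the integral
  over the earlier factors is the inner one.\<close>

lemma cinner_add_right: "cinner x (y + z) = cinner x y + cinner x (z::'a::complex_hilbert_space)"
  by (metis cinner_add_left cinner_commute complex_cnj_add)

lemma cinner_scaleC_right: "cinner x (c *\<^sub>C y) = cnj c * cinner x (y::'a::complex_hilbert_space)"
  by (metis cinner_commute cinner_scaleC_left complex_cnj_mult)

lemma scaleC_one [simp]: "1 *\<^sub>C x = (x::'a::complex_hilbert_space)"
  by (metis of_real_1 scaleR_one scaleR_scaleC)

lemma scaleC_zero_left [simp]: "0 *\<^sub>C x = (0::'a::complex_hilbert_space)"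
  by (metis of_real_0 scaleR_zero_left scaleR_scaleC)

lemma scaleC_minus_one: "(-1) *\<^sub>C x = - (x::'a::complex_hilbert_space)"
  by (metis of_real_1 of_real_minus scaleR_minus1_left scaleR_scaleC)

lemma scaleC_zero_right [simp]: "c *\<^sub>C 0 = (0::'a::complex_hilbert_space)"
  by (metis scaleC_scaleC scaleC_zero_left mult_zero_right)

lemma cinner_zero_left [simp]: "cinner 0 (x::'a::complex_hilbert_space) = 0"
  by (metis cinner_scaleC_left mult_zero_left scaleC_zero_left)

lemma cinner_zero_right [simp]: "cinner (x::'a::complex_hilbert_space) 0 = 0"
  by (metis cinner_commute cinner_zero_left complex_cnj_zero)

lemma cinner_diff_left: "cinner (x - y) z = cinner x z - cinner y (z::'a::complex_hilbert_space)"
  by (metis add_diff_cancel cinner_add_left diff_add_cancel)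

lemma cinner_diff_right: "cinner x (y - z) = cinner x y - cinner x (z::'a::complex_hilbert_space)"
  by (metis add_diff_cancel cinner_add_right diff_add_cancel)

lemma cinner_self: "cinner x x = complex_of_real ((norm (x::'a::complex_hilbert_space))\<^sup>2)"
proof -
  have "Im (cinner x x) = 0"
    using arg_cong[OF cinner_commute[of x x], of Im] by simp
  then show ?thesis
    by (simp add: complex_eq_iff power2_norm_eq_inner inner_eq_Re_cinner)
qed

lemma norm_scaleC: "norm (c *\<^sub>C x) = cmod c * norm (x::'a::complex_hilbert_space)"
proof -
  have "complex_of_real ((norm (c *\<^sub>C x))\<^sup>2) = (c * cnj c) * cinner x x"
    unfolding cinner_self[symmetric] by (simp add: cinner_scaleC_left cinner_scaleC_right)
  also have "\<dots> = complex_of_real ((cmod c * norm x)\<^sup>2)"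
    by (simp add: complex_norm_square[symmetric] cinner_self power_mult_distrib)
  finally have "(norm (c *\<^sub>C x))\<^sup>2 = (cmod c * norm x)\<^sup>2"
    using of_real_eq_iff by blast
  then show ?thesis by (metis norm_ge_zero mult_nonneg_nonneg power2_eq_imp_eq)
qed

text \<open>A unimodular factor \<open>c\<close> makes the Hermitian product real and nonnegative;
  the Cauchy-Schwarz inequality of the real inner product then applies to
  \<open>c *\<^sub>C x\<close>, whose norm is that of \<open>x\<close>.\<close>

lemma cmod_cinner_le: "cmod (cinner x y) \<le> norm x * norm (y::'a::complex_hilbert_space)"
proof (cases "cinner x y = 0")
  case False
  define c where "c = cnj (cinner x y) / complex_of_real (cmod (cinner x y))"
  have "cmod c = 1" using False by (simp add: c_def norm_divide)
  have "c * cinner x y = complex_of_real (cmod (cinner x y))"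
    using False complex_norm_square[of "cinner x y"]
    by (simp add: c_def power2_eq_square field_simps)
  then have "cmod (cinner x y) = inner (c *\<^sub>C x) y"
    by (simp add: inner_eq_Re_cinner cinner_scaleC_left)
  also have "\<dots> \<le> norm (c *\<^sub>C x) * norm y" by (rule norm_cauchy_schwarz)
  also have "\<dots> = norm x * norm y" by (simp add: norm_scaleC \<open>cmod c = 1\<close>)
  finally show ?thesis .
qed simp

lemma tendsto_cinner:
  assumes "(f \<longlongrightarrow> a) F" "(g \<longlongrightarrow> (b::'a::complex_hilbert_space)) F"
  shows "((\<lambda>x. cinner (f x) (g x)) \<longlongrightarrow> cinner a b) F"
proof -
  have "bounded_bilinear (cinner :: 'a \<Rightarrow> 'a \<Rightarrow> complex)"
  proof
    show "\<exists>K. \<forall>a b::'a. norm (cinner a b) \<le> norm a * norm b * K"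
      by (rule exI[of _ 1]) (simp add: cmod_cinner_le)
  qed (simp_all add: cinner_add_left cinner_add_right scaleR_scaleC cinner_scaleC_left
        cinner_scaleC_right scaleR_conv_of_real)
  from bounded_bilinear.tendsto[OF this assms] show ?thesis .
qed

lemma tendsto_scaleC:
  assumes "(f \<longlongrightarrow> (a::'a::complex_hilbert_space)) F"
  shows "((\<lambda>x. c *\<^sub>C f x) \<longlongrightarrow> c *\<^sub>C a) F"
proof -
  have "bounded_linear (\<lambda>x::'a. c *\<^sub>C x)"
  proof
    show "\<exists>K. \<forall>x::'a. norm (c *\<^sub>C x) \<le> norm x * K"
      by (rule exI[of _ "cmod c"]) (simp add: norm_scaleC)
  qed (simp_all add: scaleC_add_right scaleR_scaleC scaleC_scaleC mult.commute)
  from bounded_linear.tendsto[OF this assms] show ?thesis .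
qed

lemma csubspace_0: "csubspace H \<Longrightarrow> 0 \<in> H"
  and csubspace_add: "csubspace H \<Longrightarrow> u \<in> H \<Longrightarrow> v \<in> H \<Longrightarrow> u + v \<in> H"
  and csubspace_scaleC: "csubspace H \<Longrightarrow> u \<in> H \<Longrightarrow> c *\<^sub>C u \<in> H"
  by (auto simp: csubspace_def)

lemma csubspace_scaleR: "csubspace H \<Longrightarrow> u \<in> H \<Longrightarrow> r *\<^sub>R u \<in> H"
  by (simp add: scaleR_scaleC csubspace_scaleC)

lemma csubspace_diff: "csubspace H \<Longrightarrow> u \<in> H \<Longrightarrow> v \<in> H \<Longrightarrow> u - v \<in> H"
  using csubspace_add[of H u "(-1) *\<^sub>C v"] csubspace_scaleC[of H v "-1"]
  by (simp add: scaleC_minus_one)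

lemma csubspace_closure:
  assumes "csubspace H" shows "csubspace (closure H)"
  unfolding csubspace_def
proof (intro conjI ballI allI)
  show "0 \<in> closure H" using assms csubspace_0 closure_subset by blast
  fix u c assume "u \<in> closure H"
  then obtain f where f: "\<And>n. f n \<in> H" "f \<longlonglongrightarrow> u" by (auto simp: closure_sequential)
  have "(\<lambda>n. c *\<^sub>C f n) \<longlonglongrightarrow> c *\<^sub>C u" using f by (intro tendsto_scaleC)
  then show "c *\<^sub>C u \<in> closure H"
    unfolding closure_sequential using f csubspace_scaleC[OF assms]
    by (intro exI[of _ "\<lambda>n. c *\<^sub>C f n"]) auto
  fix v assume "v \<in> closure H"
  then obtain g where g: "\<And>n. g n \<in> H" "g \<longlonglongrightarrow> v" by (auto simp: closure_sequential)
  have "(\<lambda>n. f n + g n) \<longlonglongrightarrow> u + v" using f g by (intro tendsto_add)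
  then show "u + v \<in> closure H"
    unfolding closure_sequential using f g csubspace_add[OF assms]
    by (intro exI[of _ "\<lambda>n. f n + g n"]) auto
qed

lemma csubspace_hull: "csubspace (csubspace hull T)"
  by (rule hull_in) (auto simp: csubspace_def)

section \<open>Riesz representation, orthogonal vectors and polarisation\<close>

text \<open>Minimisation of |v|^2 - 2 Re (\<phi> v) over \<open>H\<close>: for a representing vector
  e this equals |v - e|^2 - |e|^2, so the minimiser is e. Completeness and closedness enter through
  a minimising sequence.\<close>

theorem riesz_representation:
  fixes H :: "'h::complex_hilbert_space set" and \<phi> :: "'h \<Rightarrow> complex"
  assumes H: "closed_csubspace H"
    and add: "\<And>u v. u \<in> H \<Longrightarrow> v \<in> H \<Longrightarrow> \<phi> (u + v) = \<phi> u + \<phi> v"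
    and scale: "\<And>c u. u \<in> H \<Longrightarrow> \<phi> (c *\<^sub>C u) = c * \<phi> u"
    and bound: "\<And>u. u \<in> H \<Longrightarrow> cmod (\<phi> u) \<le> C * norm u"
  obtains e where "e \<in> H" "\<And>v. v \<in> H \<Longrightarrow> \<phi> v = cinner v e"
proof -
  have sub: "csubspace H" and "closed H" using H by (auto simp: closed_csubspace_def)
  have scaleR: "\<phi> (r *\<^sub>R u) = r *\<^sub>R \<phi> u" if "u \<in> H" for r u
    using scale[OF that] by (simp add: scaleR_scaleC scaleR_conv_of_real)
  have diff: "\<phi> (u - v) = \<phi> u - \<phi> v" if "u \<in> H" "v \<in> H" for u v
    using add[of u "(-1) *\<^sub>C v"] scale[of v "-1"] that csubspace_scaleC[OF sub, of v "-1"]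
    by (simp add: scaleC_minus_one)
  define q where "q v = (norm v)\<^sup>2 - 2 * Re (\<phi> v)" for v
  define \<mu> where "\<mu> = Inf (q ` H)"
  have lower: "- C\<^sup>2 \<le> q v" if "v \<in> H" for v
  proof -
    have "Re (\<phi> v) \<le> C * norm v" using bound[OF that] complex_Re_le_cmod order_trans by blast
    moreover have "0 \<le> (norm v - C)\<^sup>2" by simp
    ultimately show ?thesis by (simp add: q_def power2_eq_square algebra_simps)
  qed
  then have bdd: "bdd_below (q ` H)" by (auto intro!: bdd_belowI)
  have \<mu>_le: "\<mu> \<le> q v" if "v \<in> H" for v
    unfolding \<mu>_def using bdd that by (auto intro: cInf_lower)
  have "\<exists>v\<in>H. q v < \<mu> + 1 / real (Suc n)" for n
  proof -
    have "Inf (q ` H) < \<mu> + 1 / real (Suc n)" unfolding \<mu>_def by (simp del: of_nat_Suc)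
    moreover have "q ` H \<noteq> {}" using csubspace_0[OF sub] by auto
    ultimately show ?thesis using cInf_lessD[of "q ` H"] by force
  qed
  then obtain x where x: "\<And>n. x n \<in> H" "\<And>n. q (x n) < \<mu> + 1 / real (Suc n)" by metis
  \<comment> \<open>The parallelogram law, combined with \<open>\<mu> \<le> q w\<close> at the
    midpoint \<open>w\<close>; it forces minimising sequences to be Cauchy.\<close>
  have par: "(norm (u - v))\<^sup>2 \<le> 2 * (q u - \<mu>) + 2 * (q v - \<mu>)" if uv: "u \<in> H" "v \<in> H" for u v
  proof -
    define w where "w = (1/2) *\<^sub>R (u + v)"
    have "w \<in> H" using uv sub by (simp add: w_def csubspace_scaleR csubspace_add)
    have "\<phi> w = (1/2) *\<^sub>R (\<phi> u + \<phi> v)"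
      unfolding w_def using uv sub by (simp add: scaleR csubspace_add add)
    moreover have "norm w = norm (u + v) / 2" by (simp add: w_def)
    ultimately have "4 * q w = (norm (u + v))\<^sup>2 - 4 * (Re (\<phi> u) + Re (\<phi> v))"
      by (simp add: q_def power2_eq_square field_simps)
    moreover have "(norm (u - v))\<^sup>2 + (norm (u + v))\<^sup>2 = 2 * (norm u)\<^sup>2 + 2 * (norm v)\<^sup>2"
      by (simp add: power2_norm_eq_inner inner_add inner_diff inner_commute)
    ultimately show ?thesis using \<mu>_le[OF \<open>w \<in> H\<close>] by (simp add: q_def)
  qed
  have "Cauchy x"
  proof (rule metric_CauchyI)
    fix \<epsilon> :: real assume "\<epsilon> > 0"
    then obtain N where N: "inverse (real (Suc N)) < \<epsilon>\<^sup>2 / 4" using reals_Archimedean[of "\<epsilon>\<^sup>2/4"] by auto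
    have *: "q (x n) - \<mu> < \<epsilon>\<^sup>2 / 4" if "n \<ge> N" for n
    proof -
      have "1 / real (Suc n) \<le> inverse (real (Suc N))" using that by (simp add: field_simps)
      then show ?thesis using x(2)[of n] N by linarith
    qed
    show "\<exists>M. \<forall>m\<ge>M. \<forall>n\<ge>M. dist (x m) (x n) < \<epsilon>"
    proof (intro exI[of _ N] allI impI)
      fix m n assume "N \<le> m" "N \<le> n"
      then have "(norm (x m - x n))\<^sup>2 < \<epsilon>\<^sup>2"
        using par[OF x(1) x(1), of m n] *[OF \<open>N \<le> m\<close>] *[OF \<open>N \<le> n\<close>] by argo
      then show "dist (x m) (x n) < \<epsilon>"
        using \<open>\<epsilon> > 0\<close> by (simp add: dist_norm power_less_imp_less_base)
    qed
  qed
  then obtain e where e: "x \<longlonglongrightarrow> e" using Cauchy_convergent convergent_def by blast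
  have "e \<in> H" using closed_sequentially[OF \<open>closed H\<close>] x(1) e by blast
  have \<phi>e: "(\<lambda>n. \<phi> (x n)) \<longlonglongrightarrow> \<phi> e"
  proof (rule LIM_zero_cancel, rule Lim_null_comparison)
    show "\<forall>\<^sub>F n in sequentially. norm (\<phi> (x n) - \<phi> e) \<le> C * norm (x n - e)"
      using bound[of "x _ - e"] diff[OF x(1) \<open>e \<in> H\<close>] csubspace_diff[OF sub x(1) \<open>e \<in> H\<close>] by (simp del: of_nat_Suc)
    show "(\<lambda>n. C * norm (x n - e)) \<longlonglongrightarrow> 0"
      using e by (auto intro!: tendsto_eq_intros simp: LIM_zero_iff tendsto_norm_zero)
  qed
  have "q e \<le> \<mu>"
  proof (rule LIMSEQ_le)
    show "(\<lambda>n. q (x n)) \<longlonglongrightarrow> q e" unfolding q_def using e \<phi>e by (intro tendsto_intros)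
    show "(\<lambda>n. \<mu> + 1 / real (Suc n)) \<longlonglongrightarrow> \<mu>"
      using LIMSEQ_inverse_real_of_nat_add[of \<mu>] by (simp add: inverse_eq_divide)
    show "\<exists>N. \<forall>n\<ge>N. q (x n) \<le> \<mu> + 1 / real (Suc n)" using x(2) less_imp_le by blast
  qed
  have Re_eq: "Re (\<phi> v) = Re (cinner v e)" if v: "v \<in> H" for v
  proof -
    define d where "d = inner v e - Re (\<phi> v)"
    \<comment> \<open>\<open>e\<close> minimises \<open>q\<close> on the real line through
      \<open>e\<close> in direction \<open>v\<close>. A quadratic in \<open>t\<close> without
      constant term that is nowhere negative has vanishing linear coefficient.\<close>
    have ineq: "0 \<le> t\<^sup>2 * (norm v)\<^sup>2 + 2 * t * d" for t
    proof -
      have "q e \<le> q (e + t *\<^sub>R v)"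
        using \<open>q e \<le> \<mu>\<close> \<mu>_le[of "e + t *\<^sub>R v"] v \<open>e \<in> H\<close> sub
        by (simp add: csubspace_add csubspace_scaleR)
      moreover have "\<phi> (e + t *\<^sub>R v) = \<phi> e + t *\<^sub>R \<phi> v"
        using v \<open>e \<in> H\<close> sub by (simp add: add scaleR csubspace_scaleR)
      moreover have "(norm (e + t *\<^sub>R v))\<^sup>2 = (norm e)\<^sup>2 + 2 * t * inner v e + t\<^sup>2 * (norm v)\<^sup>2"
        unfolding power2_norm_eq_inner
        by (simp add: inner_add inner_commute power2_eq_square algebra_simps)
      ultimately show ?thesis by (simp add: q_def d_def algebra_simps)
    qed
    have "d = 0"
    proof (rule ccontr)
      assume "d \<noteq> 0"
      show False
      proof (cases "norm v = 0")
        case True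
        have "0 < d * d" using \<open>d \<noteq> 0\<close> by (metis not_real_square_gt_zero)
        then show False using ineq[of "-d"] True by simp
      next
        case False
        have "0 \<le> (- d / (norm v)\<^sup>2)\<^sup>2 * (norm v)\<^sup>2 + 2 * (- d / (norm v)\<^sup>2) * d" by (rule ineq)
        also have "\<dots> = - (d\<^sup>2 / (norm v)\<^sup>2)" using False by (simp add: field_simps power2_eq_square)
        finally show False using \<open>d \<noteq> 0\<close> False by (simp add: divide_le_0_iff)
      qed
    qed
    then show ?thesis by (simp add: d_def inner_eq_Re_cinner)
  qed
  have "\<phi> v = cinner v e" if v: "v \<in> H" for v
  proof (rule complex_eqI)
    show "Re (\<phi> v) = Re (cinner v e)" by (rule Re_eq[OF v])
    \<comment> \<open>Variation along real multiples sees only real parts; the vector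
      \<open>\<i> *\<^sub>C v\<close> supplies the imaginary part.\<close>
    show "Im (\<phi> v) = Im (cinner v e)"
      using Re_eq[OF csubspace_scaleC[OF sub v, of \<i>]] scale[OF v, of \<i>]
      by (simp add: cinner_scaleC_left)
  qed
  then show thesis using that \<open>e \<in> H\<close> by blast
qed

text \<open>The vector \<open>w\<close> is the orthogonal projection of \<open>u\<close>, found as
  the Riesz vector of the functional \<open>\<lambda>v. cinner v u\<close> on
  \<open>W\<close>.\<close>

lemma orthogonal_vector_exists:
  assumes W: "closed_csubspace W" and u: "u \<notin> W"
  obtains w where "w \<in> W" "u - w \<noteq> 0" "\<And>v. v \<in> W \<Longrightarrow> cinner (u - w) v = 0"
proof -
  obtain w where w: "w \<in> W" "\<And>v. v \<in> W \<Longrightarrow> cinner v u = cinner v w"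
    using riesz_representation[OF W, of "\<lambda>v. cinner v u" "norm u"]
    by (auto simp: cinner_add_left cinner_scaleC_left cmod_cinner_le mult.commute)
  have "cinner (u - w) v = 0" if "v \<in> W" for v
    using w(2)[OF that] cinner_commute[of "u - w" v] by (simp add: cinner_diff_right)
  then show thesis using that w u by (metis right_minus_eq)
qed

text \<open>Polarisation: vanishing at \<open>u + v\<close> makes the form antisymmetric, and
  vanishing at \<open>u + \<i> *\<^sub>C v\<close> makes it symmetric, because the second slot is
  conjugate linear.\<close>

lemma sesquilinear_zero:
  fixes B :: "'h::complex_hilbert_space \<Rightarrow> 'h \<Rightarrow> complex"
  assumes H: "csubspace H"
    and "\<And>u u' v. u \<in> H \<Longrightarrow> u' \<in> H \<Longrightarrow> v \<in> H \<Longrightarrow> B (u + u') v = B u v + B u' v"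
    and "\<And>u v v'. u \<in> H \<Longrightarrow> v \<in> H \<Longrightarrow> v' \<in> H \<Longrightarrow> B u (v + v') = B u v + B u v'"
    and "\<And>c u v. u \<in> H \<Longrightarrow> v \<in> H \<Longrightarrow> B (c *\<^sub>C u) v = c * B u v"
    and "\<And>c u v. u \<in> H \<Longrightarrow> v \<in> H \<Longrightarrow> B u (c *\<^sub>C v) = cnj c * B u v"
    and diag: "\<And>u. u \<in> H \<Longrightarrow> B u u = 0"
    and u: "u \<in> H" and v: "v \<in> H"
  shows "B u v = 0"
proof -
  have *: "B u w + B w u = 0" if w: "w \<in> H" for w
    using diag[OF csubspace_add[OF H u w]] assms(2)[OF u w, of "u + w"] assms(3)[OF u u w]
      assms(3)[OF w u w] diag[OF u] diag[OF w] csubspace_add[OF H u w] by simp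
  have iv: "\<i> *\<^sub>C v \<in> H" using H v by (rule csubspace_scaleC)
  have "B u v + B v u = 0" by (rule *[OF v])
  moreover have "- \<i> * B u v + \<i> * B v u = 0"
    using *[OF iv] assms(4)[OF v u, of \<i>] assms(5)[OF u v, of \<i>] by simp
  then have "\<i> * (B v u - B u v) = 0" by (simp add: algebra_simps)
  ultimately show ?thesis by simp
qed

definition isometry_on :: "'h::complex_hilbert_space set \<Rightarrow> ('h \<Rightarrow> 'h) \<Rightarrow> bool" where
  "isometry_on H U \<longleftrightarrow> (\<forall>u\<in>H. U u \<in> H) \<and> (\<forall>u\<in>H. \<forall>v\<in>H. U (u + v) = U u + U v) \<and>
     (\<forall>c. \<forall>u\<in>H. U (c *\<^sub>C u) = c *\<^sub>C U u) \<and> (\<forall>u\<in>H. norm (U u) = norm u)"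

lemma isometry_on_in: "isometry_on H U \<Longrightarrow> u \<in> H \<Longrightarrow> U u \<in> H"
  and isometry_on_add: "isometry_on H U \<Longrightarrow> u \<in> H \<Longrightarrow> v \<in> H \<Longrightarrow> U (u + v) = U u + U v"
  and isometry_on_scaleC: "isometry_on H U \<Longrightarrow> u \<in> H \<Longrightarrow> U (c *\<^sub>C u) = c *\<^sub>C U u"
  and isometry_on_norm: "isometry_on H U \<Longrightarrow> u \<in> H \<Longrightarrow> norm (U u) = norm u"
  by (auto simp: isometry_on_def)

lemma isometry_on_diff:
  assumes "isometry_on H U" "csubspace H" "u \<in> H" "v \<in> H" shows "U (u - v) = U u - U v"
  using isometry_on_add[OF assms(1,3) csubspace_scaleC[OF assms(2,4), of "-1"]]
    isometry_on_scaleC[OF assms(1,4), of "-1"] by (simp add: scaleC_minus_one)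

lemma isometry_on_cinner:
  assumes U: "isometry_on H U" and H: "csubspace H" and u: "u \<in> H" and v: "v \<in> H"
  shows "cinner (U u) (U v) = cinner u v"
proof -
  have "cinner (U u) (U v) - cinner u v = 0"
    by (rule sesquilinear_zero[where B = "\<lambda>u v. cinner (U u) (U v) - cinner u v", OF H _ _ _ _ _ u v])
      (simp_all add: isometry_on_add[OF U] isometry_on_scaleC[OF U] cinner_add_left cinner_add_right
        cinner_scaleC_left cinner_scaleC_right cinner_self isometry_on_norm[OF U] right_diff_distrib)
  then show ?thesis by simp
qed


section \<open>Schur relations for families of isometries\<close>

text \<open>The integral is taken in the extended nonnegative reals, so that the equation includes
  finiteness. \<open>M\<close> is an arbitrary measure space because the relation occurs on
  coordinate space, on M_r/Z_r and on finite products of such quotients.\<close>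

definition schur_relation ::
  "'a measure \<Rightarrow> ('a \<Rightarrow> 'h \<Rightarrow> 'h) \<Rightarrow> 'h::complex_hilbert_space set \<Rightarrow> real \<Rightarrow> bool" where
  "schur_relation M U H C \<longleftrightarrow> (\<forall>u\<in>H. \<forall>v\<in>H. (\<lambda>x. cinner u (U x v)) \<in> borel_measurable M \<and>
     (\<integral>\<^sup>+x. ennreal ((cmod (cinner u (U x v)))\<^sup>2) \<partial>M) = ennreal (C * (norm u)\<^sup>2 * (norm v)\<^sup>2))"

lemma schur_relation_measurable:
  "schur_relation M U H C \<Longrightarrow> u \<in> H \<Longrightarrow> v \<in> H \<Longrightarrow> (\<lambda>x. cinner u (U x v)) \<in> borel_measurable M"
  by (auto simp: schur_relation_def)

lemma schur_relation_integral:
  assumes "schur_relation M U H C" "C \<ge> 0" "u \<in> H" "v \<in> H"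
  shows "integrable M (\<lambda>x. (cmod (cinner u (U x v)))\<^sup>2)"
    and "(LINT x|M. (cmod (cinner u (U x v)))\<^sup>2) = C * (norm u)\<^sup>2 * (norm v)\<^sup>2"
proof -
  have [measurable]: "(\<lambda>x. cinner u (U x v)) \<in> borel_measurable M"
    and eq: "(\<integral>\<^sup>+x. ennreal ((cmod (cinner u (U x v)))\<^sup>2) \<partial>M) = ennreal (C * (norm u)\<^sup>2 * (norm v)\<^sup>2)"
    using assms by (auto simp: schur_relation_def)
  show i: "integrable M (\<lambda>x. (cmod (cinner u (U x v)))\<^sup>2)"
    by (rule integrableI_nonneg) (auto simp: eq)
  show "(LINT x|M. (cmod (cinner u (U x v)))\<^sup>2) = C * (norm u)\<^sup>2 * (norm v)\<^sup>2"
    using eq nn_integral_eq_integral[OF i] \<open>C \<ge> 0\<close> by (simp add: ennreal_inj)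
qed

lemma borel_measurable_cnj: "cnj \<in> borel_measurable borel"
  by (intro borel_measurable_continuous_onI continuous_intros)

section \<open>The polarised relation and its extension to spans\<close>

text \<open>Schur orthogonality with four independent vectors. \<open>v\<close> stands in the
  conjugate linear slot of \<open>cinner\<close>, hence the order \<open>cinner v' v\<close> in the
  value.\<close>

definition schur_product ::
  "'a measure \<Rightarrow> ('a \<Rightarrow> 'h \<Rightarrow> 'h) \<Rightarrow> real \<Rightarrow> 'h::complex_hilbert_space \<Rightarrow> 'h \<Rightarrow> 'h \<Rightarrow> 'h \<Rightarrow> bool" where
  "schur_product M U C u u' v v' \<longleftrightarrow>
     has_bochner_integral M (\<lambda>x. cinner u (U x v) * cnj (cinner u' (U x v')))
       (of_real C * cinner u u' * cinner v' v)"

text \<open>Complex conjugation of the integrand. It reduces linearity in the second and fourth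
  vector to linearity in the first and third.\<close>

lemma schur_product_swap:
  assumes "schur_product M U C u u' v v'"
  shows "schur_product M U C u' u v' v"
proof -
  have "has_bochner_integral M (\<lambda>x. cnj (cinner u (U x v) * cnj (cinner u' (U x v'))))
     (cnj (of_real C * cinner u u' * cinner v' v))"
    using assms unfolding schur_product_def
    by (rule has_bochner_integral_bounded_linear[OF bounded_linear_cnj])
  then show ?thesis
    by (simp add: schur_product_def cinner_commute[of u' u] cinner_commute[of v v'] mult.commute)
qed

lemma csubspace_schur_product1:
  assumes "csubspace H"
  shows "csubspace {u\<in>H. schur_product M U C u u' v v'}"
  unfolding csubspace_def
proof (intro conjI ballI allI; clarsimp simp: csubspace_0 csubspace_add csubspace_scaleC assms)
  show "schur_product M U C 0 u' v v'" using has_bochner_integral_zero by (simp add: schur_product_def)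
  fix u c assume u: "schur_product M U C u u' v v'"
  show "schur_product M U C (c *\<^sub>C u) u' v v'"
    using has_bochner_integral_mult_right[OF u[unfolded schur_product_def], of c]
    by (simp add: schur_product_def cinner_scaleC_left ac_simps)
  fix w assume "schur_product M U C w u' v v'"
  from has_bochner_integral_add[OF u[unfolded schur_product_def] this[unfolded schur_product_def]]
  show "schur_product M U C (u + w) u' v v'"
    by (simp add: schur_product_def cinner_add_left algebra_simps)
qed

lemma csubspace_schur_product3:
  assumes H: "csubspace H" and U: "\<And>x. x \<in> space M \<Longrightarrow> isometry_on H (U x)"
  shows "csubspace {v\<in>H. schur_product M U C u u' v v'}"
  unfolding csubspace_def
proof (intro conjI ballI allI; clarsimp simp: csubspace_0 csubspace_add csubspace_scaleC H)
  have U0: "U x 0 = 0" if "x \<in> space M" for x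
    using isometry_on_norm[OF U[OF that] csubspace_0[OF H]] by simp
  have cong: "schur_product M U C u u' v v'"
    if "has_bochner_integral M f i" "\<And>x. x \<in> space M \<Longrightarrow> f x = cinner u (U x v) * cnj (cinner u' (U x v'))"
      "i = of_real C * cinner u u' * cinner v' v" for f i v
    using that by (simp add: schur_product_def cong: has_bochner_integral_cong)
  show "schur_product M U C u u' 0 v'"
    by (rule cong[OF has_bochner_integral_zero]) (simp_all add: U0)
  fix v c assume v: "v \<in> H" "schur_product M U C u u' v v'"
  show "schur_product M U C u u' (c *\<^sub>C v) v'"
    by (rule cong[OF has_bochner_integral_mult_right[OF v(2)[unfolded schur_product_def], of "cnj c"]])
      (simp_all add: isometry_on_scaleC[OF U v(1)] cinner_scaleC_right)
  fix w assume w: "w \<in> H" "schur_product M U C u u' w v'"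
  show "schur_product M U C u u' (v + w) v'"
    by (rule cong[OF has_bochner_integral_add[OF v(2)[unfolded schur_product_def] w(2)[unfolded schur_product_def]]])
      (simp_all add: isometry_on_add[OF U v(1) w(1)] cinner_add_right algebra_simps)
qed

lemma hull_induct_csubspace:
  assumes "csubspace {u\<in>H. P u}" "\<And>u. u \<in> T \<Longrightarrow> P u" "T \<subseteq> H" "u \<in> csubspace hull T"
  shows "P u"
proof -
  have "csubspace hull T \<subseteq> {u\<in>H. P u}" using assms by (intro hull_minimal) auto
  then show ?thesis using assms(4) by auto
qed

text \<open>One slot is extended at a time. After the first and the third, a swap brings the two
  slots still confined to \<open>T\<close> into these positions.\<close>

lemma schur_product_hull:
  assumes H: "csubspace H" and U: "\<And>x. x \<in> space M \<Longrightarrow> isometry_on H (U x)" and T: "T \<subseteq> H"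
    and S: "\<And>u u' v v'. u \<in> T \<Longrightarrow> u' \<in> T \<Longrightarrow> v \<in> T \<Longrightarrow> v' \<in> T \<Longrightarrow> schur_product M U C u u' v v'"
    and in_hull: "u \<in> csubspace hull T" "u' \<in> csubspace hull T" "v \<in> csubspace hull T" "v' \<in> csubspace hull T"
  shows "schur_product M U C u u' v v'"
proof -
  note ind1 = hull_induct_csubspace[OF csubspace_schur_product1[OF H] _ T]
  note ind3 = hull_induct_csubspace[OF csubspace_schur_product3[OF H U] _ T]
  have 1: "schur_product M U C u a b c" if "a \<in> T" "b \<in> T" "c \<in> T" for a b c
    using S that by (intro ind1[OF _ in_hull(1)])
  have 2: "schur_product M U C u a v c" if "a \<in> T" "c \<in> T" for a c
    using 1 that by (intro ind3[OF _ _ in_hull(3)])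
  have 3: "schur_product M U C u' u c v" if "c \<in> T" for c
    using 2 that by (intro ind1[OF _ in_hull(2)] schur_product_swap[of _ _ _ u])
  have "schur_product M U C u' u v' v"
    using 3 by (intro ind3[OF _ _ in_hull(4)])
  then show ?thesis by (rule schur_product_swap)
qed

section \<open>From a dense set to the whole Hilbert space\<close>

text \<open>Fatou's lemma gives only an upper bound, but gives it on all of \<open>H\<close>. This
  bound then controls the errors when the lower bound is obtained by approximation from
  \<open>D\<close>.\<close>

lemma schur_relation_closure:
  assumes H: "csubspace H" and U: "\<And>x. x \<in> space M \<Longrightarrow> isometry_on H (U x)"
    and D: "D \<subseteq> H" "H \<subseteq> closure D" and C: "C \<ge> 0" and S: "schur_relation M U D C"
  shows "schur_relation M U H C"
proof -
  have approx: "\<exists>f. (\<forall>n. f n \<in> D) \<and> f \<longlonglongrightarrow> u" if "u \<in> H" for u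
    using that D(2) by (auto simp: closure_sequential)
  have lim: "(\<lambda>n. cinner (f n) (U x (g n))) \<longlonglongrightarrow> cinner u (U x v)"
    if f: "\<And>n. f n \<in> H" "f \<longlonglongrightarrow> u" and g: "\<And>n. g n \<in> H" "g \<longlonglongrightarrow> v" and v: "v \<in> H" and x: "x \<in> space M"
    for f g u v x
  proof (rule tendsto_cinner[OF f(2)])
    have "norm (U x (g n) - U x v) = norm (g n - v)" for n
      using isometry_on_norm[OF U[OF x] csubspace_diff[OF H g(1) v]]
        isometry_on_diff[OF U[OF x] H g(1) v] by simp
    then show "(\<lambda>n. U x (g n)) \<longlonglongrightarrow> U x v"
      using g(2) by (simp add: tendsto_iff dist_norm)
  qed
  have meas: "(\<lambda>x. cinner u (U x v)) \<in> borel_measurable M" if u: "u \<in> H" and v: "v \<in> H" for u v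
  proof -
    obtain f g where fg: "\<And>n. f n \<in> D" "f \<longlonglongrightarrow> u" "\<And>n. g n \<in> D" "g \<longlonglongrightarrow> v"
      using approx[OF u] approx[OF v] by blast
    show ?thesis
    proof (rule borel_measurable_LIMSEQ_metric[where f = "\<lambda>n x. cinner (f n) (U x (g n))"])
      show "(\<lambda>x. cinner (f n) (U x (g n))) \<in> borel_measurable M" for n
        by (rule schur_relation_measurable[OF S fg(1,3)])
      show "(\<lambda>n. cinner (f n) (U x (g n))) \<longlonglongrightarrow> cinner u (U x v)" if "x \<in> space M" for x
        using fg D(1) by (intro lim[OF _ fg(2) _ fg(4) v that]) auto
    qed
  qed
  have le: "(\<integral>\<^sup>+x. ennreal ((cmod (cinner u (U x v)))\<^sup>2) \<partial>M) \<le> ennreal (C * (norm u)\<^sup>2 * (norm v)\<^sup>2)"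
    if u: "u \<in> H" and v: "v \<in> H" for u v
  proof -
    obtain f g where fg: "\<And>n. f n \<in> D" "f \<longlonglongrightarrow> u" "\<And>n. g n \<in> D" "g \<longlonglongrightarrow> v"
      using approx[OF u] approx[OF v] by blast
    have "(\<integral>\<^sup>+x. ennreal ((cmod (cinner u (U x v)))\<^sup>2) \<partial>M)
        = (\<integral>\<^sup>+x. liminf (\<lambda>n. ennreal ((cmod (cinner (f n) (U x (g n))))\<^sup>2)) \<partial>M)"
    proof (rule nn_integral_cong)
      fix x assume "x \<in> space M"
      then have "(\<lambda>n. ennreal ((cmod (cinner (f n) (U x (g n))))\<^sup>2)) \<longlonglongrightarrow> ennreal ((cmod (cinner u (U x v)))\<^sup>2)"
        using fg D(1) v by (intro tendsto_ennrealI tendsto_power tendsto_norm lim) auto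
      then show "ennreal ((cmod (cinner u (U x v)))\<^sup>2) = liminf (\<lambda>n. ennreal ((cmod (cinner (f n) (U x (g n))))\<^sup>2))"
        using lim_imp_Liminf by (metis trivial_limit_sequentially)
    qed
    also have "\<dots> \<le> liminf (\<lambda>n. \<integral>\<^sup>+x. ennreal ((cmod (cinner (f n) (U x (g n))))\<^sup>2) \<partial>M)"
    proof (rule nn_integral_liminf)
      fix n
      have [measurable]: "(\<lambda>x. cinner (f n) (U x (g n))) \<in> borel_measurable M"
        by (rule schur_relation_measurable[OF S fg(1,3)])
      show "(\<lambda>x. ennreal ((cmod (cinner (f n) (U x (g n))))\<^sup>2)) \<in> borel_measurable M"
        by measurable
    qed
    also have "\<dots> = liminf (\<lambda>n. ennreal (C * (norm (f n))\<^sup>2 * (norm (g n))\<^sup>2))"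
      using S fg by (simp add: schur_relation_def)
    also have "\<dots> = ennreal (C * (norm u)\<^sup>2 * (norm v)\<^sup>2)"
      using fg by (intro lim_imp_Liminf tendsto_ennrealI tendsto_intros) auto
    finally show ?thesis .
  qed
  have int: "integrable M (\<lambda>x. (cmod (cinner u (U x v)))\<^sup>2)"
    and int_le: "(LINT x|M. (cmod (cinner u (U x v)))\<^sup>2) \<le> C * (norm u)\<^sup>2 * (norm v)\<^sup>2"
    if u: "u \<in> H" and v: "v \<in> H" for u v
  proof -
    have [measurable]: "(\<lambda>x. cinner u (U x v)) \<in> borel_measurable M" by (rule meas[OF u v])
    show i: "integrable M (\<lambda>x. (cmod (cinner u (U x v)))\<^sup>2)"
      using le[OF u v] by (intro integrableI_nonneg) (auto simp: less_top[symmetric] top_unique)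
    show "(LINT x|M. (cmod (cinner u (U x v)))\<^sup>2) \<le> C * (norm u)\<^sup>2 * (norm v)\<^sup>2"
      using le[OF u v] nn_integral_eq_integral[OF i] C by simp
  qed
  have ge: "C * (norm u)\<^sup>2 * (norm v)\<^sup>2 \<le> (LINT x|M. (cmod (cinner u (U x v)))\<^sup>2)"
    if u: "u \<in> H" and v: "v \<in> H" for u v
  proof -
    obtain f g where fg: "\<And>n. f n \<in> D" "f \<longlonglongrightarrow> u" "\<And>n. g n \<in> D" "g \<longlonglongrightarrow> v"
      using approx[OF u] approx[OF v] by blast
    let ?I = "LINT x|M. (cmod (cinner u (U x v)))\<^sup>2"
    \<comment> \<open>A free parameter weighs the main term against the errors: (a + b)^2 <= (1 +
      \<delta>) a^2 + (1 + 1/\<delta>) b^2. The approximation goes to its limit at fixed \<delta>,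
      and only then does \<delta> tend to 0.\<close>
    have *: "C * (norm u)\<^sup>2 * (norm v)\<^sup>2 \<le> (1 + \<delta>) * ?I" if \<delta>: "\<delta> > 0" for \<delta>
    proof (rule LIMSEQ_le)
      let ?R = "\<lambda>n. (1 + \<delta>) * ?I + (1 + 1/\<delta>) * (2 * (C * (norm (f n - u))\<^sup>2 * (norm (g n))\<^sup>2) + 2 * (C * (norm u)\<^sup>2 * (norm (g n - v))\<^sup>2))"
      show "(\<lambda>n. C * (norm (f n))\<^sup>2 * (norm (g n))\<^sup>2) \<longlonglongrightarrow> C * (norm u)\<^sup>2 * (norm v)\<^sup>2"
        using fg by (intro tendsto_intros)
      have "?R \<longlonglongrightarrow> (1 + \<delta>) * ?I + (1 + 1/\<delta>) * (2 * (C * (norm (u - u))\<^sup>2 * (norm v)\<^sup>2) + 2 * (C * (norm u)\<^sup>2 * (norm (v - v))\<^sup>2))"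
        using fg by (intro tendsto_intros)
      then show "?R \<longlonglongrightarrow> (1 + \<delta>) * ?I" by simp
      have "C * (norm (f n))\<^sup>2 * (norm (g n))\<^sup>2 \<le> ?R n" for n
      proof -
        have fH: "f n \<in> H" "g n \<in> H" "f n - u \<in> H" "g n - v \<in> H"
          using fg D(1) u v by (auto intro!: csubspace_diff[OF H])
        have pw: "(cmod (cinner (f n) (U x (g n))))\<^sup>2 \<le> (1 + \<delta>) * (cmod (cinner u (U x v)))\<^sup>2
           + (1 + 1/\<delta>) * (2 * (cmod (cinner (f n - u) (U x (g n))))\<^sup>2 + 2 * (cmod (cinner u (U x (g n - v))))\<^sup>2)"
          if x: "x \<in> space M" for x
        proof -
          define a where "a = cmod (cinner u (U x v))"
          define b where "b = cmod (cinner (f n - u) (U x (g n)))"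
          define c where "c = cmod (cinner u (U x (g n - v)))"
          have "cinner (f n) (U x (g n)) = cinner u (U x v) + cinner (f n - u) (U x (g n)) + cinner u (U x (g n - v))"
            by (simp add: isometry_on_diff[OF U[OF x] H fH(2) v] cinner_diff_left cinner_diff_right)
          then have "cmod (cinner (f n) (U x (g n))) \<le> a + b + c"
            unfolding a_def b_def c_def by (simp add: norm_triangle_mono)
          then have "(cmod (cinner (f n) (U x (g n))))\<^sup>2 \<le> (a + (b + c))\<^sup>2" by (intro power_mono) auto
          also have "\<dots> \<le> (1 + \<delta>) * a\<^sup>2 + (1 + 1/\<delta>) * (b + c)\<^sup>2"
          proof -
            have "0 \<le> (\<delta> * a - (b + c))\<^sup>2 / \<delta>" using \<delta> by simp
            also have "\<dots> = \<delta> * a\<^sup>2 + (b + c)\<^sup>2 / \<delta> - 2 * a * (b + c)"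
              using \<delta> by (simp add: field_simps power2_eq_square)
            finally show ?thesis by (simp add: power2_eq_square algebra_simps add_divide_distrib)
          qed
          also have "\<dots> \<le> (1 + \<delta>) * a\<^sup>2 + (1 + 1/\<delta>) * (2 * b\<^sup>2 + 2 * c\<^sup>2)"
          proof -
            have "(b + c)\<^sup>2 \<le> 2 * b\<^sup>2 + 2 * c\<^sup>2" using zero_le_power2[of "b - c"]
              by (simp add: power2_eq_square algebra_simps)
            then show ?thesis using \<delta> by (intro add_left_mono mult_left_mono) auto
          qed
          finally show ?thesis unfolding a_def b_def c_def .
        qed
        have "C * (norm (f n))\<^sup>2 * (norm (g n))\<^sup>2 = (LINT x|M. (cmod (cinner (f n) (U x (g n))))\<^sup>2)"
          using schur_relation_integral(2)[OF S C] fg by simp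
        also have "\<dots> \<le> (LINT x|M. (1 + \<delta>) * (cmod (cinner u (U x v)))\<^sup>2
           + (1 + 1/\<delta>) * (2 * (cmod (cinner (f n - u) (U x (g n))))\<^sup>2 + 2 * (cmod (cinner u (U x (g n - v))))\<^sup>2))"
          using fH u v by (intro integral_mono pw int Bochner_Integration.integrable_add integrable_mult_right)
        also have "\<dots> = (1 + \<delta>) * ?I + (1 + 1/\<delta>) * (2 * (LINT x|M. (cmod (cinner (f n - u) (U x (g n))))\<^sup>2)
            + 2 * (LINT x|M. (cmod (cinner u (U x (g n - v))))\<^sup>2))"
          using fH u v int by simp
        \<comment> \<open>The upper bound is applied to the differences \<open>f n - u\<close> and
          \<open>g n - v\<close>, which lie in \<open>H\<close> but need not lie in
          \<open>D\<close>.\<close>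
        also have "\<dots> \<le> ?R n"
          using fH u v \<delta> int_le by (intro add_mono mult_left_mono) auto
        finally show ?thesis .
      qed
      then show "\<exists>N. \<forall>n\<ge>N. C * (norm (f n))\<^sup>2 * (norm (g n))\<^sup>2 \<le> ?R n" by blast
    qed
    have "(\<lambda>n. (1 + inverse (real (Suc n))) * ?I) \<longlonglongrightarrow> (1 + 0) * ?I"
      by (intro tendsto_intros LIMSEQ_inverse_real_of_nat)
    then show ?thesis
      using * by (intro LIMSEQ_le_const[where X = "\<lambda>n. (1 + inverse (real (Suc n))) * ?I"]) auto
  qed
  show ?thesis unfolding schur_relation_def
  proof (intro ballI conjI)
    fix u v assume uv: "u \<in> H" "v \<in> H"
    show "(\<lambda>x. cinner u (U x v)) \<in> borel_measurable M" using meas uv .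
    show "(\<integral>\<^sup>+x. ennreal ((cmod (cinner u (U x v)))\<^sup>2) \<partial>M) = ennreal (C * (norm u)\<^sup>2 * (norm v)\<^sup>2)"
      using nn_integral_eq_integral[OF int[OF uv]] int_le[OF uv] ge[OF uv] by simp
  qed
qed

text \<open>An identity between squares on generators says nothing about their linear combinations.
  Generators are therefore tested with four independent vectors, and squares are formed only on the
  span.\<close>

lemma schur_relation_generators:
  assumes H: "csubspace H" and U: "\<And>x. x \<in> space M \<Longrightarrow> isometry_on H (U x)" and T: "T \<subseteq> H"
    and dense: "H \<subseteq> closure (csubspace hull T)" and C: "C \<ge> 0"
    and meas: "\<And>u v. u \<in> T \<Longrightarrow> v \<in> T \<Longrightarrow> (\<lambda>x. cinner u (U x v)) \<in> borel_measurable M"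
    and S: "\<And>u u' v v'. u \<in> T \<Longrightarrow> u' \<in> T \<Longrightarrow> v \<in> T \<Longrightarrow> v' \<in> T \<Longrightarrow> schur_product M U C u u' v v'"
  shows "schur_relation M U H C"
proof (rule schur_relation_closure[OF H U _ dense C])
  let ?D = "csubspace hull T"
  show DH: "?D \<subseteq> H" using T H by (rule hull_minimal)
  have m1: "(\<lambda>x. cinner u (U x v)) \<in> borel_measurable M" if "u \<in> ?D" "v \<in> T" for u v
  proof (rule hull_induct_csubspace[OF _ _ T that(1)])
    show "csubspace {u \<in> H. (\<lambda>x. cinner u (U x v)) \<in> borel_measurable M}"
      unfolding csubspace_def using H
      by (auto simp: csubspace_0 csubspace_add csubspace_scaleC cinner_add_left cinner_scaleC_left)
  qed (use meas that in auto)
  have m2: "(\<lambda>x. cinner u (U x v)) \<in> borel_measurable M" if "u \<in> ?D" "v \<in> ?D" for u v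
  proof (rule hull_induct_csubspace[OF _ _ T that(2)])
    have U0: "U x 0 = 0" if "x \<in> space M" for x
      using isometry_on_norm[OF U[OF that] csubspace_0[OF H]] by simp
    show "csubspace {v \<in> H. (\<lambda>x. cinner u (U x v)) \<in> borel_measurable M}"
      unfolding csubspace_def using H
      by (auto simp: csubspace_0 csubspace_add csubspace_scaleC cinner_add_right cinner_scaleC_right
          U0 isometry_on_add[OF U] isometry_on_scaleC[OF U] cong: measurable_cong)
  qed (use m1 that in auto)
  show "schur_relation M U ?D C"
    unfolding schur_relation_def
  proof (intro ballI conjI m2)
    fix u v assume uv: "u \<in> ?D" "v \<in> ?D"
    have "has_bochner_integral M (\<lambda>x. cinner u (U x v) * cnj (cinner u (U x v))) (of_real C * cinner u u * cinner v v)"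
      using schur_product_hull[OF H U T S uv(1) uv(1) uv(2) uv(2)] by (simp add: schur_product_def)
    moreover have "of_real C * cinner u u * cinner v v = complex_of_real (C * (norm u)\<^sup>2 * (norm v)\<^sup>2)"
      by (simp add: cinner_self)
    ultimately have "has_bochner_integral M (\<lambda>x. complex_of_real ((cmod (cinner u (U x v)))\<^sup>2))
        (complex_of_real (C * (norm u)\<^sup>2 * (norm v)\<^sup>2))"
      unfolding complex_norm_square by simp
    from has_bochner_integral_bounded_linear[OF bounded_linear_Re this]
    have "has_bochner_integral M (\<lambda>x. (cmod (cinner u (U x v)))\<^sup>2) (C * (norm u)\<^sup>2 * (norm v)\<^sup>2)" by simp
    then show "(\<integral>\<^sup>+x. ennreal ((cmod (cinner u (U x v)))\<^sup>2) \<partial>M) = ennreal (C * (norm u)\<^sup>2 * (norm v)\<^sup>2)"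
      using has_bochner_integral_integral_eq has_bochner_integral_integrable
      by (subst nn_integral_eq_integral) (auto simp: has_bochner_integral_iff)
  qed
qed

text \<open>Two polarisations: the first separates \<open>u\<close> from \<open>u'\<close> while
  both other vectors agree, the second separates \<open>v\<close> from \<open>v'\<close>.\<close>

lemma schur_relation_product:
  assumes H: "csubspace H" and U: "\<And>x. x \<in> space M \<Longrightarrow> isometry_on H (U x)" and C: "C \<ge> 0"
    and S: "schur_relation M U H C" and in_H: "u \<in> H" "u' \<in> H" "v \<in> H" "v' \<in> H"
  shows "schur_product M U C u u' v v'"
proof -
  define f where "f u u' v v' x = cinner u (U x v) * cnj (cinner u' (U x v'))" for u u' v v' x
  have int: "integrable M (f u u' v v')" if "u \<in> H" "u' \<in> H" "v \<in> H" "v' \<in> H" for u u' v v'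
  proof (rule Bochner_Integration.integrable_bound)
    show "integrable M (\<lambda>x. (cmod (cinner u (U x v)))\<^sup>2 + (cmod (cinner u' (U x v')))\<^sup>2)"
      using schur_relation_integral(1)[OF S C] that by (intro Bochner_Integration.integrable_add)
    show "f u u' v v' \<in> borel_measurable M"
      unfolding f_def using schur_relation_measurable[OF S] that
      by (intro borel_measurable_times measurable_compose[OF _ borel_measurable_cnj])
    have "a * b \<le> a\<^sup>2 + b\<^sup>2" for a b :: real
      using zero_le_power2[of "a - b"] zero_le_power2[of "a + b"] by (simp add: power2_eq_square algebra_simps)
    then show "AE x in M. norm (f u u' v v' x) \<le> norm ((cmod (cinner u (U x v)))\<^sup>2 + (cmod (cinner u' (U x v')))\<^sup>2)"
      by (simp add: f_def norm_mult)
  qed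
  have U0: "U x 0 = 0" if "x \<in> space M" for x
    using isometry_on_norm[OF U[OF that] csubspace_0[OF H]] by simp
  have f_add1: "f (a + b) u' v v' x = f a u' v v' x + f b u' v v' x"
    and f_add2: "f u (a + b) v v' x = f u a v v' x + f u b v v' x"
    and f_sc1: "f (c *\<^sub>C a) u' v v' x = c * f a u' v v' x"
    and f_sc2: "f u (c *\<^sub>C a) v v' x = cnj c * f u a v v' x" for a b u u' v v' x c
    by (simp_all add: f_def cinner_add_left cinner_scaleC_left algebra_simps)
  have f_add3: "f u u' (a + b) v' x = f u u' a v' x + f u u' b v' x"
    and f_add4: "f u u' v (a + b) x = f u u' v a x + f u u' v b x"
    and f_sc3: "f u u' (c *\<^sub>C a) v' x = cnj c * f u u' a v' x"
    and f_sc4: "f u u' v (c *\<^sub>C a) x = c * f u u' v a x"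
    if "a \<in> H" "b \<in> H" "x \<in> space M" for a b u u' v v' x c
    using that by (simp_all add: f_def isometry_on_add[OF U] isometry_on_scaleC[OF U]
        cinner_add_right cinner_scaleC_right algebra_simps)
  have diag: "(LINT x|M. f u u v v x) = of_real C * cinner u u * cinner v v" if "u \<in> H" "v \<in> H" for u v
  proof -
    have "f u u v v x = complex_of_real ((cmod (cinner u (U x v)))\<^sup>2)" for x
      by (simp only: f_def complex_norm_square)
    then show ?thesis
      using schur_relation_integral(2)[OF S C that] by (simp add: cinner_self del: of_real_power)
  qed
  have step1: "(LINT x|M. f u u' v v x) = of_real C * cinner u u' * cinner v v" if v: "v \<in> H" and u: "u \<in> H" "u' \<in> H" for u u' v
  proof -
    have "(LINT x|M. f u u' v v x) - of_real C * cinner u u' * cinner v v = 0"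
      by (rule sesquilinear_zero[where B = "\<lambda>u u'. (LINT x|M. f u u' v v x) - of_real C * cinner u u' * cinner v v", OF H _ _ _ _ _ u])
        (simp_all add: f_add1 f_add2 f_sc1 f_sc2 int v diag cinner_add_left cinner_add_right cinner_scaleC_left
           cinner_scaleC_right right_diff_distrib algebra_simps)
    then show ?thesis by simp
  qed
  have "(LINT x|M. f u u' v v' x) - of_real C * cinner u u' * cinner v' v = 0"
  \<comment> \<open>The form is linear in \<open>v'\<close> and conjugate linear in
    \<open>v\<close>, so the pair is polarised in this order.\<close>
  proof (rule sesquilinear_zero[where B = "\<lambda>v' v. (LINT x|M. f u u' v v' x) - of_real C * cinner u u' * cinner v' v", OF H _ _ _ _ _ in_H(4,3)])
    fix a b c assume abc: "a \<in> H" "b \<in> H" "c \<in> H"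
    have "(LINT x|M. f u u' c (a + b) x) = (LINT x|M. f u u' c a x + f u u' c b x)"
      by (rule Bochner_Integration.integral_cong) (simp_all add: f_add4 abc)
    then show "(LINT x|M. f u u' c (a + b) x) - of_real C * cinner u u' * cinner (a + b) c =
      (LINT x|M. f u u' c a x) - of_real C * cinner u u' * cinner a c +
      ((LINT x|M. f u u' c b x) - of_real C * cinner u u' * cinner b c)"
      by (simp add: int in_H abc cinner_add_left algebra_simps)
    have "(LINT x|M. f u u' (b + c) a x) = (LINT x|M. f u u' b a x + f u u' c a x)"
      by (rule Bochner_Integration.integral_cong) (simp_all add: f_add3 abc)
    then show "(LINT x|M. f u u' (b + c) a x) - of_real C * cinner u u' * cinner a (b + c) =
      (LINT x|M. f u u' b a x) - of_real C * cinner u u' * cinner a b +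
      ((LINT x|M. f u u' c a x) - of_real C * cinner u u' * cinner a c)"
      by (simp add: int in_H abc cinner_add_right algebra_simps)
  next
    fix c a b assume ab: "a \<in> H" "b \<in> H"
    have "(LINT x|M. f u u' b (c *\<^sub>C a) x) = (LINT x|M. c * f u u' b a x)"
      by (rule Bochner_Integration.integral_cong) (simp_all add: f_sc4[OF ab(1) ab(1)])
    then show "(LINT x|M. f u u' b (c *\<^sub>C a) x) - of_real C * cinner u u' * cinner (c *\<^sub>C a) b =
      c * ((LINT x|M. f u u' b a x) - of_real C * cinner u u' * cinner a b)"
      by (simp add: cinner_scaleC_left algebra_simps)
    have "(LINT x|M. f u u' (c *\<^sub>C b) a x) = (LINT x|M. cnj c * f u u' b a x)"
      by (rule Bochner_Integration.integral_cong) (simp_all add: f_sc3[OF ab(2) ab(2)])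
    then show "(LINT x|M. f u u' (c *\<^sub>C b) a x) - of_real C * cinner u u' * cinner a (c *\<^sub>C b) =
      cnj c * ((LINT x|M. f u u' b a x) - of_real C * cinner u u' * cinner a b)"
      by (simp add: cinner_scaleC_right algebra_simps)
  next
    fix a assume "a \<in> H"
    then show "(LINT x|M. f u u' a a x) - of_real C * cinner u u' * cinner a a = 0"
      by (simp add: step1 in_H)
  qed
  then show ?thesis
    using int[OF in_H] by (simp add: schur_product_def has_bochner_integral_iff f_def[abs_def])
qed

section \<open>Gaussian integrals\<close>

abbreviation lebesgue_prod :: "'i set \<Rightarrow> ('i \<Rightarrow> real) measure" where
  "lebesgue_prod J \<equiv> Pi\<^sub>M J (\<lambda>_. lborel)"

lemma product_sigma_finite_lborel: "product_sigma_finite (\<lambda>_. lborel :: real measure)"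
  by standard

lemma sigma_finite_lebesgue_prod: "finite J \<Longrightarrow> sigma_finite_measure (lebesgue_prod J)"
  by (rule product_sigma_finite.sigma_finite[OF product_sigma_finite_lborel])

text \<open>Comparison on boxes, where the one-dimensional substitution rule applies in each
  coordinate. The map ends in a restriction to \<open>J\<close> because the points of the product
  space are extensional functions.\<close>

lemma lebesgue_prod_affine:
  assumes J: "finite J" and c: "c \<noteq> 0"
  shows "lebesgue_prod J = density (distr (lebesgue_prod J) (lebesgue_prod J) (\<lambda>x. \<lambda>j\<in>J. a j + c * x j))
    (\<lambda>_. ennreal (\<bar>c\<bar> ^ card J))"
proof -
  interpret product_sigma_finite "\<lambda>_. lborel :: real measure" by (rule product_sigma_finite_lborel)
  let ?T = "\<lambda>x. \<lambda>j\<in>J. a j + c * x j"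
  have T[measurable]: "?T \<in> measurable (lebesgue_prod J) (lebesgue_prod J)" by measurable
  show ?thesis
  proof (rule PiM_eqI[OF J, symmetric])
    fix A :: "'a \<Rightarrow> real set" assume "\<And>j. j \<in> J \<Longrightarrow> A j \<in> sets lborel"
    then have A: "\<And>j. j \<in> J \<Longrightarrow> A j \<in> sets borel" by simp
    then have box: "Pi\<^sub>E J A \<in> sets (lebesgue_prod J)" by (intro sets_PiM_I_finite J) simp
    have pre: "(\<lambda>t. a j + c * t) -` A j \<in> sets borel" if "j \<in> J" for j
      by (rule measurable_sets_borel[OF _ A[OF that]]) measurable
    have one: "emeasure lborel (A j) = ennreal \<bar>c\<bar> * emeasure lborel ((\<lambda>t. a j + c * t) -` A j)" if "j \<in> J" for j
      using A[OF that] by (subst lborel_real_affine[OF c, of "a j"]) (simp add: emeasure_density_const emeasure_distr)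
    have "?T -` Pi\<^sub>E J A \<inter> space (lebesgue_prod J) = Pi\<^sub>E J (\<lambda>j. (\<lambda>t. a j + c * t) -` A j)"
      by (auto simp: space_PiM PiE_iff)
    then have "emeasure (density (distr (lebesgue_prod J) (lebesgue_prod J) ?T) (\<lambda>_. ennreal (\<bar>c\<bar> ^ card J))) (Pi\<^sub>E J A)
       = ennreal (\<bar>c\<bar> ^ card J) * emeasure (lebesgue_prod J) (Pi\<^sub>E J (\<lambda>j. (\<lambda>t. a j + c * t) -` A j))"
      using box by (simp add: emeasure_density_const emeasure_distr)
    also have "\<dots> = (\<Prod>j\<in>J. ennreal \<bar>c\<bar>) * (\<Prod>j\<in>J. emeasure lborel ((\<lambda>t. a j + c * t) -` A j))"
      using pre by (subst emeasure_PiM[OF J]) (auto simp: ennreal_power)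
    also have "\<dots> = (\<Prod>j\<in>J. emeasure lborel (A j))"
      unfolding prod.distrib[symmetric] using one by (intro prod.cong) simp_all
    finally show "emeasure (density (distr (lebesgue_prod J) (lebesgue_prod J) ?T) (\<lambda>_. ennreal (\<bar>c\<bar> ^ card J))) (Pi\<^sub>E J A)
       = (\<Prod>j\<in>J. emeasure lborel (A j))" .
  qed simp
qed

lemma
  fixes f :: "('i \<Rightarrow> real) \<Rightarrow> 'b::{banach, second_countable_topology}"
  assumes J: "finite J" and c: "c \<noteq> 0" and f: "f \<in> borel_measurable (lebesgue_prod J)"
  shows integral_lebesgue_prod_affine:
      "integral\<^sup>L (lebesgue_prod J) f = \<bar>c\<bar> ^ card J *\<^sub>R (\<integral>x. f (\<lambda>j\<in>J. a j + c * x j) \<partial>lebesgue_prod J)"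
    and integrable_lebesgue_prod_affine_iff:
      "integrable (lebesgue_prod J) f \<longleftrightarrow> integrable (lebesgue_prod J) (\<lambda>x. f (\<lambda>j\<in>J. a j + c * x j))"
proof -
  let ?T = "\<lambda>x. \<lambda>j\<in>J. a j + c * x j"
  let ?D = "distr (lebesgue_prod J) (lebesgue_prod J) ?T"
  have T[measurable]: "?T \<in> measurable (lebesgue_prod J) (lebesgue_prod J)" by measurable
  have f'[measurable]: "f \<in> borel_measurable ?D" using f by simp
  have "integral\<^sup>L (lebesgue_prod J) f = integral\<^sup>L (density ?D (\<lambda>_. ennreal (\<bar>c\<bar> ^ card J))) f"
    by (subst lebesgue_prod_affine[OF J c, of a]) simp
  also have "\<dots> = \<bar>c\<bar> ^ card J *\<^sub>R integral\<^sup>L ?D f"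
    by (subst integral_density) auto
  also have "integral\<^sup>L ?D f = (\<integral>x. f (?T x) \<partial>lebesgue_prod J)"
    by (rule integral_distr[OF T f])
  finally show "integral\<^sup>L (lebesgue_prod J) f = \<bar>c\<bar> ^ card J *\<^sub>R (\<integral>x. f (?T x) \<partial>lebesgue_prod J)" .
  have "integrable (lebesgue_prod J) f \<longleftrightarrow> integrable (density ?D (\<lambda>_. ennreal (\<bar>c\<bar> ^ card J))) f"
    by (subst lebesgue_prod_affine[OF J c, of a]) simp
  also have "\<dots> \<longleftrightarrow> integrable ?D f"
  proof -
    have "integrable ?D f" if "integrable ?D (\<lambda>x. \<bar>c\<bar> ^ card J *\<^sub>R f x)"
      using integrable_scaleR_right[OF that, of "inverse (\<bar>c\<bar> ^ card J)"] c by simp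
    then show ?thesis by (subst integrable_density) auto
  qed
  also have "\<dots> \<longleftrightarrow> integrable (lebesgue_prod J) (\<lambda>x. f (?T x))"
    by (rule integrable_distr_eq[OF T f])
  finally show "integrable (lebesgue_prod J) f \<longleftrightarrow> integrable (lebesgue_prod J) (\<lambda>x. f (?T x))" .
qed

section \<open>Fourier transforms of Gaussians\<close>

text \<open>The substitution y = m + c x reduces the integral to the characteristic function of the
  standard normal distribution.\<close>

lemma gaussian_fourier_real:
  fixes a m b :: real
  assumes a: "a > 0"
  shows "has_bochner_integral lborel (\<lambda>y. complex_of_real (exp (- (pi * a * (y - m)\<^sup>2))) * cis (pi * (b * y)))
    (complex_of_real (exp (- (pi / (4 * a) * b\<^sup>2)) / sqrt a) * cis (pi * (b * m)))"
proof -
  \<comment> \<open>Chosen so that pi a (c x)^2 = x^2 / 2.\<close>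
  define c where "c = 1 / sqrt (2 * pi * a)"
  have "c > 0" using a by (simp add: c_def)
  have c2: "c\<^sup>2 = 1 / (2 * pi * a)" using a by (simp add: c_def power_divide)
  have int: "integrable lborel (\<lambda>x. std_normal_density x *\<^sub>R cis (pi * b * c * x))"
  proof (rule Bochner_Integration.integrable_bound)
    show "integrable lborel (\<lambda>x. std_normal_density x)" by simp
    show "(\<lambda>x. std_normal_density x *\<^sub>R cis (pi * b * c * x)) \<in> borel_measurable lborel"
      unfolding cis_conv_exp by measurable
  qed simp
  have "(LINT x|lborel. std_normal_density x *\<^sub>R cis (pi * b * c * x)) = exp (- ((pi * b * c)\<^sup>2) / 2)"
  proof -
    have "char std_normal_distribution (pi * b * c) = (LINT x|lborel. std_normal_density x *\<^sub>R cis (pi * b * c * x))"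
      unfolding char_def cis_conv_exp by (subst integral_density) (auto simp: mult.assoc)
    then show ?thesis by (simp add: char_std_normal_distribution)
  qed
  with int have "has_bochner_integral lborel (\<lambda>x. std_normal_density x *\<^sub>R cis (pi * b * c * x))
      (complex_of_real (exp (- ((pi * b * c)\<^sup>2) / 2)))"
    by (simp add: has_bochner_integral_iff)
  from has_bochner_integral_mult_right[OF this, of "complex_of_real (sqrt (2 * pi)) * cis (pi * (b * m))"]
  have "has_bochner_integral lborel (\<lambda>x. complex_of_real (sqrt (2 * pi)) * cis (pi * (b * m)) * (std_normal_density x *\<^sub>R cis (pi * b * c * x)))
     (complex_of_real (sqrt (2 * pi)) * cis (pi * (b * m)) * complex_of_real (exp (- ((pi * b * c)\<^sup>2) / 2)))" by simp
  moreover have "complex_of_real (sqrt (2 * pi)) * cis (pi * (b * m)) * (std_normal_density x *\<^sub>R cis (pi * b * c * x))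
     = complex_of_real (exp (- (pi * a * (m + c * x - m)\<^sup>2))) * cis (pi * (b * (m + c * x)))" for x
  proof -
    have "pi * a * (m + c * x - m)\<^sup>2 = x\<^sup>2 / 2" using a by (simp add: power_mult_distrib c2)
    moreover have "cis (pi * (b * (m + c * x))) = cis (pi * (b * m)) * cis (pi * b * c * x)"
      by (simp add: cis_mult algebra_simps)
    moreover have "sqrt (2 * pi) * std_normal_density x = exp (- (x\<^sup>2 / 2))"
      by (simp add: std_normal_density_def)
    ultimately show ?thesis by (simp add: scaleR_conv_of_real flip: of_real_mult)
  qed
  moreover have "complex_of_real (sqrt (2 * pi)) * cis (pi * (b * m)) * complex_of_real (exp (- ((pi * b * c)\<^sup>2) / 2))
     = (complex_of_real (exp (- (pi / (4 * a) * b\<^sup>2)) / sqrt a) * cis (pi * (b * m))) /\<^sub>R \<bar>c\<bar>"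
  proof -
    define X where "X = exp (- (pi / (4 * a) * b\<^sup>2))"
    have "(pi * b * c)\<^sup>2 / 2 = pi / (4 * a) * b\<^sup>2"
      unfolding power_mult_distrib c2 using a by (simp add: field_simps power2_eq_square)
    then have "exp (- ((pi * b * c)\<^sup>2) / 2) = X" by (simp add: X_def)
    moreover have "inverse \<bar>c\<bar> * (X / sqrt a) = sqrt (2 * pi) * X"
      using a \<open>c > 0\<close> by (simp add: c_def real_sqrt_mult)
    then have "(complex_of_real (X / sqrt a) * cis (pi * (b * m))) /\<^sub>R \<bar>c\<bar> = complex_of_real (sqrt (2 * pi) * X) * cis (pi * (b * m))"
      unfolding scaleR_conv_of_real mult.assoc[symmetric] of_real_mult[symmetric] by simp
    ultimately show ?thesis unfolding X_def[symmetric] by (simp add: mult.commute mult.left_commute)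
  qed
  ultimately show ?thesis
    using \<open>c > 0\<close> by (subst lborel_has_bochner_integral_real_affine_iff[where t = m and c = c]) simp_all
qed

lemma gaussian_fourier:
  fixes m b :: "'i \<Rightarrow> real"
  assumes J: "finite J" and a: "a > 0"
  shows "has_bochner_integral (lebesgue_prod J)
    (\<lambda>x. complex_of_real (exp (- (pi * a * (\<Sum>j\<in>J. (x j - m j)\<^sup>2)))) * cis (pi * (\<Sum>j\<in>J. b j * x j)))
    (complex_of_real (exp (- (pi / (4 * a) * (\<Sum>j\<in>J. (b j)\<^sup>2))) / sqrt a ^ card J) * cis (pi * (\<Sum>j\<in>J. b j * m j)))"
proof -
  interpret product_sigma_finite "\<lambda>_. lborel :: real measure" by (rule product_sigma_finite_lborel)
  let ?f = "\<lambda>j y. complex_of_real (exp (- (pi * a * (y - m j)\<^sup>2))) * cis (pi * (b j * y))"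
  have cis_sum: "cis (\<Sum>j\<in>J. h j) = (\<Prod>j\<in>J. cis (h j))" for h :: "'i \<Rightarrow> real"
    by (simp add: cis_conv_exp sum_distrib_left exp_sum[OF J])
  have f: "integrable lborel (?f j)" "integral\<^sup>L lborel (?f j) =
      complex_of_real (exp (- (pi / (4 * a) * (b j)\<^sup>2)) / sqrt a) * cis (pi * (b j * m j))" for j
    using gaussian_fourier_real[OF a, of "m j" "b j"] by (simp_all add: has_bochner_integral_iff)
  have eq: "complex_of_real (exp (- (pi * a * (\<Sum>j\<in>J. (x j - m j)\<^sup>2)))) * cis (pi * (\<Sum>j\<in>J. b j * x j))
     = (\<Prod>j\<in>J. ?f j (x j))" for x
    by (simp add: sum_distrib_left cis_sum prod.distrib exp_sum[OF J] flip: sum_negf)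
  have "(\<Prod>j\<in>J. integral\<^sup>L lborel (?f j)) =
      complex_of_real (exp (- (pi / (4 * a) * (\<Sum>j\<in>J. (b j)\<^sup>2))) / sqrt a ^ card J) * cis (pi * (\<Sum>j\<in>J. b j * m j))"
    by (simp add: f(2) sum_distrib_left cis_sum prod.distrib exp_sum[OF J] prod_dividef flip: sum_negf)
  then show ?thesis
    unfolding eq using product_integral_prod[OF J f(1)] product_integrable_prod[OF J f(1)]
    by (simp add: has_bochner_integral_iff)
qed

section \<open>Irreducible Weyl systems\<close>

lemma integrable_pair_mult:
  fixes f g :: "_ \<Rightarrow> real"
  assumes "sigma_finite_measure M1" "sigma_finite_measure M2" "integrable M1 f" "integrable M2 g"
  shows "integrable (M1 \<Otimes>\<^sub>M M2) (\<lambda>(x, y). f x * g y)"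
proof -
  interpret M1: sigma_finite_measure M1 by fact
  interpret M2: sigma_finite_measure M2 by fact
  interpret pair_sigma_finite M1 M2 ..
  have [measurable]: "f \<in> borel_measurable M1" "g \<in> borel_measurable M2" using assms by auto
  show ?thesis
  proof (rule Fubini_integrable)
    have "integrable M1 (\<lambda>x. \<bar>f x\<bar> * (\<integral>y. \<bar>g y\<bar> \<partial>M2))" using assms(3) by simp
    then show "integrable M1 (\<lambda>x. \<integral>y. norm (case (x, y) of (x, y) \<Rightarrow> f x * g y) \<partial>M2)"
      by (simp add: abs_mult)
  qed (use assms(4) in auto)
qed

text \<open>The Gaussian kernels below couple their two variables, but are bounded by a product of
  one function of each. Such a bound yields integrability on the product space.\<close>

lemma Fubini_dominated:
  fixes f :: "'a \<Rightarrow> 'b \<Rightarrow> complex" and g h :: "_ \<Rightarrow> real"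
  assumes M1: "sigma_finite_measure M1" and M2: "sigma_finite_measure M2"
    and g: "integrable M1 g" and h: "integrable M2 h"
    and f: "case_prod f \<in> borel_measurable (M1 \<Otimes>\<^sub>M M2)"
    and le: "\<And>x y. x \<in> space M1 \<Longrightarrow> y \<in> space M2 \<Longrightarrow> cmod (f x y) \<le> g x * h y"
  shows "(\<integral>x. \<integral>y. f x y \<partial>M2 \<partial>M1) = (\<integral>y. \<integral>x. f x y \<partial>M1 \<partial>M2)"
proof -
  interpret M1: sigma_finite_measure M1 by fact
  interpret M2: sigma_finite_measure M2 by fact
  interpret pair_sigma_finite M1 M2 ..
  have "integrable (M1 \<Otimes>\<^sub>M M2) (case_prod f)"
  proof (rule Bochner_Integration.integrable_bound[OF integrable_pair_mult[OF M1 M2 g h] f], rule AE_I2)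
    fix z assume "z \<in> space (M1 \<Otimes>\<^sub>M M2)"
    then show "norm (case_prod f z) \<le> norm (case_prod (\<lambda>x y. g x * h y) z)"
      using le by (auto simp: space_pair_measure split_beta intro: order_trans[OF _ abs_ge_self])
  qed
  then show ?thesis by (simp add: Fubini_integral)
qed

text \<open>Coordinates \<open>J\<close> on a symplectic vector space: \<tau> exchanges a coordinate
  with its conjugate one and \<epsilon> gives the sign, which makes the form in
  \<open>W_mult\<close> alternating. Operators are indexed by functions on the whole type, and
  \<open>W_cong\<close> makes only their values on \<open>J\<close> count. Continuity is weak and
  along rays into the origin, where the nonvanishing of the Gaussian average is tested.\<close>

locale weyl_system =
  fixes J :: "'i set" and \<tau> :: "'i \<Rightarrow> 'i" and \<epsilon> :: "'i \<Rightarrow> real" and l :: real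
    and H :: "'h::complex_hilbert_space set" and W :: "('i \<Rightarrow> real) \<Rightarrow> 'h \<Rightarrow> 'h"
  assumes finite_J: "finite J"
    and \<tau>_in: "j \<in> J \<Longrightarrow> \<tau> j \<in> J"
    and \<tau>_\<tau>: "j \<in> J \<Longrightarrow> \<tau> (\<tau> j) = j"
    and \<epsilon>_square: "j \<in> J \<Longrightarrow> (\<epsilon> j)\<^sup>2 = 1"
    and \<epsilon>_\<tau>: "j \<in> J \<Longrightarrow> \<epsilon> (\<tau> j) = - \<epsilon> j"
    and l_nonzero: "l \<noteq> 0"
    and closed_H: "closed_csubspace H" and H_nonzero: "H \<noteq> {0}"
    and W_isometry: "isometry_on H (W x)"
    and W_mult: "u \<in> H \<Longrightarrow> W x (W y u) = cis (pi * l * (\<Sum>j\<in>J. \<epsilon> j * x j * y (\<tau> j))) *\<^sub>C W (\<lambda>j. x j + y j) u"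
    and W_cong: "(\<And>j. j \<in> J \<Longrightarrow> x j = y j) \<Longrightarrow> W x = W y"
    and W_zero: "u \<in> H \<Longrightarrow> W (\<lambda>_. 0) u = u"
    and W_measurable: "u \<in> H \<Longrightarrow> v \<in> H \<Longrightarrow> (\<lambda>x. cinner u (W x v)) \<in> borel_measurable (lebesgue_prod J)"
    and W_continuous: "u \<in> H \<Longrightarrow> v \<in> H \<Longrightarrow> ((\<lambda>s. cinner u (W (\<lambda>j. s * x j) v)) \<longlongrightarrow> cinner u v) (at 0)"
    and W_irreducible: "closed_csubspace V \<Longrightarrow> V \<subseteq> H \<Longrightarrow> (\<And>x u. u \<in> V \<Longrightarrow> W x u \<in> V) \<Longrightarrow> V = {0} \<or> V = H"
begin

abbreviation "\<alpha> \<equiv> \<bar>l\<bar>"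

definition symp :: "('i \<Rightarrow> real) \<Rightarrow> ('i \<Rightarrow> real) \<Rightarrow> real" where
  "symp x y = (\<Sum>j\<in>J. \<epsilon> j * x j * y (\<tau> j))"

definition sq :: "('i \<Rightarrow> real) \<Rightarrow> real" where
  "sq x = (\<Sum>j\<in>J. (x j)\<^sup>2)"

text \<open>The width is tuned to the phase \<open>pi * l * symp x y\<close>. This function becomes
  the coefficient of the vacuum vector.\<close>

definition gauss :: "('i \<Rightarrow> real) \<Rightarrow> real" where
  "gauss x = exp (- (pi * \<alpha> / 2 * sq x))"

text \<open>The reciprocal of the integral of the square of \<open>gauss\<close>. When
  \<open>J\<close> has \<open>2 * (CARD('n) - 2 * r)\<close> elements it equals the formal degree
  \<open>\<bar>l\<bar> ^ (CARD('n) - 2 * r)\<close>.\<close>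

definition \<kappa> :: real where "\<kappa> = sqrt \<alpha> ^ card J"

lemma \<alpha>_pos: "\<alpha> > 0" using l_nonzero by simp

lemma \<kappa>_pos: "\<kappa> > 0" using l_nonzero by (simp add: \<kappa>_def)

lemma csubspace_H: "csubspace H" using closed_H by (simp add: closed_csubspace_def)

lemma symp_simps:
  "symp (\<lambda>j. x j + y j) z = symp x z + symp y z"
  "symp z (\<lambda>j. x j + y j) = symp z x + symp z y"
  "symp (\<lambda>j. x j - y j) z = symp x z - symp y z"
  "symp z (\<lambda>j. x j - y j) = symp z x - symp z y"
  "symp (\<lambda>j. - x j) z = - symp x z"
  "symp z (\<lambda>j. - x j) = - symp z x"
  "symp (\<lambda>j. c * x j) z = c * symp x z"
  "symp z (\<lambda>j. c * x j) = c * symp z x"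
  "symp z (\<lambda>j. x j / c) = symp z x / c"
  "symp (\<lambda>_. 0) z = 0"
  "symp z (\<lambda>_. 0) = 0"
  by (simp_all add: symp_def algebra_simps add_divide_distrib sum.distrib sum_subtractf sum_negf
      sum_distrib_left sum_divide_distrib)

lemma bij_\<tau>: "bij_betw \<tau> J J"
  by (rule bij_betwI[where g = \<tau>]) (auto simp: \<tau>_in \<tau>_\<tau>)

lemma symp_antisym: "symp y x = - symp x y"
proof -
  have "symp y x = (\<Sum>j\<in>J. \<epsilon> (\<tau> j) * y (\<tau> j) * x (\<tau> (\<tau> j)))"
    unfolding symp_def by (rule sum.reindex_bij_betw[OF bij_\<tau>, symmetric])
  also have "\<dots> = (\<Sum>j\<in>J. - (\<epsilon> j * x j * y (\<tau> j)))"
    by (intro sum.cong) (simp_all add: \<tau>_\<tau> \<epsilon>_\<tau>)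
  finally show ?thesis by (simp add: symp_def sum_negf)
qed

lemma symp_self: "symp x x = 0" using symp_antisym[of x x] by simp

lemma sq_restrict [simp]: "sq (restrict x J) = sq x" by (simp add: sq_def)

lemma symp_cong: "(\<And>j. j \<in> J \<Longrightarrow> x j = x' j) \<Longrightarrow> (\<And>j. j \<in> J \<Longrightarrow> y j = y' j) \<Longrightarrow> symp x y = symp x' y'"
  unfolding symp_def by (intro sum.cong) (auto simp: \<tau>_in)

lemma sq_cong: "(\<And>j. j \<in> J \<Longrightarrow> x j = x' j) \<Longrightarrow> sq x = sq x'"
  unfolding sq_def by (intro sum.cong) auto

lemma measurable_sq [measurable]:
  assumes "\<And>j. j \<in> J \<Longrightarrow> (\<lambda>x. f x j) \<in> borel_measurable M"
  shows "(\<lambda>x. sq (f x)) \<in> borel_measurable M"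
  unfolding sq_def using assms by (intro borel_measurable_sum borel_measurable_power)

lemma measurable_symp [measurable]:
  assumes "\<And>j. j \<in> J \<Longrightarrow> (\<lambda>x. f x j) \<in> borel_measurable M" "\<And>j. j \<in> J \<Longrightarrow> (\<lambda>x. g x j) \<in> borel_measurable M"
  shows "(\<lambda>x. symp (f x) (g x)) \<in> borel_measurable M"
  unfolding symp_def using assms \<tau>_in by (intro borel_measurable_sum borel_measurable_times) auto

lemma measurable_gauss [measurable]:
  assumes "\<And>j. j \<in> J \<Longrightarrow> (\<lambda>x. f x j) \<in> borel_measurable M"
  shows "(\<lambda>x. gauss (f x)) \<in> borel_measurable M"
  unfolding gauss_def using measurable_sq[OF assms] by measurable

lemma measurable_cis: "f \<in> borel_measurable M \<Longrightarrow> (\<lambda>x. cis (f x)) \<in> borel_measurable M"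
  unfolding cis_conv_exp by measurable

lemma gauss_nonneg: "gauss x \<ge> 0" by (simp add: gauss_def)

lemma gauss_minus: "gauss (\<lambda>j. - x j) = gauss x" by (simp add: gauss_def sq_def)

lemma gauss_symp_integral:
  assumes a: "a > 0"
  shows "has_bochner_integral (lebesgue_prod J)
    (\<lambda>x. complex_of_real (exp (- (pi * a * sq (\<lambda>j. x j - m j)))) * cis (pi * l * symp S x))
    (complex_of_real (exp (- (pi * l\<^sup>2 / (4 * a) * sq S)) / sqrt a ^ card J) * cis (pi * l * symp S m))"
proof -
  \<comment> \<open>With this vector the symplectic pairing with \<open>S\<close>, multiplied by
    \<open>l\<close>, becomes an ordinary dot product. Since \<tau> permutes \<open>J\<close> and
    the signs square to 1, the length of \<open>b\<close> is |l| times that of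
    \<open>S\<close>.\<close>
  define b where "b j = l * (\<epsilon> (\<tau> j) * S (\<tau> j))" for j
  have 1: "l * symp S x = (\<Sum>j\<in>J. b j * x j)" for x
  proof -
    have "symp S x = (\<Sum>j\<in>J. \<epsilon> (\<tau> j) * S (\<tau> j) * x (\<tau> (\<tau> j)))"
      unfolding symp_def by (rule sum.reindex_bij_betw[OF bij_\<tau>, symmetric])
    then show ?thesis by (simp add: b_def sum_distrib_left \<tau>_\<tau> mult.assoc cong: sum.cong)
  qed
  have "sq S = (\<Sum>j\<in>J. (S (\<tau> j))\<^sup>2)"
    unfolding sq_def by (rule sum.reindex_bij_betw[OF bij_\<tau>, symmetric])
  then have 2: "(\<Sum>j\<in>J. (b j)\<^sup>2) = l\<^sup>2 * sq S"
    by (simp add: b_def power_mult_distrib \<epsilon>_square \<tau>_in sum_distrib_left cong: sum.cong)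
  have 3: "pi * l * z = pi * (l * z)" "pi * l\<^sup>2 / (4 * a) * z = pi / (4 * a) * (l\<^sup>2 * z)" for z by simp_all
  show ?thesis
    using gaussian_fourier[OF finite_J a, of m b] unfolding 1[symmetric] 2 sq_def[symmetric] 3 .
qed

text \<open>The parallelogram law merges the two Gaussians into one about their midpoint, up to a
  factor depending on the distance of the centres. The same integral evaluates the iterated Gaussian
  average and, later, products of coefficients of orbit vectors.\<close>

lemma gauss_pair_integral:
  "has_bochner_integral (lebesgue_prod J)
    (\<lambda>x. complex_of_real (gauss (\<lambda>j. x j - A j) * gauss (\<lambda>j. x j - B j)) * cis (pi * l * symp S x))
    (complex_of_real (exp (- (pi * \<alpha> / 4 * (sq (\<lambda>j. A j - B j) + sq S))) / \<kappa>) * cis (pi * l * (symp S A + symp S B) / 2))"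
proof -
  define m where "m j = (A j + B j) / 2" for j
  define k where "k = exp (- (pi * \<alpha> / 4 * sq (\<lambda>j. A j - B j)))"
  have "(\<Sum>j\<in>J. (x j - A j)\<^sup>2 + (x j - B j)\<^sup>2) = (\<Sum>j\<in>J. 2 * (x j - m j)\<^sup>2 + (A j - B j)\<^sup>2 / 2)" for x
    by (intro sum.cong) (simp_all add: m_def power2_eq_square field_simps)
  then have "sq (\<lambda>j. x j - A j) + sq (\<lambda>j. x j - B j) = 2 * sq (\<lambda>j. x j - m j) + sq (\<lambda>j. A j - B j) / 2" for x
    unfolding sq_def by (simp add: sum.distrib sum_distrib_left sum_divide_distrib)
  then have ex: "- (pi * \<alpha> / 2 * sq (\<lambda>j. x j - A j)) + - (pi * \<alpha> / 2 * sq (\<lambda>j. x j - B j))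
     = - (pi * \<alpha> / 4 * sq (\<lambda>j. A j - B j)) + - (pi * \<alpha> * sq (\<lambda>j. x j - m j))" for x
  proof -
    assume *: "\<And>x. sq (\<lambda>j. x j - A j) + sq (\<lambda>j. x j - B j) = 2 * sq (\<lambda>j. x j - m j) + sq (\<lambda>j. A j - B j) / 2"
    have "- (pi * \<alpha> / 2 * sq (\<lambda>j. x j - A j)) + - (pi * \<alpha> / 2 * sq (\<lambda>j. x j - B j)) =
      - (pi * \<alpha> / 2) * (sq (\<lambda>j. x j - A j) + sq (\<lambda>j. x j - B j))" by (simp add: algebra_simps)
    then show ?thesis unfolding * by (simp add: algebra_simps)
  qed
  have 1: "gauss (\<lambda>j. x j - A j) * gauss (\<lambda>j. x j - B j) = k * exp (- (pi * \<alpha> * sq (\<lambda>j. x j - m j)))" for x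
    unfolding gauss_def k_def exp_add[symmetric] ex ..
  have 2: "symp S m = (symp S A + symp S B) / 2" by (simp add: m_def[abs_def] symp_simps)
  have "l\<^sup>2 = \<alpha> * \<alpha>" by (simp add: power2_eq_square)
  \<comment> \<open>Effect of the tuned width: the Fourier factor gets the same coefficient as the
    distance factor, so the squared distance of \<open>A\<close> and \<open>B\<close> and the
    squared length of \<open>S\<close> simply add.\<close>
  then have ratio: "pi * l\<^sup>2 / (4 * \<alpha>) = pi * \<alpha> / 4"
    using l_nonzero by (simp add: field_simps del: abs_mult_self_eq)
  have "exp (- (pi * \<alpha> / 4 * (sq (\<lambda>j. A j - B j) + sq S))) / \<kappa> = k * (exp (- (pi * l\<^sup>2 / (4 * \<alpha>) * sq S)) / sqrt \<alpha> ^ card J)"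
    unfolding ratio by (simp add: k_def \<kappa>_def distrib_left exp_add[symmetric] exp_minus[symmetric])
  then show ?thesis
    using has_bochner_integral_mult_right[OF gauss_symp_integral[OF \<alpha>_pos, of m S], of k] unfolding 1 2
    by (simp add: mult.assoc)
qed

lemma integrable_gaussian: "a > 0 \<Longrightarrow> integrable (lebesgue_prod J) (\<lambda>x. exp (- (pi * a * sq (\<lambda>j. x j - m j))))"
  using gauss_symp_integral[of a m "\<lambda>_. 0"]
  by (simp add: symp_simps has_bochner_integral_iff complex_of_real_integrable_eq)

lemma integrable_gauss: "integrable (lebesgue_prod J) gauss"
  using integrable_gaussian[of "\<alpha> / 2" "\<lambda>_. 0"] \<alpha>_pos by (simp add: gauss_def[abs_def])

section \<open>Weyl operators and their weak Gaussian average\<close>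

lemma W_in: "u \<in> H \<Longrightarrow> W x u \<in> H"
  using W_isometry by (rule isometry_on_in)

lemma W_symp: "u \<in> H \<Longrightarrow> W x (W y u) = cis (pi * l * symp x y) *\<^sub>C W (\<lambda>j. x j + y j) u"
  by (simp add: W_mult symp_def)

lemma W_inverse': "u \<in> H \<Longrightarrow> W x (W (\<lambda>j. - x j) u) = u"
  by (simp add: W_symp symp_simps symp_self W_zero)

lemma W_adjoint: "u \<in> H \<Longrightarrow> v \<in> H \<Longrightarrow> cinner u (W x v) = cinner (W (\<lambda>j. - x j) u) v"
  using isometry_on_cinner[OF W_isometry[of x] csubspace_H, of "W (\<lambda>j. - x j) u" v]
  by (simp add: W_in W_inverse')

lemma W_adjoint': "u \<in> H \<Longrightarrow> v \<in> H \<Longrightarrow> cinner (W x u) v = cinner u (W (\<lambda>j. - x j) v)"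
  using W_adjoint[of u v "\<lambda>j. - x j"] by simp

lemma cmod_W_le: "u \<in> H \<Longrightarrow> v \<in> H \<Longrightarrow> cmod (cinner u (W x v)) \<le> norm u * norm v"
  using cmod_cinner_le[of u "W x v"] by (simp add: isometry_on_norm[OF W_isometry])

lemma W_affine_measurable:
  assumes "u \<in> H" "v \<in> H"
  shows "(\<lambda>x. cinner u (W (\<lambda>j. a j + c * x j) v)) \<in> borel_measurable (lebesgue_prod J)"
proof -
  have "(\<lambda>x. \<lambda>j\<in>J. a j + c * x j) \<in> measurable (lebesgue_prod J) (lebesgue_prod J)" by measurable
  from measurable_compose[OF this W_measurable[OF assms]]
  have "(\<lambda>x. cinner u (W (\<lambda>j\<in>J. a j + c * x j) v)) \<in> borel_measurable (lebesgue_prod J)" .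
  moreover have "W (\<lambda>j\<in>J. a j + c * x j) = W (\<lambda>j. a j + c * x j)" for x by (rule W_cong) simp
  ultimately show ?thesis by simp
qed

lemma integrable_gauss_W:
  assumes "u \<in> H" "v \<in> H"
  shows "integrable (lebesgue_prod J) (\<lambda>x. complex_of_real (gauss x) * cinner u (W x v))"
proof (rule Bochner_Integration.integrable_bound)
  show "integrable (lebesgue_prod J) (\<lambda>x. gauss x * (norm u * norm v))" using integrable_gauss by simp
  have [measurable]: "gauss \<in> borel_measurable (lebesgue_prod J)" using integrable_gauss by auto
  show "(\<lambda>x. complex_of_real (gauss x) * cinner u (W x v)) \<in> borel_measurable (lebesgue_prod J)"
    using W_measurable[OF assms] by measurable
  show "AE x in lebesgue_prod J. norm (complex_of_real (gauss x) * cinner u (W x v)) \<le> norm (gauss x * (norm u * norm v))"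
    using cmod_W_le[OF assms] by (simp add: norm_mult abs_mult mult_left_mono)
qed

text \<open>The operator \<open>\<kappa> \<integral> gauss x W(x) dx\<close>, von Neumann's projection onto the vacuum vector.\<close>

definition gform :: "'h \<Rightarrow> 'h \<Rightarrow> complex" where
  "gform v u = of_real \<kappa> * (\<integral>x. complex_of_real (gauss x) * cinner v (W x u) \<partial>lebesgue_prod J)"

text \<open>The average applied to a vector, as the Riesz vector of the form; this stands in for a
  vector-valued integral. The choice is meaningful for \<open>u\<close> in \<open>H\<close>, where
  existence is shown next.\<close>

definition vac :: "'h \<Rightarrow> 'h" where
  "vac u = (SOME e. e \<in> H \<and> (\<forall>v\<in>H. gform v u = cinner v e))"

lemma vac:
  assumes u: "u \<in> H"
  shows vac_in: "vac u \<in> H" and vac_cinner: "v \<in> H \<Longrightarrow> cinner v (vac u) = gform v u"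
proof -
  obtain e where "e \<in> H" "\<And>v. v \<in> H \<Longrightarrow> gform v u = cinner v e"
  proof (rule riesz_representation[OF closed_H, where \<phi> = "\<lambda>v. gform v u" and C = "\<kappa> * integral\<^sup>L (lebesgue_prod J) gauss * norm u"])
    fix v v' c assume v: "v \<in> H"
    show "gform (c *\<^sub>C v) u = c * gform v u"
      by (simp add: gform_def cinner_scaleC_left mult.left_commute[of _ c])
    show "cmod (gform v u) \<le> \<kappa> * integral\<^sup>L (lebesgue_prod J) gauss * norm u * norm v"
    proof -
      have "cmod (\<integral>x. complex_of_real (gauss x) * cinner v (W x u) \<partial>lebesgue_prod J)
          \<le> (\<integral>x. norm (complex_of_real (gauss x) * cinner v (W x u)) \<partial>lebesgue_prod J)" by simp
      also have "\<dots> \<le> (\<integral>x. gauss x * (norm u * norm v) \<partial>lebesgue_prod J)"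
        using integrable_gauss integrable_norm[OF integrable_gauss_W[OF v u]]
          cmod_W_le[OF v u] by (intro integral_mono) (auto simp: norm_mult gauss_nonneg mult.commute[of "norm u"] intro!: mult_left_mono)
      finally show ?thesis using \<kappa>_pos by (simp add: gform_def norm_mult mult.assoc)
    qed
    assume "v' \<in> H"
    then show "gform (v + v') u = gform v u + gform v' u"
      using integrable_gauss_W[OF _ u] v by (simp add: gform_def cinner_add_left distrib_left)
  qed (rule that)
  then have "\<exists>e. e \<in> H \<and> (\<forall>v\<in>H. gform v u = cinner v e)" by blast
  from someI_ex[OF this] show "vac u \<in> H" "v \<in> H \<Longrightarrow> cinner v (vac u) = gform v u"
    unfolding vac_def by auto
qed

text \<open>The adjoint of \<open>W x\<close> is \<open>W (\<lambda>j. - x j)\<close> and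
  \<open>gauss\<close> is even, so substituting -x for x identifies the average with its
  adjoint.\<close>

lemma vac_selfadjoint:
  assumes u: "u \<in> H" and v: "v \<in> H"
  shows "cinner (vac v) u = gform v u"
proof -
  have [measurable]: "gauss \<in> borel_measurable (lebesgue_prod J)" using integrable_gauss by auto
  have "cinner (vac v) u = cnj (gform u v)"
    by (metis cinner_commute vac_cinner[OF v u])
  also have "\<dots> = of_real \<kappa> * (\<integral>x. cnj (complex_of_real (gauss x) * cinner u (W x v)) \<partial>lebesgue_prod J)"
    unfolding gform_def complex_cnj_mult[of "of_real \<kappa>"] Bochner_Integration.integral_cnj by simp
  also have "(\<integral>x. cnj (complex_of_real (gauss x) * cinner u (W x v)) \<partial>lebesgue_prod J)
      = (\<integral>x. complex_of_real (gauss x) * cinner v (W (\<lambda>j. - x j) u) \<partial>lebesgue_prod J)"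
    by (simp add: cinner_commute[of u "W _ v", symmetric] W_adjoint'[OF v u] flip: cinner_commute)
  also have "\<dots> = (\<integral>x. complex_of_real (gauss x) * cinner v (W x u) \<partial>lebesgue_prod J)"
  proof -
    have "(\<integral>x. complex_of_real (gauss x) * cinner v (W x u) \<partial>lebesgue_prod J)
       = (\<integral>x. complex_of_real (gauss (\<lambda>j\<in>J. - x j)) * cinner v (W (\<lambda>j\<in>J. - x j) u) \<partial>lebesgue_prod J)"
      using integral_lebesgue_prod_affine[OF finite_J, of "-1" "\<lambda>x. complex_of_real (gauss x) * cinner v (W x u)" "\<lambda>_. 0"]
        W_measurable[OF v u] by simp
    moreover have "W (\<lambda>j\<in>J. - x j) = W (\<lambda>j. - x j)" "gauss (\<lambda>j\<in>J. - x j) = gauss x" for x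
      by (rule W_cong) (simp_all add: gauss_def sq_def)
    ultimately show ?thesis by simp
  qed
  finally show ?thesis by (simp add: gform_def)
qed

text \<open>In operator terms P W(y) P = gauss(y) P for the average P. Merging the three Weyl
  operators and taking the sum of their arguments as new variable w leaves an inner Gaussian
  integral, with value gauss(y) gauss(w) / \<kappa> up to phases that cancel.\<close>

lemma vac_sandwich:
  assumes u: "u \<in> H" and v: "v \<in> H"
  shows "cinner (vac v) (W y (vac u)) = of_real (gauss y) * cinner v (vac u)"
proof -
  let ?M = "lebesgue_prod J"
  have meas_g [measurable]: "gauss \<in> borel_measurable ?M" using integrable_gauss by auto
  note W_measurable[OF v u, measurable]
  \<comment> \<open>The integrand after the substitution w = x + y + z, where x belongs to the left
    average and z to the right one. The \<open>cis\<close> factor collects the two multiplication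
    phases.\<close>
  define K where "K z w = complex_of_real (gauss z) * (complex_of_real (gauss (\<lambda>j. w j - y j - z j)) *
     cis (- (pi * l * (symp w y + symp (\<lambda>j. w j + y j) z))) * cinner v (W w u))" for z w
  have "cinner (vac v) (W y (vac u)) = cinner (W (\<lambda>j. - y j) (vac v)) (vac u)"
    by (rule W_adjoint[OF vac_in[OF v] vac_in[OF u]])
  also have "\<dots> = gform (W (\<lambda>j. - y j) (vac v)) u"
    by (rule vac_cinner[OF u W_in[OF vac_in[OF v]]])
  also have "\<dots> = of_real \<kappa> * (\<integral>z. complex_of_real (gauss z) * gform v (W y (W z u)) \<partial>?M)"
    using u v by (simp add: gform_def[of "W _ _"] W_adjoint'[OF vac_in[OF v] W_in] vac_selfadjoint[OF W_in[OF W_in]])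
  also have "\<dots> = of_real \<kappa> * (of_real \<kappa> * (\<integral>z. \<integral>w. K z w \<partial>?M \<partial>?M))"
  proof -
    have "gform v (W y (W z u)) = of_real \<kappa> * (\<integral>w. complex_of_real (gauss (\<lambda>j. w j - y j - z j)) *
       cis (- (pi * l * (symp w y + symp (\<lambda>j. w j + y j) z))) * cinner v (W w u) \<partial>?M)" for z
    proof -
      let ?f = "\<lambda>w. complex_of_real (gauss (\<lambda>j. w j - y j - z j)) *
       cis (- (pi * l * (symp w y + symp (\<lambda>j. w j + y j) z))) * cinner v (W w u)"
      have m: "?f \<in> borel_measurable ?M"
        by (intro borel_measurable_times measurable_cis borel_measurable_of_real) measurable
      have "integral\<^sup>L ?M ?f = (\<integral>x. ?f (\<lambda>j\<in>J. y j + z j + x j) \<partial>?M)"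
        using integral_lebesgue_prod_affine[OF finite_J _ m, of 1 "\<lambda>j. y j + z j"] by simp
      also have "\<dots> = (\<integral>x. complex_of_real (gauss x) * cinner v (W x (W y (W z u))) \<partial>?M)"
      proof (rule Bochner_Integration.integral_cong[OF refl])
        fix x
        have 1: "gauss (\<lambda>j. (\<lambda>j\<in>J. y j + z j + x j) j - y j - z j) = gauss x"
          unfolding gauss_def by (subst sq_cong[of _ x]) auto
        have 2: "symp (\<lambda>j\<in>J. y j + z j + x j) y = symp (\<lambda>j. y j + z j + x j) y"
          "symp (\<lambda>j. (\<lambda>j\<in>J. y j + z j + x j) j + y j) z = symp (\<lambda>j. y j + z j + x j + y j) z"
          by (auto intro!: symp_cong)
        have 3: "W (\<lambda>j\<in>J. y j + z j + x j) = W (\<lambda>j. x j + (y j + z j))" by (rule W_cong) simp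
        have "W x (W y (W z u)) = cis (pi * l * symp y z) *\<^sub>C cis (pi * l * symp x (\<lambda>j. y j + z j)) *\<^sub>C W (\<lambda>j. x j + (y j + z j)) u"
          using u by (simp add: W_symp W_in isometry_on_scaleC[OF W_isometry])
        then have 4: "cinner v (W x (W y (W z u))) = cis (- (pi * l * (symp y z + symp x (\<lambda>j. y j + z j)))) * cinner v (W (\<lambda>j. x j + (y j + z j)) u)"
          unfolding \<open>W x (W y (W z u)) = _\<close> cinner_scaleC_right cis_cnj mult.assoc[symmetric] cis_mult
          by (simp add: algebra_simps)
        have 5: "symp y z + symp x (\<lambda>j. y j + z j) = symp (\<lambda>j. y j + z j + x j) y + symp (\<lambda>j. y j + z j + x j + y j) z"
          using symp_antisym[of y z] by (simp add: symp_simps symp_self)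
        show "?f (\<lambda>j\<in>J. y j + z j + x j) = complex_of_real (gauss x) * cinner v (W x (W y (W z u)))"
          unfolding 1 2 3 4 5 by simp
      qed
      finally show ?thesis by (simp add: gform_def)
    qed
    then have "complex_of_real (gauss z) * gform v (W y (W z u)) = of_real \<kappa> * (\<integral>w. K z w \<partial>?M)" for z
      by (simp add: K_def)
    then show ?thesis by simp
  qed
  also have "(\<integral>z. \<integral>w. K z w \<partial>?M \<partial>?M) = (\<integral>w. \<integral>z. K z w \<partial>?M \<partial>?M)"
  proof (rule Fubini_dominated)
    \<comment> \<open>One third of the exponent \<alpha> / 2 survives when the variables are
      decoupled by p^2 + q^2 <= 3 (p^2 + (q - p)^2), applied coordinatewise with p = z and q = w -
      y.\<close>
    let ?g = "\<lambda>z. exp (- (pi * (\<alpha> / 6) * sq (\<lambda>j. z j - 0)))"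
    let ?h = "\<lambda>w. exp (- (pi * (\<alpha> / 6) * sq (\<lambda>j. w j - y j))) * (norm v * norm u)"
    show "integrable ?M ?g" using \<alpha>_pos by (intro integrable_gaussian) simp
    show "integrable ?M ?h" using \<alpha>_pos by (intro integrable_mult_left integrable_gaussian) simp
    have [measurable]: "(\<lambda>(z, w). cinner v (W w u)) \<in> borel_measurable (?M \<Otimes>\<^sub>M ?M)"
      unfolding split_beta by (rule measurable_compose[OF measurable_snd W_measurable[OF v u]])
    show "case_prod K \<in> borel_measurable (?M \<Otimes>\<^sub>M ?M)"
      unfolding K_def split_beta'
      by (intro borel_measurable_times measurable_cis borel_measurable_of_real
          measurable_compose[OF measurable_snd W_measurable[OF v u]]) measurable
    fix z w
    have "(\<Sum>j\<in>J. (z j)\<^sup>2 + (w j - y j)\<^sup>2) \<le> (\<Sum>j\<in>J. 3 * ((z j)\<^sup>2 + (w j - y j - z j)\<^sup>2))"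
    proof (rule sum_mono)
      fix j
      define p q where "p = z j" and "q = w j - y j"
      have "3 * (p\<^sup>2 + (q - p)\<^sup>2) - (p\<^sup>2 + q\<^sup>2) = 2 * (q - 3/2 * p)\<^sup>2 + p\<^sup>2 / 2"
        by (simp add: power2_eq_square field_simps)
      moreover have "0 \<le> 2 * (q - 3/2 * p)\<^sup>2 + p\<^sup>2 / 2" by simp
      ultimately show "(z j)\<^sup>2 + (w j - y j)\<^sup>2 \<le> 3 * ((z j)\<^sup>2 + (w j - y j - z j)\<^sup>2)"
        unfolding p_def[symmetric] q_def[symmetric] by linarith
    qed
    then have s: "sq z + sq (\<lambda>j. w j - y j) \<le> 3 * (sq z + sq (\<lambda>j. w j - y j - z j))"
      by (simp add: sq_def sum.distrib sum_distrib_left)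
    have "gauss z * gauss (\<lambda>j. w j - y j - z j) \<le> ?g z * exp (- (pi * (\<alpha> / 6) * sq (\<lambda>j. w j - y j)))"
      using mult_left_mono[OF s, of "pi * \<alpha> / 6"] by (simp add: gauss_def exp_add[symmetric] exp_minus[symmetric] algebra_simps)
    then have "(gauss z * gauss (\<lambda>j. w j - y j - z j)) * cmod (cinner v (W w u))
        \<le> (?g z * exp (- (pi * (\<alpha> / 6) * sq (\<lambda>j. w j - y j)))) * (norm v * norm u)"
      by (rule mult_mono[OF _ cmod_W_le[OF v u]]) simp_all
    then show "cmod (K z w) \<le> ?g z * ?h w"
      by (simp add: K_def norm_mult gauss_nonneg mult.assoc)
  qed (rule sigma_finite_lebesgue_prod[OF finite_J])+
  also have "(\<integral>w. \<integral>z. K z w \<partial>?M \<partial>?M) = (\<integral>w. of_real (gauss y / \<kappa>) * (complex_of_real (gauss w) * cinner v (W w u)) \<partial>?M)"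
  proof (rule Bochner_Integration.integral_cong[OF refl])
    fix w
    let ?S = "\<lambda>j. - (w j + y j)"
    define A B where "A = (\<lambda>j::'i. 0::real)" and "B = (\<lambda>j. w j - y j)"
    have K: "K z w = (cis (- (pi * l * symp w y)) * cinner v (W w u)) *
      (complex_of_real (gauss (\<lambda>j. z j - A j) * gauss (\<lambda>j. z j - B j)) * cis (pi * l * symp ?S z))" for z
    proof -
      have "gauss (\<lambda>j. w j - y j - z j) = gauss (\<lambda>j. z j - B j)"
        by (subst gauss_minus[symmetric]) (simp add: B_def algebra_simps)
      moreover have "cis (- (pi * l * (symp w y + symp (\<lambda>j. w j + y j) z))) = cis (- (pi * l * symp w y)) * cis (pi * l * symp ?S z)"
        unfolding cis_mult symp_simps by (simp add: algebra_simps)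
      ultimately show ?thesis by (simp add: K_def A_def)
    qed
    \<comment> \<open>The parallelogram law for w - y and w + y. At the chosen width the exponential
      then splits into exactly \<open>gauss y * gauss w\<close>.\<close>
    have "sq (\<lambda>j. A j - B j) + sq ?S = 2 * (sq y + sq w)"
      unfolding sq_def A_def B_def sum.distrib[symmetric] sum_distrib_left
      by (intro sum.cong) (simp_all add: power2_eq_square algebra_simps)
    then have 1: "exp (- (pi * \<alpha> / 4 * (sq (\<lambda>j. A j - B j) + sq ?S))) = gauss y * gauss w"
      unfolding gauss_def exp_add[symmetric] by (simp add: algebra_simps)
    \<comment> \<open>This phase is inverse to the one that \<open>K\<close> carries independently
      of \<open>z\<close>.\<close>
    have 2: "pi * l * (symp ?S A + symp ?S B) / 2 = pi * l * symp w y"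
      using symp_antisym[of y w] by (simp add: A_def B_def symp_simps symp_self)
    have "(\<integral>z. K z w \<partial>?M) = (cis (- (pi * l * symp w y)) * cinner v (W w u)) *
       (complex_of_real (gauss y * gauss w / \<kappa>) * cis (pi * l * symp w y))"
      unfolding K integral_mult_right_zero has_bochner_integral_integral_eq[OF gauss_pair_integral[of A B ?S]] 1 2 ..
    also have "\<dots> = (cis (- (pi * l * symp w y)) * cis (pi * l * symp w y)) * (of_real (gauss y / \<kappa>) * (complex_of_real (gauss w) * cinner v (W w u)))"
      by simp
    also have "cis (- (pi * l * symp w y)) * cis (pi * l * symp w y) = 1" by (simp add: cis_mult)
    finally show "(\<integral>z. K z w \<partial>?M) = of_real (gauss y / \<kappa>) * (complex_of_real (gauss w) * cinner v (W w u))" by simp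
  qed
  finally show ?thesis using \<kappa>_pos by (simp add: vac_cinner[OF u v] gform_def)
qed

lemma W_commute: "u \<in> H \<Longrightarrow> W x (W y u) = cis (pi * l * (2 * symp x y)) *\<^sub>C W y (W x u)"
  using symp_antisym[of x y]
  by (simp add: W_symp scaleC_scaleC cis_mult add.commute algebra_simps)

text \<open>
  If all \<open>vac u\<close> vanished, then so would the Fourier transform of \<open>gauss x \<cdot> \<langle>u, W(x)u\<rangle>\<close>. Testing it against
  narrower and narrower Gaussians recovers its value \<open>\<parallel>u\<parallel>\<^sup>2\<close> at the origin.
\<close>

lemma vac_nonzero: "\<exists>u\<in>H. vac u \<noteq> 0"
proof (rule ccontr)
  let ?M = "lebesgue_prod J"
  assume "\<not> (\<exists>u\<in>H. vac u \<noteq> 0)"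
  then have gform0: "gform v u = 0" if "u \<in> H" "v \<in> H" for u v
    using vac_cinner[OF that] that by simp
  obtain u where u: "u \<in> H" "u \<noteq> 0"
    using H_nonzero csubspace_0[OF csubspace_H] by blast
  define F where "F x = cinner u (W x u)" for x
  have F[measurable]: "F \<in> borel_measurable ?M"
    unfolding F_def by (rule W_measurable[OF u(1) u(1)])
  have F_le: "cmod (F x) \<le> (norm u)\<^sup>2" for x
    using cmod_W_le[OF u(1) u(1)] by (simp add: F_def power2_eq_square)
  have meas_g [measurable]: "gauss \<in> borel_measurable ?M" using integrable_gauss by auto
  \<comment> \<open>Conjugation by \<open>W y\<close> multiplies \<open>W x\<close> by a character
    of \<open>x\<close>. The vanishing of the form at \<open>W y u\<close> is thus the vanishing of
    the Fourier transform of \<open>gauss x * F x\<close> at a frequency proportional to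
    \<open>y\<close>.\<close>
  have fourier0: "(\<integral>x. complex_of_real (gauss x) * F x * cis (pi * l * (2 * symp y x)) \<partial>?M) = 0" for y
  proof -
    have "cinner (W y u) (W x (W y u)) = cis (pi * l * (2 * symp y x)) * F x" for x
    proof -
      have "cinner (W y u) (W x (W y u)) = cnj (cis (pi * l * (2 * symp x y))) * cinner (W y u) (W y (W x u))"
        by (simp only: W_commute[OF u(1), of x y] cinner_scaleC_right)
      also have "cinner (W y u) (W y (W x u)) = F x"
        unfolding F_def by (rule isometry_on_cinner[OF W_isometry csubspace_H u(1) W_in[OF u(1)]])
      finally show ?thesis using symp_antisym[of x y] by (simp add: cis_cnj)
    qed
    then show ?thesis
      using gform0[OF W_in[OF u(1)] W_in[OF u(1)], of y y] \<kappa>_pos by (simp add: gform_def mult_ac)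
  qed
  have narrow0: "(\<integral>x. complex_of_real (exp (- (pi * t * sq x))) * F x \<partial>?M) = 0" if t: "t > \<alpha> / 2" for t
  proof -
    \<comment> \<open>Chosen so that integrating the character against exp (- pi a |y|^2) gives, up
      to a constant, exp (- pi (t - \<alpha>/2) |x|^2), which completes \<open>gauss\<close> to the
      Gaussian with parameter \<open>t\<close>. Positivity of \<open>a\<close> is the bound on
      \<open>t\<close>.\<close>
    define a where "a = l\<^sup>2 / (t - \<alpha> / 2)"
    have a: "a > 0" "l\<^sup>2 / a = t - \<alpha> / 2" using t l_nonzero by (simp_all add: a_def)
    define K where "K y x = complex_of_real (exp (- (pi * a * sq y))) * (complex_of_real (gauss x) * F x * cis (pi * l * (2 * symp y x)))" for y x
    have "0 = (\<integral>y. \<integral>x. K y x \<partial>?M \<partial>?M)" unfolding K_def by (simp add: fourier0)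
    also have "\<dots> = (\<integral>x. \<integral>y. K y x \<partial>?M \<partial>?M)"
    proof (rule Fubini_dominated)
      show "integrable ?M (\<lambda>y. exp (- (pi * a * sq (\<lambda>j. y j - 0))))" by (rule integrable_gaussian[OF a(1)])
      show "integrable ?M (\<lambda>x. gauss x * (norm u)\<^sup>2)" using integrable_gauss by simp
      show "case_prod K \<in> borel_measurable (?M \<Otimes>\<^sub>M ?M)"
        unfolding K_def split_beta'
        by (intro borel_measurable_times measurable_cis borel_measurable_of_real
            measurable_compose[OF measurable_snd F]) measurable
      show "cmod (K y x) \<le> exp (- (pi * a * sq (\<lambda>j. y j - 0))) * (gauss x * (norm u)\<^sup>2)" for y x
        by (simp add: K_def norm_mult gauss_nonneg F_le mult_left_mono)
    qed (rule sigma_finite_lebesgue_prod[OF finite_J])+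
    also have "\<dots> = (\<integral>x. of_real (1 / sqrt a ^ card J) * (complex_of_real (exp (- (pi * t * sq x))) * F x) \<partial>?M)"
    proof (rule Bochner_Integration.integral_cong[OF refl])
      fix x :: "'i \<Rightarrow> real"
      let ?S = "\<lambda>j. - 2 * x j"
      have S: "sq ?S = 4 * sq x" by (simp add: sq_def power_mult_distrib sum_distrib_left)
      have K: "K y x = (complex_of_real (gauss x) * F x) *
         (complex_of_real (exp (- (pi * a * sq (\<lambda>j. y j - 0)))) * cis (pi * l * symp ?S y))" for y
        using symp_antisym[of x y] by (simp only: K_def symp_simps) simp
      have ex: "pi * l\<^sup>2 / (4 * a) * sq ?S = pi * (t - \<alpha> / 2) * sq x"
        unfolding S a(2)[symmetric] by simp
      have "(\<integral>y. K y x \<partial>?M) = (complex_of_real (gauss x) * F x) *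
         complex_of_real (exp (- (pi * (t - \<alpha> / 2) * sq x)) / sqrt a ^ card J)"
        unfolding K using has_bochner_integral_integral_eq[OF gauss_symp_integral[OF a(1), of "\<lambda>_. 0" ?S]]
        by (simp only: integral_mult_right_zero ex symp_simps) simp
      also have "\<dots> = of_real (1 / sqrt a ^ card J) * (complex_of_real (gauss x * exp (- (pi * (t - \<alpha> / 2) * sq x))) * F x)"
        by simp
      also have "gauss x * exp (- (pi * (t - \<alpha> / 2) * sq x)) = exp (- (pi * t * sq x))"
        unfolding gauss_def exp_add[symmetric] by (simp add: algebra_simps)
      finally show "(\<integral>y. K y x \<partial>?M) = of_real (1 / sqrt a ^ card J) * (complex_of_real (exp (- (pi * t * sq x))) * F x)" .
    qed
    finally show ?thesis using a(1) by simp
  qed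
  \<comment> \<open>The scale that brings the parameter t = \<alpha> + n back to 1. The summand
    \<alpha> keeps t above \<alpha> / 2 from n = 0 on.\<close>
  define s where "s n = 1 / sqrt (\<alpha> + real n)" for n
  have \<alpha>n: "\<alpha> + real n > 0" for n using \<alpha>_pos by linarith
  have s_pos: "s n > 0" for n using \<alpha>n by (simp add: s_def)
  have s2: "(\<alpha> + real n) * (s n)\<^sup>2 = 1" for n using \<alpha>n[of n] by (simp add: s_def power_divide)
  have "s \<longlonglongrightarrow> 0" unfolding s_def by real_asymp
  then have s_at: "filterlim s (at 0) sequentially"
    using s_pos by (auto simp: filterlim_at intro!: always_eventually less_imp_neq[symmetric])
  have scaled0: "(\<integral>x. complex_of_real (exp (- (pi * sq x))) * F (\<lambda>j. s n * x j) \<partial>?M) = 0" for n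
  proof -
    let ?f = "\<lambda>x. complex_of_real (exp (- (pi * (\<alpha> + real n) * sq x))) * F x"
    have m: "?f \<in> borel_measurable ?M" by measurable
    have "\<alpha> + real n > \<alpha> / 2" using \<alpha>_pos by linarith
    then have "(\<integral>x. ?f (\<lambda>j\<in>J. s n * x j) \<partial>?M) = 0"
      using narrow0 integral_lebesgue_prod_affine[OF finite_J _ m, of "s n" "\<lambda>_. 0"] s_pos[of n] by simp
    moreover have "?f (\<lambda>j\<in>J. s n * x j) = complex_of_real (exp (- (pi * sq x))) * F (\<lambda>j. s n * x j)" for x
    proof -
      have "sq (\<lambda>j. s n * x j) = (s n)\<^sup>2 * sq x" by (simp add: sq_def power_mult_distrib sum_distrib_left)
      then have "pi * (\<alpha> + real n) * sq (\<lambda>j. s n * x j) = pi * ((\<alpha> + real n) * (s n)\<^sup>2) * sq x" by simp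
      moreover have "W (\<lambda>j\<in>J. s n * x j) = W (\<lambda>j. s n * x j)" by (rule W_cong) simp
      ultimately show ?thesis by (simp add: s2 F_def)
    qed
    ultimately show ?thesis by simp
  qed
  \<comment> \<open>After rescaling the Gaussian is fixed and only the argument of \<open>F\<close>
    shrinks, along a ray for each \<open>x\<close>. Hence \<open>W_continuous\<close> gives
    pointwise convergence, and the bound on \<open>F\<close> gives domination.\<close>
  have "(\<lambda>n. \<integral>x. complex_of_real (exp (- (pi * sq x))) * F (\<lambda>j. s n * x j) \<partial>?M)
      \<longlonglongrightarrow> (\<integral>x. complex_of_real (exp (- (pi * sq x))) * cinner u u \<partial>?M)"
  proof (rule integral_dominated_convergence)
    show "(\<lambda>x. complex_of_real (exp (- (pi * sq x))) * cinner u u) \<in> borel_measurable ?M" by measurable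
    show "(\<lambda>x. complex_of_real (exp (- (pi * sq x))) * F (\<lambda>j. s n * x j)) \<in> borel_measurable ?M" for n
      using W_affine_measurable[OF u(1) u(1), of "\<lambda>_. 0" "s n"] unfolding F_def by simp
    show "integrable ?M (\<lambda>x. exp (- (pi * sq x)) * (norm u)\<^sup>2)"
      using integrable_gaussian[of 1 "\<lambda>_. 0"] by simp
    show "AE x in ?M. (\<lambda>n. complex_of_real (exp (- (pi * sq x))) * F (\<lambda>j. s n * x j))
       \<longlonglongrightarrow> complex_of_real (exp (- (pi * sq x))) * cinner u u"
      unfolding F_def
      by (intro AE_I2 tendsto_mult tendsto_const filterlim_compose[OF W_continuous[OF u(1) u(1)] s_at])
    show "AE x in ?M. norm (complex_of_real (exp (- (pi * sq x))) * F (\<lambda>j. s n * x j)) \<le> exp (- (pi * sq x)) * (norm u)\<^sup>2" for n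
      by (simp add: norm_mult F_le)
  qed
  then have "(\<integral>x. complex_of_real (exp (- (pi * sq x))) * cinner u u \<partial>?M) = 0"
    unfolding scaled0 using LIMSEQ_unique tendsto_const by blast
  moreover have "(\<integral>x. complex_of_real (exp (- (pi * sq x))) \<partial>?M) = 1"
    using has_bochner_integral_integral_eq[OF gauss_symp_integral[of 1 "\<lambda>_. 0" "\<lambda>_. 0"]]
    by (simp add: symp_simps sq_def)
  ultimately have "cinner u u = 0" by simp
  then show False using u(2) by (simp add: cinner_self)
qed

text \<open>Any nonzero \<open>vac u\<close> works after normalisation: at y = 0 the sandwich
  formula identifies \<open>cinner u (vac u)\<close>, the constant in the general formula, with the
  squared norm of \<open>vac u\<close>.\<close>

lemma vacuum_vector:
  obtains e where "e \<in> H" "e \<noteq> 0" "\<And>y. cinner e (W y e) = of_real (gauss y)"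
proof -
  obtain u where u: "u \<in> H" "vac u \<noteq> 0" using vac_nonzero by blast
  define e where "e = complex_of_real (1 / norm (vac u)) *\<^sub>C vac u"
  have "gauss (\<lambda>_. 0) = 1" by (simp add: gauss_def sq_def)
  then have n: "cinner u (vac u) = of_real ((norm (vac u))\<^sup>2)"
    using vac_sandwich[OF u(1) u(1), of "\<lambda>_. 0"] by (simp add: W_zero vac_in u cinner_self)
  have "e \<in> H" unfolding e_def by (intro csubspace_scaleC csubspace_H vac_in u)
  moreover have "norm e = 1" using u(2) by (simp add: e_def norm_scaleC norm_divide)
  then have "e \<noteq> 0" by auto
  moreover have "cinner e (W y e) = of_real (gauss y)" for y
    using vac_sandwich[OF u(1) u(1), of y] u
    by (simp add: n e_def isometry_on_scaleC[OF W_isometry vac_in] cinner_scaleC_left cinner_scaleC_right power2_eq_square)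
  ultimately show thesis by (rule that)
qed

section \<open>The orbit of the vacuum vector and the Schur relation\<close>

text \<open>Irreducibility of the Weyl system enters here. The span of the orbit is invariant
  because products of Weyl operators are phases times Weyl operators, and isometries carry the
  invariance over to the closure.\<close>

lemma closure_hull_orbit:
  assumes e: "e \<in> H" "e \<noteq> 0"
  shows "closure (csubspace hull range (\<lambda>p. W p e)) = H"
proof -
  let ?D = "csubspace hull range (\<lambda>p. W p e)"
  have T: "range (\<lambda>p. W p e) \<subseteq> H" using W_in[OF e(1)] by auto
  have D: "?D \<subseteq> H" using T csubspace_H by (rule hull_minimal)
  have D_inv: "W x u \<in> ?D" if "u \<in> ?D" for x u
  proof (rule hull_induct_csubspace[OF _ _ T that])
    show "csubspace {u \<in> H. W x u \<in> ?D}"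
      using csubspace_hull[of "range (\<lambda>p. W p e)"] csubspace_H isometry_on_norm[OF W_isometry[of x] csubspace_0[OF csubspace_H]]
      by (auto simp: csubspace_def isometry_on_add[OF W_isometry] isometry_on_scaleC[OF W_isometry])
    fix u assume "u \<in> range (\<lambda>p. W p e)"
    then obtain p where "u = W p e" by auto
    then have "W x u = cis (pi * l * symp x p) *\<^sub>C W (\<lambda>j. x j + p j) e" by (simp add: W_symp e)
    moreover have "W (\<lambda>j. x j + p j) e \<in> ?D" by (rule hull_inc) auto
    ultimately show "W x u \<in> ?D" using csubspace_scaleC[OF csubspace_hull] by metis
  qed
  have cD: "closure ?D \<subseteq> H"
    using D closed_H by (simp add: closure_minimal closed_csubspace_def)
  have "W x u \<in> closure ?D" if u: "u \<in> closure ?D" for x u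
  proof -
    obtain f where f: "\<And>n. f n \<in> ?D" "f \<longlonglongrightarrow> u" using u by (auto simp: closure_sequential)
    have fH: "f n \<in> H" for n using f(1) D by blast
    have uH: "u \<in> H" using u cD by blast
    have "norm (W x (f n) - W x u) = norm (f n - u)" for n
      using isometry_on_norm[OF W_isometry csubspace_diff[OF csubspace_H fH uH]]
        isometry_on_diff[OF W_isometry csubspace_H fH uH] by simp
    then have "(\<lambda>n. W x (f n)) \<longlonglongrightarrow> W x u" using f(2) by (simp add: tendsto_iff dist_norm)
    then show ?thesis
      unfolding closure_sequential using D_inv[OF f(1)] by (intro exI[of _ "\<lambda>n. W x (f n)"]) auto
  qed
  moreover have "closed_csubspace (closure ?D)"
    unfolding closed_csubspace_def by (simp add: csubspace_closure csubspace_hull)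
  ultimately have "closure ?D = {0} \<or> closure ?D = H" using W_irreducible cD by blast
  moreover have "e \<in> ?D"
    using W_zero[OF e(1)] by (metis hull_inc rangeI)
  then have "e \<in> closure ?D" using closure_subset by blast
  ultimately show ?thesis using e(2) by auto
qed

lemma vacuum_orbit_cinner:
  assumes e: "e \<in> H" "\<And>y. cinner e (W y e) = of_real (gauss y)"
  shows "cinner (W p e) (W x (W q e)) =
    cis (pi * l * (symp p q + symp p x + symp q x)) * of_real (gauss (\<lambda>j. x j - (p j - q j)))"
proof -
  have "cinner (W p e) (W x (W q e)) = cinner e (W (\<lambda>j. - p j) (W x (W q e)))"
    by (rule W_adjoint'[OF e(1) W_in[OF W_in[OF e(1)]]])
  also have "W (\<lambda>j. - p j) (W x (W q e)) =
      cis (pi * l * symp x q) *\<^sub>C cis (pi * l * symp (\<lambda>j. - p j) (\<lambda>j. x j + q j)) *\<^sub>C W (\<lambda>j. - p j + (x j + q j)) e"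
    using e(1) by (simp add: W_symp W_in isometry_on_scaleC[OF W_isometry])
  also have "(\<lambda>j. - p j + (x j + q j)) = (\<lambda>j. x j - (p j - q j))" by auto
  finally show ?thesis
    unfolding cinner_scaleC_right e(2) cis_cnj mult.assoc[symmetric] cis_mult
    using symp_antisym[of q x] by (simp add: symp_simps algebra_simps)
qed

text \<open>It suffices to test the vectors \<open>W p e\<close>. For them the integrand has the
  shape of \<open>gauss_pair_integral\<close>, and both sides are Gaussians in p - p' and q - q'
  with matching phases. For even \<open>card J\<close> the constant \<kappa> is an integral power of
  |l|.\<close>

theorem weyl_schur_relation: "schur_relation (lebesgue_prod J) W H (1 / \<bar>l\<bar> ^ (card J div 2))" if "even (card J)"
proof -
  have \<kappa>: "1 / \<bar>l\<bar> ^ (card J div 2) = 1 / \<kappa>"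
    unfolding \<kappa>_def using that by (metis abs_ge_zero dvd_mult_div_cancel power_mult real_sqrt_pow2)
  obtain e where e: "e \<in> H" "e \<noteq> 0" "\<And>y. cinner e (W y e) = of_real (gauss y)"
    using vacuum_vector by blast
  note orbit = vacuum_orbit_cinner[OF e(1,3)]
  show ?thesis unfolding \<kappa>
  proof (rule schur_relation_generators[OF csubspace_H W_isometry])
    show T: "range (\<lambda>p. W p e) \<subseteq> H" using W_in[OF e(1)] by auto
    show "H \<subseteq> closure (csubspace hull range (\<lambda>p. W p e))" using closure_hull_orbit[OF e(1,2)] by simp
    show "0 \<le> 1 / \<kappa>" using \<kappa>_pos by simp
    show "(\<lambda>x. cinner u (W x v)) \<in> borel_measurable (lebesgue_prod J)"
      if "u \<in> range (\<lambda>p. W p e)" "v \<in> range (\<lambda>p. W p e)" for u v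
      using T that by (intro W_measurable) auto
    fix u u' v v' assume "u \<in> range (\<lambda>p. W p e)" "u' \<in> range (\<lambda>p. W p e)" "v \<in> range (\<lambda>p. W p e)" "v' \<in> range (\<lambda>p. W p e)"
    then obtain p p' q q' where eqs: "u = W p e" "u' = W p' e" "v = W q e" "v' = W q' e" by auto
    \<comment> \<open>\<open>S\<close> collects the vectors paired with \<open>x\<close> in the
      phases; \<open>A\<close> and \<open>B\<close> below are the centres of the two Gaussian
      factors.\<close>
    define S where "S j = p j + q j - (p' j + q' j)" for j
    define A B where "A j = p j - q j" and "B j = p' j - q' j" for j
    have "cinner u (W x v) * cnj (cinner u' (W x v')) = cis (pi * l * (symp p q - symp p' q')) *
       (complex_of_real (gauss (\<lambda>j. x j - A j) * gauss (\<lambda>j. x j - B j)) * cis (pi * l * symp S x))" for x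
    proof -
      have ph: "cis (pi * l * (symp p q + symp p x + symp q x)) * cis (- (pi * l * (symp p' q' + symp p' x + symp q' x)))
         = cis (pi * l * (symp p q - symp p' q')) * cis (pi * l * symp S x)"
        unfolding cis_mult S_def[abs_def] symp_simps by (simp add: algebra_simps)
      show ?thesis
        unfolding eqs orbit complex_cnj_mult cis_cnj complex_cnj_complex_of_real A_def B_def of_real_mult
        using arg_cong[OF ph, of "\<lambda>z. z * (complex_of_real (gauss (\<lambda>j. x j - (p j - q j))) * complex_of_real (gauss (\<lambda>j. x j - (p' j - q' j))))"]
        by (simp only: mult_ac)
    qed
    moreover have "cis (pi * l * (symp p q - symp p' q')) *
        (complex_of_real (exp (- (pi * \<alpha> / 4 * (sq (\<lambda>j. A j - B j) + sq S))) / \<kappa>) * cis (pi * l * (symp S A + symp S B) / 2))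
      = of_real (1 / \<kappa>) * cinner u u' * cinner v' v"
    proof -
      have W0: "W (\<lambda>_. 0) (W p e) = W p e" for p by (simp add: W_zero W_in e)
      have uu: "cinner u u' = cis (pi * l * symp p p') * of_real (gauss (\<lambda>j. p j - p' j))"
        using orbit[of p "\<lambda>_. 0" p'] gauss_minus[of "\<lambda>j. p j - p' j"] by (simp add: W0 symp_simps eqs)
      have vv: "cinner v' v = cis (pi * l * symp q' q) * of_real (gauss (\<lambda>j. q' j - q j))"
        using orbit[of q' "\<lambda>_. 0" q] gauss_minus[of "\<lambda>j. q' j - q j"] by (simp add: W0 symp_simps eqs)
      \<comment> \<open>Parallelogram law for p - p' and q - q': their difference is A - B and their
        sum is S.\<close>
      have "sq (\<lambda>j. A j - B j) + sq S = 2 * (sq (\<lambda>j. p j - p' j) + sq (\<lambda>j. q' j - q j))"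
        unfolding sq_def A_def B_def S_def sum.distrib[symmetric] sum_distrib_left
        by (intro sum.cong) (simp_all add: power2_eq_square algebra_simps)
      then have ex: "exp (- (pi * \<alpha> / 4 * (sq (\<lambda>j. A j - B j) + sq S))) = gauss (\<lambda>j. p j - p' j) * gauss (\<lambda>j. q' j - q j)"
        unfolding gauss_def exp_add[symmetric] by (simp add: algebra_simps)
      have "(symp S A + symp S B) / 2 = symp p p' + symp q' q - (symp p q - symp p' q')"
        unfolding S_def[abs_def] A_def[abs_def] B_def[abs_def] symp_simps
        using symp_antisym[of p q] symp_antisym[of p p'] symp_antisym[of p q'] symp_antisym[of q p']
          symp_antisym[of q q'] symp_antisym[of p' q'] by (simp add: symp_self)
      moreover have "pi * l * (symp p q - symp p' q') + pi * l * (symp S A + symp S B) / 2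
          = pi * l * (symp p q - symp p' q' + (symp S A + symp S B) / 2)"
        by (simp add: algebra_simps add_divide_distrib)
      ultimately have ph: "pi * l * (symp p q - symp p' q') + pi * l * (symp S A + symp S B) / 2 = pi * l * symp p p' + pi * l * symp q' q"
        by (simp add: field_simps)
      have "cis (pi * l * (symp p q - symp p' q')) * cis (pi * l * (symp S A + symp S B) / 2) = cis (pi * l * symp p p') * cis (pi * l * symp q' q)"
        unfolding cis_mult ph ..
      from arg_cong[OF this, of "\<lambda>z. z * complex_of_real (gauss (\<lambda>j. p j - p' j) * gauss (\<lambda>j. q' j - q j) / \<kappa>)"]
      show ?thesis unfolding uu vv ex by (simp add: mult_ac)
    qed
    ultimately show "schur_product (lebesgue_prod J) W (1 / \<kappa>) u u' v v'"
      using has_bochner_integral_mult_right[OF gauss_pair_integral[of A B S], of "cis (pi * l * (symp p q - symp p' q'))"]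
      unfolding schur_product_def by (simp only:)
  qed
qed

end

section \<open>Unipotent matrix groups with prescribed support\<close>

lemma pos_strict_mono: "a < b \<Longrightarrow> pos a < pos (b::'n::{finite,linorder})"
  unfolding pos_def by (intro psubset_card_mono) auto

lemma pos_less_iff: "pos a < pos b \<longleftrightarrow> a < (b::'n::{finite,linorder})"
  using pos_strict_mono[of a b] pos_strict_mono[of b a] by (cases a b rule: linorder_cases) auto

lemma pos_eq_iff [simp]: "pos a = pos b \<longleftrightarrow> a = (b::'n::{finite,linorder})"
  using pos_strict_mono[of a b] pos_strict_mono[of b a] by (cases a b rule: linorder_cases) auto

lemma pos_ge_1: "1 \<le> pos (a::'n::{finite,linorder})"
  unfolding pos_def by (metis One_nat_def Suc_leI atMost_iff card_gt_0_iff empty_iff finite order_refl)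

lemma pos_le_card: "pos (a::'n::{finite,linorder}) \<le> CARD('n)"
  unfolding pos_def by (intro card_mono) auto

lemma range_pos: "range (pos :: 'n::{finite,linorder} \<Rightarrow> nat) = {1..CARD('n)}"
proof (rule card_subset_eq)
  show "range (pos :: 'n \<Rightarrow> nat) \<subseteq> {1..CARD('n)}" using pos_ge_1 pos_le_card by auto
  show "card (range (pos :: 'n \<Rightarrow> nat)) = card {1..CARD('n)}" by (simp add: card_image inj_def)
qed simp

lemma pos_surj: "1 \<le> k \<Longrightarrow> k \<le> CARD('n) \<Longrightarrow> \<exists>a::'n::{finite,linorder}. pos a = k"
  using range_pos[where 'n = 'n] by (metis atLeastAtMost_iff imageE)

section \<open>Pattern algebras, pattern groups and elimination\<close>

definition pattern_alg :: "(nat \<times> nat) set \<Rightarrow> ('n::{finite,linorder}) sqmat set" where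
  "pattern_alg Q = {X. \<forall>a b. (pos a, pos b) \<notin> Q \<longrightarrow> X $ a $ b = 0}"

definition pattern_group :: "(nat \<times> nat) set \<Rightarrow> ('n::{finite,linorder}) sqmat set" where
  "pattern_group Q = {A. (\<forall>a. A $ a $ a = 1) \<and> (\<forall>a b. a \<noteq> b \<longrightarrow> (pos a, pos b) \<notin> Q \<longrightarrow> A $ a $ b = 0)}"

text \<open>Transitivity closes the matrices supported on \<open>Q\<close> under multiplication, as
  in an incidence algebra; the condition i < j makes them nilpotent.\<close>

definition strict_pattern :: "(nat \<times> nat) set \<Rightarrow> bool" where
  "strict_pattern Q \<longleftrightarrow> trans Q \<and> (\<forall>(i, j)\<in>Q. i < j)"

lemma strict_patternD: "strict_pattern Q \<Longrightarrow> (i, j) \<in> Q \<Longrightarrow> i < j"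
  by (auto simp: strict_pattern_def)

lemma strict_pattern_trans: "strict_pattern Q \<Longrightarrow> (i, j) \<in> Q \<Longrightarrow> (j, k) \<in> Q \<Longrightarrow> (i, k) \<in> Q"
  unfolding strict_pattern_def by (meson transD)

lemma subspace_pattern_alg: "subspace (pattern_alg Q)"
  by (auto simp: subspace_def pattern_alg_def)

lemma closed_pattern_group: "closed (pattern_group Q)"
proof -
  have "pattern_group Q = (\<Inter>a. {A. A $ a $ a = 1}) \<inter>
      (\<Inter>a. \<Inter>b\<in>{b. a \<noteq> b \<and> (pos a, pos b) \<notin> Q}. {A. A $ a $ b = 0})"
    by (auto simp: pattern_group_def)
  also have "closed \<dots>"
    by (intro closed_Int closed_INT ballI closed_Collect_eq continuous_intros)
  finally show ?thesis .
qed

lemma E_nth: "E i j $ a $ b = (if pos a = i \<and> pos b = j then 1 else 0)"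
  by (simp add: E_def)

lemma inner_matrix: "(A::('n::finite) sqmat) \<bullet> B = (\<Sum>a\<in>UNIV. \<Sum>b\<in>UNIV. A $ a $ b * B $ a $ b)"
  by (simp add: inner_vec_def)

lemma inner_E: "E (pos a) (pos b) \<bullet> A = A $ a $ b"
proof -
  have "E (pos a) (pos b) \<bullet> A = (\<Sum>c\<in>UNIV. \<Sum>d\<in>UNIV. if c = a \<and> d = b then A $ a $ b else 0)"
    unfolding inner_matrix E_nth by (intro sum.cong) auto
  also have "\<dots> = (\<Sum>c\<in>UNIV. if c = a then A $ a $ b else 0)"
    by (intro sum.cong) (auto simp: sum.delta')
  finally show ?thesis by simp
qed

lemma span_E: "span ((\<lambda>(i, j). E i j) ` Q) = (pattern_alg Q :: ('n::{finite,linorder}) sqmat set)"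
proof
  show "span ((\<lambda>(i, j). E i j) ` Q) \<subseteq> (pattern_alg Q :: 'n sqmat set)"
    by (rule span_minimal[OF _ subspace_pattern_alg]) (auto simp: pattern_alg_def E_nth)
  show "pattern_alg Q \<subseteq> span ((\<lambda>(i, j). E i j) ` Q :: 'n sqmat set)"
  proof
    fix X :: "'n sqmat" assume X: "X \<in> pattern_alg Q"
    have "X = (\<Sum>a\<in>UNIV. \<Sum>b\<in>UNIV. X $ a $ b *\<^sub>R E (pos a) (pos b))"
    proof -
      have "(\<Sum>a\<in>UNIV. \<Sum>b\<in>UNIV. X $ a $ b *\<^sub>R E (pos a) (pos b) $ c $ d) = X $ c $ d" for c d
      proof -
        have "(\<Sum>a\<in>UNIV. \<Sum>b\<in>UNIV. X $ a $ b *\<^sub>R E (pos a) (pos b) $ c $ d)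
           = (\<Sum>a\<in>UNIV. \<Sum>b\<in>UNIV. if a = c \<and> b = d then X $ c $ d else 0)"
          by (intro sum.cong) (auto simp: E_nth)
        also have "\<dots> = (\<Sum>a\<in>UNIV. if a = c then X $ c $ d else 0)"
          by (intro sum.cong) (auto simp: sum.delta')
        finally show ?thesis by simp
      qed
      then show ?thesis by (simp add: vec_eq_iff)
    qed
    also have "\<dots> \<in> span ((\<lambda>(i, j). E i j) ` Q)"
    proof (intro span_sum)
      fix a b
      show "X $ a $ b *\<^sub>R E (pos a) (pos b) \<in> span ((\<lambda>(i, j). E i j) ` Q)"
      proof (cases "(pos a, pos b) \<in> Q")
        case True
        then show ?thesis by (intro span_scale span_base) force
      next
        case False
        then have "X $ a $ b = 0" using X by (simp add: pattern_alg_def)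
        then show ?thesis by (simp add: span_zero)
      qed
    qed
    finally show "X \<in> span ((\<lambda>(i, j). E i j) ` Q)" .
  qed
qed

lemma pattern_group_iff:
  "strict_pattern Q \<Longrightarrow> (A :: ('n::{finite,linorder}) sqmat) \<in> pattern_group Q \<longleftrightarrow> A - mat 1 \<in> pattern_alg Q"
proof -
  assume Q: "strict_pattern Q"
  have diag: "(pos a, pos a) \<notin> Q" for a :: 'n
    using strict_patternD[OF Q, of "pos a" "pos a"] by auto
  have "A - mat 1 \<in> pattern_alg Q \<longleftrightarrow> (\<forall>a b. (pos a, pos b) \<notin> Q \<longrightarrow> A $ a $ b = (if a = b then 1 else 0))"
    by (simp add: pattern_alg_def mat_def)
  also have "\<dots> \<longleftrightarrow> A \<in> pattern_group Q"
    unfolding pattern_group_def mem_Collect_eq using diag by metis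
  finally show ?thesis ..
qed

lemma pattern_alg_mult:
  assumes "strict_pattern Q" "X \<in> pattern_alg Q" "Y \<in> pattern_alg Q"
  shows "X ** Y \<in> pattern_alg Q"
proof -
  have "X $ a $ m * Y $ m $ b = 0" if "(pos a, pos b) \<notin> Q" for a b m
    using assms(2,3) strict_pattern_trans[OF assms(1), of "pos a" "pos m" "pos b"] that
    by (auto simp: pattern_alg_def)
  then show ?thesis by (auto simp: pattern_alg_def matrix_matrix_mult_def intro!: sum.neutral)
qed

lemma matrix_add_rdistrib: "((A::real^'n^'m) + B) ** C = A ** C + B ** C"
  by (simp add: matrix_matrix_mult_def vec_eq_iff sum.distrib algebra_simps)

lemma scaleR_matrix_mult:
  fixes A :: "real^'n^'m" and B :: "real^'k^'n"
  shows "(t *\<^sub>R A) ** B = t *\<^sub>R (A ** B)" "A ** (t *\<^sub>R B) = t *\<^sub>R (A ** B)"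
  by (simp_all add: matrix_matrix_mult_def vec_eq_iff sum_distrib_left mult_ac)

lemma matrix_mult_1_plus: "(mat 1 + X) ** (mat 1 + Y) = mat 1 + (X + Y + X ** (Y::('n::finite) sqmat))"
  by (simp add: matrix_add_ldistrib matrix_add_rdistrib algebra_simps)

lemma pattern_group_mult:
  assumes Q: "strict_pattern Q" and AB: "A \<in> pattern_group Q" "B \<in> pattern_group Q"
  shows "A ** B \<in> pattern_group Q"
proof -
  define X Y where "X = A - mat 1" and "Y = B - mat 1"
  have XY: "X \<in> pattern_alg Q" "Y \<in> pattern_alg Q" using AB by (simp_all add: X_def Y_def pattern_group_iff[OF Q])
  have "A ** B - mat 1 = X + Y + X ** Y"
    using matrix_mult_1_plus[of X Y] by (simp add: X_def Y_def)
  then show ?thesis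
    using XY pattern_alg_mult[OF Q XY] by (simp add: pattern_group_iff[OF Q] subspace_add[OF subspace_pattern_alg])
qed

lemma one_in_pattern_group: "mat 1 \<in> pattern_group Q"
  by (simp add: pattern_group_def mat_def)

lemma elementary_mult_nth:
  fixes A :: "('n::{finite,linorder}) sqmat"
  shows "((mat 1 + t *\<^sub>R E (pos a) (pos b)) ** A) $ i $ j = A $ i $ j + (if i = a then t * A $ b $ j else 0)"
proof -
  have "(E (pos a) (pos b) ** A) $ i $ j = (\<Sum>m\<in>UNIV. if m = b then (if i = a then A $ b $ j else 0) else 0)"
    unfolding matrix_matrix_mult_def vec_lambda_beta by (intro sum.cong) (auto simp: E_nth)
  then have "(E (pos a) (pos b) ** A) $ i $ j = (if i = a then A $ b $ j else 0)" by simp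
  then show ?thesis by (simp add: matrix_add_rdistrib scaleR_matrix_mult)
qed

text \<open>Gaussian elimination: left multiplication by elementary matrices at positions of
  \<open>Q\<close> removes the off-diagonal entries one by one, and their number decreases.\<close>

lemma pattern_group_induct [consumes 2, case_names one step]:
  fixes A :: "('n::{finite,linorder}) sqmat"
  assumes Q: "strict_pattern Q" and A: "A \<in> pattern_group Q"
    and one: "P (mat 1)"
    and step: "\<And>(a::'n) (b::'n) t A. (pos a, pos b) \<in> Q \<Longrightarrow> A \<in> pattern_group Q \<Longrightarrow> P A \<Longrightarrow> P ((mat 1 + t *\<^sub>R E (pos a) (pos b)) ** A)"
  shows "P A"
  using A
proof (induction "card {(i, j). i \<noteq> j \<and> A $ i $ j \<noteq> 0}" arbitrary: A rule: less_induct)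
  case less
  let ?S = "\<lambda>A::'n sqmat. {(i, j). i \<noteq> j \<and> A $ i $ j \<noteq> 0}"
  show ?case
  proof (cases "?S A = {}")
    case True
    have "A = mat 1"
      using True less.prems by (auto simp: vec_eq_iff mat_def pattern_group_def)
    then show ?thesis using one by simp
  next
    case False
    \<comment> \<open>The last row with a nonzero off-diagonal entry. The column \<open>b\<close> of
      such an entry satisfies a < b, so row \<open>b\<close> is that of the unit matrix, and
      subtracting a multiple of it from row \<open>a\<close> changes the entry at (a, b)
      alone.\<close>
    define a where "a = Max (fst ` ?S A)"
    have "a \<in> fst ` ?S A" unfolding a_def using False by (intro Max_in) auto
    then obtain b where b: "a \<noteq> b" "A $ a $ b \<noteq> 0" by auto
    then have ab: "(pos a, pos b) \<in> Q" using less.prems by (auto simp: pattern_group_def)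
    then have "a < b" using strict_patternD[OF Q] pos_less_iff by blast
    have row_b: "A $ b $ j = (if j = b then 1 else 0)" for j
    proof (rule ccontr)
      assume "A $ b $ j \<noteq> (if j = b then 1 else 0)"
      then have "(b, j) \<in> ?S A" using less.prems by (auto simp: pattern_group_def split: if_splits)
      then have "b \<in> fst ` ?S A" by force
      then have "b \<le> a" unfolding a_def by (intro Max_ge) auto
      then show False using \<open>a < b\<close> by simp
    qed
    define t where "t = A $ a $ b"
    define A' where "A' = (mat 1 + (- t) *\<^sub>R E (pos a) (pos b)) ** A"
    have A'_nth: "A' $ i $ j = (if i = a \<and> j = b then 0 else A $ i $ j)" for i j
      unfolding A'_def elementary_mult_nth by (auto simp: row_b t_def)
    have A': "A' \<in> pattern_group Q" using less.prems b(1) by (auto simp: pattern_group_def A'_nth)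
    have "?S A' \<subset> ?S A" using b by (auto simp: A'_nth split: if_splits)
    then have "P A'" using less.hyps[of A'] A' by (simp add: psubset_card_mono)
    moreover have "A = (mat 1 + t *\<^sub>R E (pos a) (pos b)) ** A'"
      using \<open>a < b\<close> row_b by (auto simp: vec_eq_iff elementary_mult_nth A'_nth t_def)
    ultimately show ?thesis using step[OF ab A'] by simp
  qed
qed

lemma elementary_in_pattern_group: "strict_pattern Q \<Longrightarrow> (pos a, pos b) \<in> Q \<Longrightarrow> mat 1 + t *\<^sub>R E (pos a) (pos b) \<in> pattern_group Q"
  by (auto simp: pattern_group_iff pattern_alg_def E_nth)

lemma elementary_inverse:
  fixes a b :: "'n::{finite,linorder}"
  assumes "a \<noteq> b"
  shows "(mat 1 + t *\<^sub>R E (pos a) (pos b)) ** (mat 1 + (- t) *\<^sub>R E (pos a) (pos b)) = (mat 1 :: 'n sqmat)"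
proof -
  have "((mat 1 + t *\<^sub>R E (pos a) (pos b)) ** (mat 1 + (- t) *\<^sub>R E (pos a) (pos b))) $ i $ j = (mat 1 :: 'n sqmat) $ i $ j" for i j
    unfolding elementary_mult_nth using assms by (auto simp: E_nth mat_def)
  then show ?thesis by (simp add: vec_eq_iff)
qed

text \<open>Inverses are assembled along the factorisation into elementary matrices, whose inverses
  are elementary at the same position.\<close>

lemma matrix_group_pattern_group:
  assumes Q: "strict_pattern Q"
  shows "matrix_group (pattern_group Q :: ('n::{finite,linorder}) sqmat set)"
  unfolding matrix_group_def
proof (intro conjI ballI)
  show "mat 1 \<in> pattern_group Q" by (rule one_in_pattern_group)
  show "x ** y \<in> pattern_group Q" if "x \<in> pattern_group Q" "y \<in> pattern_group Q" for x y :: "'n sqmat"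
    using pattern_group_mult[OF Q that] .
  fix x :: "'n sqmat" assume "x \<in> pattern_group Q"
  with Q show "\<exists>y\<in>pattern_group Q. x ** y = mat 1 \<and> y ** x = mat 1"
  proof (induction rule: pattern_group_induct)
    case one
    show ?case using one_in_pattern_group by force
  next
    case (step a b t A)
    then obtain B where B: "B \<in> pattern_group Q" "A ** B = mat 1" "B ** A = mat 1" by auto
    have "a \<noteq> b" using strict_patternD[OF Q step(1)] by auto
    let ?e = "mat 1 + t *\<^sub>R E (pos a) (pos b) :: 'n sqmat" and ?f = "mat 1 + (- t) *\<^sub>R E (pos a) (pos b) :: 'n sqmat"
    have "B ** ?f \<in> pattern_group Q"
      by (intro pattern_group_mult[OF Q B(1)] elementary_in_pattern_group[OF Q step(1)])
    moreover have "?e ** A ** (B ** ?f) = mat 1"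
      using elementary_inverse[OF \<open>a \<noteq> b\<close>, of t] B(2)
      by (metis matrix_mul_assoc matrix_mul_lid)
    moreover have "?f ** ?e = mat 1"
      using elementary_inverse[OF \<open>a \<noteq> b\<close>, of "- t"] by simp
    then have "B ** ?f ** (?e ** A) = mat 1"
      using B(3) by (metis matrix_mul_assoc matrix_mul_lid)
    ultimately show ?case by blast
  qed
qed

section \<open>Exponentials of nilpotent pattern matrices\<close>

text \<open>Each factor \<open>X\<close> moves at least one position to the right. Consequently
  powers with exponent at least \<open>CARD('n)\<close> vanish.\<close>

lemma power_pattern_nth:
  assumes Q: "strict_pattern Q" and X: "X \<in> pattern_alg Q"
    and nz: "((**) X ^^ k) (mat 1) $ a $ b \<noteq> 0"
  shows "pos a + k \<le> pos b"
  using nz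
proof (induction k arbitrary: a)
  case 0
  then show ?case by (simp add: mat_def split: if_splits)
next
  case (Suc k)
  have "\<exists>m. X $ a $ m * ((**) X ^^ k) (mat 1) $ m $ b \<noteq> 0"
  proof (rule ccontr)
    assume "\<not> ?thesis"
    then have "((**) X ^^ Suc k) (mat 1) $ a $ b = 0"
      by (auto simp: matrix_matrix_mult_def intro!: sum.neutral)
    then show False using Suc.prems by simp
  qed
  then obtain m where m: "X $ a $ m \<noteq> 0" "((**) X ^^ k) (mat 1) $ m $ b \<noteq> 0" by auto
  then have "pos a < pos m" using X strict_patternD[OF Q] by (auto simp: pattern_alg_def)
  then show ?case using Suc.IH[OF m(2)] by simp
qed

lemma power_in_pattern_alg:
  assumes Q: "strict_pattern Q" and X: "X \<in> pattern_alg Q"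
  shows "((**) X ^^ Suc k) (mat 1) \<in> pattern_alg Q"
  by (induction k) (use X in \<open>auto intro: pattern_alg_mult[OF Q]\<close>)

text \<open>By nilpotency the exponential series is a finite sum, and all its terms after the unit
  matrix lie in the algebra.\<close>

lemma mexp_in_pattern_group:
  fixes X :: "('n::{finite,linorder}) sqmat"
  assumes Q: "strict_pattern Q" and X: "X \<in> pattern_alg Q"
  shows "mexp X \<in> pattern_group Q"
proof -
  have "((**) X ^^ k) (mat 1) = 0" if "k \<notin> {..<CARD('n)}" for k
  proof -
    have "((**) X ^^ k) (mat 1) $ a $ b = 0" for a b :: 'n
      using power_pattern_nth[OF Q X, of k a b] pos_le_card[of b] pos_ge_1[of a] that by fastforce
    then show ?thesis by (simp add: vec_eq_iff)
  qed
  then have "mexp X = (\<Sum>k<CARD('n). (1 / fact k) *\<^sub>R ((**) X ^^ k) (mat 1))"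
    unfolding mexp_def by (intro suminf_finite) auto
  also have "{..<CARD('n)} = {..<Suc (CARD('n) - 1)}" by simp
  also have "(\<Sum>k\<in>\<dots>. (1 / fact k) *\<^sub>R ((**) X ^^ k) (mat 1))
      = mat 1 + (\<Sum>k<CARD('n) - 1. (1 / fact (Suc k)) *\<^sub>R ((**) X ^^ Suc k) (mat 1))"
    unfolding sum.lessThan_Suc_shift by simp
  finally have "mexp X - mat 1 = (\<Sum>k<CARD('n) - 1. (1 / fact (Suc k)) *\<^sub>R ((**) X ^^ Suc k) (mat 1))" by simp
  also have "\<dots> \<in> pattern_alg Q"
    by (intro subspace_sum subspace_scale subspace_pattern_alg power_in_pattern_alg Q X)
  finally show ?thesis by (simp add: pattern_group_iff[OF Q])
qed

lemma mexp_quadratic: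
  assumes "X ** (X ** X) = 0"
  shows "mexp X = mat 1 + X + (1/2) *\<^sub>R (X ** (X::('n::finite) sqmat))"
proof -
  have z: "((**) X ^^ (k + 3)) (mat 1) = 0" for k
    by (induction k) (simp_all add: assms eval_nat_numeral)
  have "((**) X ^^ k) (mat 1) = 0" if "k \<notin> {..<3}" for k
    using z[of "k - 3"] that by simp
  then have "mexp X = (\<Sum>k<3. (1 / fact k) *\<^sub>R ((**) X ^^ k) (mat 1))"
    unfolding mexp_def by (intro suminf_finite) auto
  then show ?thesis by (simp add: eval_nat_numeral)
qed

text \<open>The range condition is there because \<open>E i j\<close> is the zero matrix when
  \<open>j\<close> numbers no column.\<close>

lemma E_mult: "E i j ** E k m = (if j = k \<and> 1 \<le> j \<and> j \<le> CARD('n) then E i m else (0::('n::{finite,linorder}) sqmat))"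
proof -
  have "(E i j ** E k m) $ a $ b = (if j = k \<and> 1 \<le> j \<and> j \<le> CARD('n) then E i m else (0::'n sqmat)) $ a $ b" for a b :: 'n
  proof (cases "\<exists>c::'n. pos c = j")
    case True
    then obtain c :: 'n where c: "pos c = j" by blast
    have "(E i j ** E k m) $ a $ b = (\<Sum>d\<in>UNIV. if d = c then (if pos a = i \<and> pos b = m \<and> j = k then 1 else 0) else 0 :: real)"
      unfolding matrix_matrix_mult_def vec_lambda_beta using c by (intro sum.cong) (auto simp: E_nth)
    then show ?thesis using c pos_ge_1[of c] pos_le_card[of c] by (simp add: E_nth)
  next
    case False
    then have "\<not> (1 \<le> j \<and> j \<le> CARD('n))" using pos_surj by blast
    moreover have "(E i j ** E k m) $ a $ b = 0"
      using False unfolding matrix_matrix_mult_def by (auto simp: E_nth intro!: sum.neutral)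
    ultimately show ?thesis by auto
  qed
  then show ?thesis by (simp add: vec_eq_iff)
qed

text \<open>The pattern group contains the exponentials. Conversely, elementary matrices generate
  it, and each is an exponential because an off-diagonal matrix unit squares to 0.\<close>

lemma analytic_subgroup_pattern:
  assumes Q: "strict_pattern Q"
  shows "analytic_subgroup (pattern_alg Q) = (pattern_group Q :: ('n::{finite,linorder}) sqmat set)"
proof
  show "analytic_subgroup (pattern_alg Q) \<subseteq> (pattern_group Q :: 'n sqmat set)"
    unfolding analytic_subgroup_def
    using mexp_in_pattern_group[OF Q] by (intro hull_minimal matrix_group_pattern_group Q) auto
  have hull: "x \<in> analytic_subgroup (pattern_alg Q)"
    if "\<And>G. matrix_group G \<Longrightarrow> mexp ` pattern_alg Q \<subseteq> G \<Longrightarrow> x \<in> G" for x :: "'n sqmat"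
    using that by (auto simp: analytic_subgroup_def hull_def)
  show "pattern_group Q \<subseteq> analytic_subgroup (pattern_alg Q :: 'n sqmat set)"
  proof (rule subsetI, rule hull)
    fix A :: "'n sqmat" and G :: "'n sqmat set"
    assume A: "A \<in> pattern_group Q" and G: "matrix_group G" "mexp ` pattern_alg Q \<subseteq> G"
    from Q A show "A \<in> G"
    proof (induction rule: pattern_group_induct)
      case one
      then show ?case using G(1) by (simp add: matrix_group_def)
    next
      case (step a b t A)
      have "pos a \<noteq> pos b" using strict_patternD[OF Q step(1)] by auto
      then have "(t *\<^sub>R E (pos a) (pos b)) ** (t *\<^sub>R E (pos a) (pos b)) = (0::'n sqmat)"
        by (simp add: scaleR_matrix_mult E_mult)
      then have "mexp (t *\<^sub>R E (pos a) (pos b)) = (mat 1 + t *\<^sub>R E (pos a) (pos b) :: 'n sqmat)"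
        by (subst mexp_quadratic) simp_all
      moreover have "t *\<^sub>R E (pos a) (pos b) \<in> (pattern_alg Q :: 'n sqmat set)"
        using step(1) by (auto simp: pattern_alg_def E_nth)
      ultimately have "(mat 1 + t *\<^sub>R E (pos a) (pos b) :: 'n sqmat) \<in> G" using G(2) by force
      then show ?case using step(3) G(1) by (simp add: matrix_group_def)
    qed
  qed
qed

section \<open>The groups of the theorem as pattern groups of hooks\<close>

text \<open>A hook whose corner (r, k - r + 1) is the central position; \<open>n_pattern\<close>
  consists of the outermost hooks.\<close>

definition m_pattern :: "nat \<Rightarrow> nat \<Rightarrow> (nat \<times> nat) set" where
  "m_pattern k r = insert (r, k - r + 1) (noncentral k r)"

lemma m_pattern_iff:
  assumes "1 \<le> r" "2 * r \<le> k"
  shows "(i, j) \<in> m_pattern k r \<longleftrightarrow> r \<le> i \<and> i < j \<and> j \<le> k - r + 1 \<and> (i = r \<or> j = k - r + 1)"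
  using assms by (auto simp: m_pattern_def noncentral_def)

lemma strict_m_pattern: "1 \<le> r \<Longrightarrow> 2 * r \<le> k \<Longrightarrow> strict_pattern (m_pattern k r)"
  unfolding strict_pattern_def by (auto simp: m_pattern_iff trans_def)

definition n_pattern :: "nat \<Rightarrow> nat \<Rightarrow> (nat \<times> nat) set" where
  "n_pattern k r = (\<Union>q\<in>{1..r}. m_pattern k q)"

lemma n_pattern_iff:
  assumes "2 * r \<le> k"
  shows "(i, j) \<in> n_pattern k r \<longleftrightarrow> 1 \<le> i \<and> i < j \<and> j \<le> k \<and> (i \<le> r \<or> k + 1 - j \<le> r)"
proof
  assume "(i, j) \<in> n_pattern k r"
  then obtain q where "q \<in> {1..r}" "(i, j) \<in> m_pattern k q" by (auto simp: n_pattern_def)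
  then show "1 \<le> i \<and> i < j \<and> j \<le> k \<and> (i \<le> r \<or> k + 1 - j \<le> r)"
    using assms m_pattern_iff[of q k i j] by auto
next
  assume ij: "1 \<le> i \<and> i < j \<and> j \<le> k \<and> (i \<le> r \<or> k + 1 - j \<le> r)"
  \<comment> \<open>The number of the hook through (i, j): the distance to the first row or to the
    last column, whichever is smaller, counted from 1.\<close>
  define q where "q = min i (k + 1 - j)"
  have "q \<in> {1..r}" "2 * q \<le> k" using ij assms by (auto simp: q_def)
  moreover have "(i, j) \<in> m_pattern k q"
    using ij calculation by (subst m_pattern_iff) (auto simp: q_def min_def)
  ultimately show "(i, j) \<in> n_pattern k r" by (auto simp: n_pattern_def)
qed

lemma strict_n_pattern: "2 * r \<le> k \<Longrightarrow> strict_pattern (n_pattern k r)"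
  unfolding strict_pattern_def by (auto simp: n_pattern_iff trans_def)

lemma M_grp_eq:
  assumes "1 \<le> r" "2 * r \<le> CARD('n)"
  shows "M_grp r = (pattern_group (m_pattern CARD('n) r) :: ('n::{finite,linorder}) sqmat set)"
proof -
  have "m_lie r = (pattern_alg (m_pattern CARD('n) r) :: 'n sqmat set)"
    unfolding span_E[symmetric] m_lie_def m_pattern_def E_central_def by simp
  then show ?thesis using analytic_subgroup_pattern[OF strict_m_pattern[OF assms]] by (simp add: M_grp_def)
qed

lemma Z_grp_eq:
  assumes "1 \<le> r" "2 * r \<le> CARD('n)"
  shows "Z_grp r = (pattern_group {(r, CARD('n) - r + 1)} :: ('n::{finite,linorder}) sqmat set)"
proof -
  have "z_lie r = (pattern_alg {(r, CARD('n) - r + 1)} :: 'n sqmat set)"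
    unfolding span_E[symmetric] z_lie_def E_central_def by simp
  moreover have "strict_pattern {(r, CARD('n) - r + 1)}"
    using assms by (auto simp: strict_pattern_def trans_def)
  ultimately show ?thesis using analytic_subgroup_pattern by (simp add: Z_grp_def)
qed

lemma N_grp_eq:
  assumes "2 * r \<le> CARD('n)"
  shows "N_grp r = (pattern_group (n_pattern CARD('n) r) :: ('n::{finite,linorder}) sqmat set)"
proof -
  let ?E = "\<lambda>(i, j). E i j :: 'n sqmat"
  have m: "m_lie k = span (?E ` m_pattern CARD('n) k)" for k
    unfolding m_lie_def m_pattern_def E_central_def by simp
  have "n_lie r = span (?E ` n_pattern CARD('n) r)"
  proof
    show "n_lie r \<subseteq> span (?E ` n_pattern CARD('n) r)"
      unfolding n_lie_def m n_pattern_def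
      by (intro span_minimal[OF _ subspace_span] UN_least span_mono image_mono UN_upper)
    show "span (?E ` n_pattern CARD('n) r) \<subseteq> n_lie r"
      unfolding n_lie_def m n_pattern_def by (intro span_mono) (fastforce intro: span_base)
  qed
  then show ?thesis
    using analytic_subgroup_pattern[OF strict_n_pattern[OF assms]] by (simp add: N_grp_def span_E)
qed

text \<open>For i < j the sum of i and \<open>CARD('n) + 1 - j\<close> is at most
  \<open>CARD('n)\<close>, so one summand is at most its half: the hooks exhaust the positions above
  the diagonal.\<close>

lemma N_grp_unipotent: "N_grp (CARD('n) div 2) = (unipotent_group :: ('n::{finite,linorder}) sqmat set)"
proof -
  have "(pos a, pos b) \<in> n_pattern CARD('n) (CARD('n) div 2) \<longleftrightarrow> a < b" for a b :: 'n
    using pos_ge_1[of a] pos_le_card[of b] pos_less_iff[of a b] by (subst n_pattern_iff) auto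
  then show ?thesis
    by (subst N_grp_eq) (auto simp: pattern_group_def unipotent_group_def not_less)
qed

section \<open>Coordinates on the Heisenberg groups\<close>

lemma finite_noncentral: "finite (noncentral k r)"
proof -
  have "noncentral k r = (\<lambda>s. (r, s)) ` {r+1..k-r} \<union> (\<lambda>q. (q, k - r + 1)) ` {r+1..k-r}"
    by (auto simp: noncentral_def)
  then show ?thesis by simp
qed

lemma sum_noncentral:
  fixes f :: "nat \<times> nat \<Rightarrow> 'a::comm_monoid_add"
  shows "sum f (noncentral k r) = (\<Sum>s=r+1..k-r. f (r, s)) + (\<Sum>s=r+1..k-r. f (s, k - r + 1))"
proof -
  have "noncentral k r = (\<lambda>s. (r, s)) ` {r+1..k-r} \<union> (\<lambda>q. (q, k - r + 1)) ` {r+1..k-r}"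
    by (auto simp: noncentral_def)
  also have "sum f \<dots> = sum f ((\<lambda>s. (r, s)) ` {r+1..k-r}) + sum f ((\<lambda>q. (q, k - r + 1)) ` {r+1..k-r})"
    by (intro sum.union_disjoint) auto
  finally show ?thesis by (simp add: sum.reindex inj_on_def)
qed

lemma card_noncentral: "card (noncentral k r) = 2 * (k - 2 * r)"
  unfolding card_eq_sum sum_noncentral by (simp add: mult_2)

definition heis_mat :: "nat \<Rightarrow> (nat \<times> nat \<Rightarrow> real) \<Rightarrow> ('n::{finite,linorder}) sqmat" where
  "heis_mat r c = (\<Sum>(i, j)\<in>noncentral CARD('n) r. c (i, j) *\<^sub>R E i j)"

text \<open>The bilinear form that matrix multiplication produces, pairing the row part of
  \<open>c\<close> with the column part of \<open>d\<close>. Its antisymmetrisation is the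
  symplectic form of the Heisenberg algebra.\<close>

definition heis_form :: "nat \<Rightarrow> nat \<Rightarrow> (nat \<times> nat \<Rightarrow> real) \<Rightarrow> (nat \<times> nat \<Rightarrow> real) \<Rightarrow> real" where
  "heis_form k r c d = (\<Sum>s=r+1..k-r. c (r, s) * d (s, k - r + 1))"

lemma heis_mat_cong: "(\<And>p. p \<in> noncentral CARD('n) r \<Longrightarrow> c p = d p) \<Longrightarrow> heis_mat r c = (heis_mat r d :: ('n::{finite,linorder}) sqmat)"
  unfolding heis_mat_def by (intro sum.cong) auto

lemma heis_mat_add: "heis_mat r (\<lambda>p. c p + d p) = heis_mat r c + (heis_mat r d :: ('n::{finite,linorder}) sqmat)"
  unfolding heis_mat_def by (simp add: split_beta scaleR_add_left sum.distrib)

lemma heis_mat_scale: "heis_mat r (\<lambda>p. t * c p) = t *\<^sub>R (heis_mat r c :: ('n::{finite,linorder}) sqmat)"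
  unfolding heis_mat_def by (simp add: split_beta scaleR_sum_right)

lemma linear_mult_left_matrix: "linear (\<lambda>A::real^'n^'m. A ** (B::real^'k^'n))"
  by (auto intro!: linearI simp: matrix_add_rdistrib scaleR_matrix_mult)

lemma linear_mult_right_matrix: "linear (\<lambda>B::real^'k^'n. (A::real^'n^'m) ** B)"
  by (auto intro!: linearI simp: matrix_add_ldistrib scaleR_matrix_mult)

lemma sum_E_mult_sum_E:
  "(\<Sum>p\<in>A. c p *\<^sub>R E (f p) (g p)) ** (\<Sum>q\<in>B. d q *\<^sub>R E (f' q) (g' q)) =
   (\<Sum>p\<in>A. \<Sum>q\<in>B. (c p * d q) *\<^sub>R (E (f p) (g p) ** E (f' q) (g' q) :: ('n::{finite,linorder}) sqmat))"
  unfolding linear_sum[OF linear_mult_left_matrix] unfolding linear_sum[OF linear_mult_right_matrix]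
  by (simp add: scaleR_matrix_mult mult.commute)

text \<open>Among the products of two matrix units of one hook only \<open>E r s ** E s k\<close>
  with \<open>k = CARD('n) - r + 1\<close> is nonzero, and it is the central unit.\<close>

lemma
  assumes r: "1 \<le> r" "2 * r \<le> CARD('n)"
  shows heis_mat_mult: "heis_mat r c ** heis_mat r d = heis_form CARD('n) r c d *\<^sub>R (E_central r :: ('n::{finite,linorder}) sqmat)"
    and heis_mat_central: "heis_mat r c ** E_central r = (0 :: 'n sqmat)"
    and central_heis_mat: "E_central r ** heis_mat r c = (0 :: 'n sqmat)"
    and central_central: "E_central r ** E_central r = (0 :: 'n sqmat)"
proof -
  define k I where "k = CARD('n) - r + 1" and "I = {r+1..CARD('n)-r}"
  have split: "heis_mat r c = (\<Sum>s\<in>I. c (r, s) *\<^sub>R E r s) + (\<Sum>s\<in>I. c (s, k) *\<^sub>R E s k :: 'n sqmat)" for c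
    unfolding heis_mat_def k_def I_def by (simp add: sum_noncentral split_beta)
  have E: "E r s ** E r s' = (0 :: 'n sqmat)" "E s k ** E s' k = (0 :: 'n sqmat)" "E s k ** E r s' = (0 :: 'n sqmat)"
     "E r s ** E s' k = (if s = s' then E r k else 0 :: 'n sqmat)" if "s \<in> I" "s' \<in> I" for s s'
    using that r by (auto simp: E_mult k_def I_def)
  have "heis_mat r c ** heis_mat r d = (\<Sum>s\<in>I. \<Sum>s'\<in>I. (c (r, s) * d (s', k)) *\<^sub>R (if s = s' then E r k else 0 :: 'n sqmat))"
    unfolding split matrix_add_ldistrib matrix_add_rdistrib sum_E_mult_sum_E by (simp add: E cong: sum.cong)
  also have "\<dots> = (\<Sum>s\<in>I. \<Sum>s'\<in>I. if s = s' then (c (r, s) * d (s, k)) *\<^sub>R E r k else 0)"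
    by (intro sum.cong) auto
  also have "\<dots> = (\<Sum>s\<in>I. (c (r, s) * d (s, k)) *\<^sub>R E r k)"
    by (intro sum.cong) (auto simp: I_def)
  finally show "heis_mat r c ** heis_mat r d = heis_form CARD('n) r c d *\<^sub>R (E_central r :: 'n sqmat)"
    by (simp add: heis_form_def E_central_def scaleR_sum_left k_def I_def)
  \<comment> \<open>A sum with one term, so that the rule for products of sums applies.\<close>
  have Z: "E_central r = (\<Sum>p\<in>{()}. 1 *\<^sub>R E r k :: 'n sqmat)" by (simp add: E_central_def k_def)
  show "heis_mat r c ** E_central r = (0 :: 'n sqmat)"
    unfolding split Z matrix_add_rdistrib sum_E_mult_sum_E using r by (auto simp: E_mult k_def I_def intro!: sum.neutral)
  show "E_central r ** heis_mat r c = (0 :: 'n sqmat)"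
    unfolding split Z matrix_add_ldistrib sum_E_mult_sum_E using r by (auto simp: E_mult k_def I_def intro!: sum.neutral)
  show "E_central r ** E_central r = (0 :: 'n sqmat)"
    using r by (auto simp: E_central_def E_mult)
qed

lemma mexp_heis_mat:
  assumes r: "1 \<le> r" "2 * r \<le> CARD('n)"
  shows "mexp (heis_mat r c) = mat 1 + heis_mat r c + (heis_form CARD('n) r c c / 2) *\<^sub>R (E_central r :: ('n::{finite,linorder}) sqmat)"
proof -
  have "heis_mat r c ** (heis_mat r c ** heis_mat r c) = (0 :: 'n sqmat)"
    by (simp add: heis_mat_mult[OF r] heis_mat_central[OF r] scaleR_matrix_mult)
  from mexp_quadratic[OF this] show ?thesis by (simp add: heis_mat_mult[OF r])
qed

lemma mexp_central:
  assumes r: "1 \<le> r" "2 * r \<le> CARD('n)"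
  shows "mexp (t *\<^sub>R E_central r) = mat 1 + t *\<^sub>R (E_central r :: ('n::{finite,linorder}) sqmat)"
proof -
  have "(t *\<^sub>R E_central r) ** (t *\<^sub>R E_central r) = (0 :: 'n sqmat)"
    by (simp add: central_central[OF r] scaleR_matrix_mult)
  then show ?thesis by (subst mexp_quadratic) simp_all
qed

lemma mexp_heis_mat_central:
  assumes r: "1 \<le> r" "2 * r \<le> CARD('n)"
  shows "mexp (heis_mat r c) ** mexp (t *\<^sub>R E_central r) =
    mat 1 + heis_mat r c + (heis_form CARD('n) r c c / 2 + t) *\<^sub>R (E_central r :: ('n::{finite,linorder}) sqmat)"
  unfolding mexp_heis_mat[OF r] mexp_central[OF r]
  by (simp add: matrix_add_ldistrib matrix_add_rdistrib heis_mat_central[OF r] central_central[OF r]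
      scaleR_matrix_mult algebra_simps)

text \<open>The Baker-Campbell-Hausdorff formula, which ends after the first bracket because that
  bracket is central.\<close>

lemma mexp_heis_mat_mult:
  assumes r: "1 \<le> r" "2 * r \<le> CARD('n)"
  shows "mexp (heis_mat r c) ** mexp (heis_mat r d) = mexp (heis_mat r (\<lambda>p. c p + d p)) **
    mexp (((heis_form CARD('n) r c d - heis_form CARD('n) r d c) / 2) *\<^sub>R (E_central r :: ('n::{finite,linorder}) sqmat))"
proof -
  have "heis_form CARD('n) r (\<lambda>p. c p + d p) (\<lambda>p. c p + d p) =
      heis_form CARD('n) r c c + heis_form CARD('n) r c d + heis_form CARD('n) r d c + heis_form CARD('n) r d d"
    unfolding heis_form_def sum.distrib[symmetric] by (intro sum.cong) (simp_all add: algebra_simps)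
  then show ?thesis
    unfolding mexp_heis_mat_central[OF r] unfolding mexp_heis_mat[OF r]
    by (simp add: matrix_add_ldistrib matrix_add_rdistrib heis_mat_central[OF r] central_heis_mat[OF r] heis_mat_mult[OF r]
        central_central[OF r] scaleR_matrix_mult heis_mat_add
        algebra_simps add_divide_distrib diff_divide_distrib flip: scaleR_add_left)
qed

section \<open>Exponential coordinates and cosets of the centre\<close>

text \<open>Reads off the non-central entries; the restriction makes the result a point of
  \<open>lebesgue_prod\<close>.\<close>

definition heis_coord :: "nat \<Rightarrow> ('n::{finite,linorder}) sqmat \<Rightarrow> nat \<times> nat \<Rightarrow> real" where
  "heis_coord r x = (\<lambda>p\<in>noncentral CARD('n) r. E (fst p) (snd p) \<bullet> x)"

lemma E_inner_E:
  assumes "1 \<le> i" "i \<le> CARD('n)" "1 \<le> j" "j \<le> CARD('n)"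
  shows "E i j \<bullet> (E k m :: ('n::{finite,linorder}) sqmat) = (if k = i \<and> m = j then 1 else 0)"
proof -
  obtain a b :: 'n where "pos a = i" "pos b = j" using assms pos_surj by metis
  then show ?thesis using inner_E[of a b "E k m"] by (auto simp: E_nth)
qed

lemma noncentral_range:
  assumes "1 \<le> r" "2 * r \<le> k" "(i, j) \<in> noncentral k r"
  shows "1 \<le> i" "i < j" "j \<le> k" "r \<le> i" "j \<le> k - r + 1" "i = r \<or> j = k - r + 1" "(i, j) \<noteq> (r, k - r + 1)"
  using assms by (auto simp: noncentral_def)

lemma heis_coord_affine:
  assumes r: "1 \<le> r" "2 * r \<le> CARD('n)"
  shows "heis_coord r (mat 1 + heis_mat r c + t *\<^sub>R (E_central r :: ('n::{finite,linorder}) sqmat)) = restrict c (noncentral CARD('n) r)"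
proof -
  have "E i j \<bullet> (mat 1 + heis_mat r c + t *\<^sub>R (E_central r :: 'n sqmat)) = c (i, j)" if p: "(i, j) \<in> noncentral CARD('n) r" for i j
  proof -
    note rng = noncentral_range[OF r p]
    then have "1 \<le> i" "i \<le> CARD('n)" "1 \<le> j" "j \<le> CARD('n)" by auto
    note EE = E_inner_E[OF this]
    obtain a b :: 'n where ab: "pos a = i" "pos b = j" using \<open>1 \<le> i\<close> \<open>i \<le> CARD('n)\<close> \<open>1 \<le> j\<close> \<open>j \<le> CARD('n)\<close> pos_surj by metis
    then have "a \<noteq> b" using rng by auto
    then have "E i j \<bullet> (mat 1 :: 'n sqmat) = 0" using inner_E[of a b "mat 1"] ab by (simp add: mat_def)
    moreover have "E i j \<bullet> (heis_mat r c :: 'n sqmat) = (\<Sum>p'\<in>noncentral CARD('n) r. if p' = (i, j) then c (i, j) else 0)"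
      unfolding heis_mat_def inner_sum_right by (intro sum.cong) (auto simp: EE split: if_splits)
    then have "E i j \<bullet> (heis_mat r c :: 'n sqmat) = c (i, j)" using p finite_noncentral by simp
    moreover have "E i j \<bullet> (E_central r :: 'n sqmat) = 0" using rng by (auto simp: E_central_def EE)
    ultimately show ?thesis by (simp add: inner_add_right)
  qed
  then show ?thesis by (auto simp: heis_coord_def)
qed

lemma M_grp_eq_affine:
  assumes r: "1 \<le> r" "2 * r \<le> CARD('n)"
  shows "M_grp r = {mat 1 + heis_mat r c + t *\<^sub>R (E_central r :: ('n::{finite,linorder}) sqmat) | c t. True}"
proof -
  let ?k = "CARD('n) - r + 1" and ?Q = "noncentral CARD('n) r"
  have "pattern_alg (m_pattern CARD('n) r) = {heis_mat r c + t *\<^sub>R (E_central r :: 'n sqmat) | c t. True}"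
  proof
    have sub: "subspace {heis_mat r c + t *\<^sub>R (E_central r :: 'n sqmat) | c t. True}"
      unfolding subspace_def
    proof (intro conjI ballI allI; clarify)
      show "\<exists>c t. 0 = heis_mat r c + t *\<^sub>R (E_central r :: 'n sqmat) \<and> True"
        by (rule exI[of _ "\<lambda>_. 0"], rule exI[of _ 0]) (simp add: heis_mat_def split_beta)
      show "\<exists>c' t'. heis_mat r c + t *\<^sub>R E_central r + (heis_mat r d + s *\<^sub>R E_central r) = heis_mat r c' + t' *\<^sub>R (E_central r :: 'n sqmat) \<and> True" for c t d s
        by (rule exI[of _ "\<lambda>p. c p + d p"], rule exI[of _ "t + s"]) (simp add: heis_mat_add algebra_simps)
      show "\<exists>c' t'. a *\<^sub>R (heis_mat r c + t *\<^sub>R E_central r) = heis_mat r c' + t' *\<^sub>R (E_central r :: 'n sqmat) \<and> True" for a c t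
        by (rule exI[of _ "\<lambda>p. a * c p"], rule exI[of _ "a * t"]) (simp add: heis_mat_scale algebra_simps)
    qed
    show "pattern_alg (m_pattern CARD('n) r) \<subseteq> {heis_mat r c + t *\<^sub>R (E_central r :: 'n sqmat) | c t. True}"
      unfolding span_E[symmetric]
    proof (rule span_minimal[OF _ sub], clarify)
      fix i j assume "(i, j) \<in> m_pattern CARD('n) r"
      then consider "(i, j) = (r, ?k)" | "(i, j) \<in> ?Q" by (auto simp: m_pattern_def)
      then show "\<exists>c t. E i j = heis_mat r c + t *\<^sub>R (E_central r :: 'n sqmat) \<and> True"
      proof cases
        case 1
        then show ?thesis
          by (intro exI[of _ "\<lambda>_. 0"] exI[of _ 1]) (simp add: heis_mat_def E_central_def split_beta)
      next
        case 2
        have "heis_mat r (\<lambda>p. if p = (i, j) then 1 else 0) = (\<Sum>p\<in>?Q. if p = (i, j) then E i j else 0 :: 'n sqmat)"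
          unfolding heis_mat_def by (intro sum.cong) (auto split: if_splits)
        also have "\<dots> = E i j" using 2 finite_noncentral by simp
        finally show ?thesis
          by (intro exI[of _ "\<lambda>p. if p = (i, j) then 1 else 0"] exI[of _ 0]) simp
      qed
    qed
    show "{heis_mat r c + t *\<^sub>R (E_central r :: 'n sqmat) | c t. True} \<subseteq> pattern_alg (m_pattern CARD('n) r)"
    proof clarify
      fix c t
      have E: "E i j \<in> (pattern_alg (m_pattern CARD('n) r) :: 'n sqmat set)" if "(i, j) \<in> m_pattern CARD('n) r" for i j
        unfolding span_E[symmetric] using that by (force intro: span_base)
      have "heis_mat r c \<in> (pattern_alg (m_pattern CARD('n) r) :: 'n sqmat set)"
        unfolding heis_mat_def split_beta
        by (intro subspace_sum subspace_scale subspace_pattern_alg E) (auto simp: m_pattern_def)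
      moreover have "E_central r \<in> (pattern_alg (m_pattern CARD('n) r) :: 'n sqmat set)"
        unfolding E_central_def by (rule E) (simp add: m_pattern_def)
      ultimately show "heis_mat r c + t *\<^sub>R E_central r \<in> (pattern_alg (m_pattern CARD('n) r) :: 'n sqmat set)"
        by (intro subspace_add subspace_scale subspace_pattern_alg)
    qed
  qed
  then have "x \<in> M_grp r \<longleftrightarrow> (\<exists>c t. x - mat 1 = heis_mat r c + t *\<^sub>R (E_central r :: 'n sqmat))" for x :: "'n sqmat"
    unfolding M_grp_eq[OF r] pattern_group_iff[OF strict_m_pattern[OF r]] by auto
  then show ?thesis by (auto simp: algebra_simps)
qed

lemma Z_grp_eq_mexp:
  assumes r: "1 \<le> r" "2 * r \<le> CARD('n)"
  shows "Z_grp r = range (\<lambda>t. mexp (t *\<^sub>R (E_central r :: ('n::{finite,linorder}) sqmat)))"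
proof -
  have strict: "strict_pattern {(r, CARD('n) - r + 1)}"
    using r by (auto simp: strict_pattern_def trans_def)
  have "pattern_alg {(r, CARD('n) - r + 1)} = range (\<lambda>t. t *\<^sub>R (E_central r :: 'n sqmat))"
    unfolding span_E[symmetric] E_central_def by (simp add: span_singleton)
  then show ?thesis
    unfolding Z_grp_eq[OF r] mexp_central[OF r] set_eq_iff pattern_group_iff[OF strict] image_iff
    by (simp only: diff_eq_eq add.commute simp_thms)
qed

lemma M_grp_eq_mexp:
  assumes r: "1 \<le> r" "2 * r \<le> CARD('n)"
  shows "M_grp r = {mexp (heis_mat r c) ** mexp (t *\<^sub>R (E_central r :: ('n::{finite,linorder}) sqmat)) | c t. True}"
proof -
  \<comment> \<open>The quadratic term of the exponential already has a central entry, which is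
    subtracted from \<open>t\<close>.\<close>
  have "mat 1 + heis_mat r c + t *\<^sub>R E_central r = mexp (heis_mat r c) ** mexp ((t - heis_form CARD('n) r c c / 2) *\<^sub>R (E_central r :: 'n sqmat))" for c t
    by (simp add: mexp_heis_mat_central[OF r])
  then have "{mat 1 + heis_mat r c + t *\<^sub>R E_central r | c t. True} \<subseteq> {mexp (heis_mat r c) ** mexp (t *\<^sub>R (E_central r :: 'n sqmat)) | c t. True}"
    by blast
  moreover have "{mexp (heis_mat r c) ** mexp (t *\<^sub>R E_central r) | c t. True} \<subseteq> {mat 1 + heis_mat r c + t *\<^sub>R (E_central r :: 'n sqmat) | c t. True}"
    unfolding mexp_heis_mat_central[OF r] by blast
  ultimately show ?thesis unfolding M_grp_eq_affine[OF r] by (rule subset_antisym)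
qed

definition heis_coset :: "nat \<Rightarrow> (nat \<times> nat \<Rightarrow> real) \<Rightarrow> ('n::{finite,linorder}) sqmat set" where
  "heis_coset r c = (\<lambda>z. mexp (heis_mat r c) ** z) ` Z_grp r"

lemma heis_coset_eq:
  assumes r: "1 \<le> r" "2 * r \<le> CARD('n)"
  shows "heis_coset r c = range (\<lambda>t. mexp (heis_mat r c) ** mexp (t *\<^sub>R (E_central r :: ('n::{finite,linorder}) sqmat)))"
  by (auto simp: heis_coset_def Z_grp_eq_mexp[OF r])

text \<open>Multiplication by \<open>Z_grp r\<close> changes the central entry and nothing else, so
  the cosets are the fibres of the coordinate map on \<open>M_grp r\<close>.\<close>

lemma heis_coset_eq_coord:
  assumes r: "1 \<le> r" "2 * r \<le> CARD('n)"
  shows "heis_coset r c = {x \<in> M_grp r. heis_coord r (x :: ('n::{finite,linorder}) sqmat) = restrict c (noncentral CARD('n) r)}"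
proof -
  have "x \<in> heis_coset r c \<longleftrightarrow> x \<in> M_grp r \<and> heis_coord r x = restrict c (noncentral CARD('n) r)" for x :: "'n sqmat"
  proof
    assume "x \<in> heis_coset r c"
    then obtain t where "x = mexp (heis_mat r c) ** mexp (t *\<^sub>R E_central r)" by (auto simp: heis_coset_eq[OF r])
    then show "x \<in> M_grp r \<and> heis_coord r x = restrict c (noncentral CARD('n) r)"
      using heis_coord_affine[OF r, of c] by (auto simp: M_grp_eq_mexp[OF r] mexp_heis_mat_central[OF r])
  next
    assume x: "x \<in> M_grp r \<and> heis_coord r x = restrict c (noncentral CARD('n) r)"
    then obtain d t where d: "x = mexp (heis_mat r d) ** mexp (t *\<^sub>R E_central r)" by (auto simp: M_grp_eq_mexp[OF r])
    then have "restrict d (noncentral CARD('n) r) = restrict c (noncentral CARD('n) r)"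
      using x heis_coord_affine[OF r, of d] by (simp add: mexp_heis_mat_central[OF r])
    then have "heis_mat r d = (heis_mat r c :: 'n sqmat)" by (intro heis_mat_cong) (metis restrict_apply)
    then show "x \<in> heis_coset r c" using d by (auto simp: heis_coset_eq[OF r])
  qed
  then show ?thesis by auto
qed

lemma left_cosets_eq:
  assumes r: "1 \<le> r" "2 * r \<le> CARD('n)"
  shows "left_cosets (M_grp r) (Z_grp r) = range (heis_coset r :: _ \<Rightarrow> ('n::{finite,linorder}) sqmat set)"
proof -
  have add: "mexp (s *\<^sub>R E_central r) ** mexp (t *\<^sub>R E_central r) = (mexp ((s + t) *\<^sub>R E_central r) :: 'n sqmat)" for s t
    unfolding mexp_central[OF r]
    by (simp add: matrix_add_ldistrib matrix_add_rdistrib central_central[OF r] scaleR_matrix_mult algebra_simps)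
  have "(\<lambda>z. mexp (heis_mat r c) ** mexp (t *\<^sub>R E_central r) ** z) ` Z_grp r = (heis_coset r c :: 'n sqmat set)" for c t
  proof -
    have "(\<lambda>z. mexp (heis_mat r c) ** mexp (t *\<^sub>R E_central r) ** z) ` Z_grp r =
        (\<lambda>s. mexp (heis_mat r c) ** (mexp ((t + s) *\<^sub>R E_central r) :: 'n sqmat)) ` UNIV"
      unfolding Z_grp_eq_mexp[OF r] image_image matrix_mul_assoc[symmetric] add ..
    also have "\<dots> = (\<lambda>s. mexp (heis_mat r c) ** (mexp (s *\<^sub>R E_central r) :: 'n sqmat)) ` ((\<lambda>s. t + s) ` UNIV)"
      unfolding image_image ..
    finally show ?thesis by (simp add: heis_coset_eq[OF r])
  qed
  then have *: "(\<lambda>z. (mexp (heis_mat r c) ** mexp (t *\<^sub>R E_central r)) ** z) ` Z_grp r = (heis_coset r c :: 'n sqmat set)" for c t .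
  show ?thesis
  proof
    show "left_cosets (M_grp r) (Z_grp r) \<subseteq> range (heis_coset r :: _ \<Rightarrow> 'n sqmat set)"
      unfolding left_cosets_def M_grp_eq_mexp[OF r] using * by auto
    show "range (heis_coset r :: _ \<Rightarrow> 'n sqmat set) \<subseteq> left_cosets (M_grp r) (Z_grp r)"
      unfolding left_cosets_def M_grp_eq_mexp[OF r] using *[symmetric] by fast
  qed
qed

section \<open>The measures on \<open>M\<^sub>r/Z\<^sub>r\<close>\<close>

lemma heis_coset_cong:
  "(\<And>p. p \<in> noncentral CARD('n) r \<Longrightarrow> c p = d p) \<Longrightarrow> heis_coset r c = (heis_coset r d :: ('n::{finite,linorder}) sqmat set)"
  unfolding heis_coset_def using heis_mat_cong by metis

lemma mexp_heis_mat_in_coset: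
  assumes r: "1 \<le> r" "2 * r \<le> CARD('n)"
  shows "mexp (heis_mat r c) \<in> (heis_coset r c :: ('n::{finite,linorder}) sqmat set)"
  unfolding heis_coset_eq_coord[OF r] mexp_heis_mat[OF r]
  using heis_coord_affine[OF r] by (auto simp: M_grp_eq_affine[OF r])

lemma mexp_central_in_M_grp:
  assumes r: "1 \<le> r" "2 * r \<le> CARD('n)"
  shows "mexp (t *\<^sub>R E_central r) \<in> (M_grp r :: ('n::{finite,linorder}) sqmat set)"
proof -
  have "mexp (t *\<^sub>R E_central r) = mat 1 + heis_mat r (\<lambda>_. 0) + t *\<^sub>R (E_central r :: 'n sqmat)"
    unfolding mexp_central[OF r] by (simp add: heis_mat_def split_beta)
  then show ?thesis unfolding M_grp_eq_affine[OF r] by blast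
qed

lemma Union_left_cosets:
  assumes r: "1 \<le> r" "2 * r \<le> CARD('n)"
  shows "\<Union>(left_cosets (M_grp r) (Z_grp r)) = (M_grp r :: ('n::{finite,linorder}) sqmat set)"
proof -
  have "x \<in> heis_coset r c" if "x = mexp (heis_mat r c) ** mexp (t *\<^sub>R E_central r)" for x :: "'n sqmat" and c t
    unfolding heis_coset_eq[OF r] that by simp
  then have "M_grp r \<subseteq> \<Union>(range (heis_coset r :: _ \<Rightarrow> 'n sqmat set))"
    unfolding M_grp_eq_mexp[OF r] by blast
  moreover have "heis_coset r c \<subseteq> (M_grp r :: 'n sqmat set)" for c
    unfolding heis_coset_eq_coord[OF r] by blast
  ultimately show ?thesis unfolding left_cosets_eq[OF r] by blast
qed

lemma coset_in_left_cosets: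
  assumes r: "1 \<le> r" "2 * r \<le> CARD('n)"
    and C: "C \<in> left_cosets (M_grp r) (Z_grp r)" and x: "(x :: ('n::{finite,linorder}) sqmat) \<in> C"
  shows "x \<in> M_grp r" "C = heis_coset r (heis_coord r x)"
proof -
  obtain c where c: "C = heis_coset r c" using C left_cosets_eq[OF r] by blast
  show "x \<in> M_grp r" using x unfolding c heis_coset_eq_coord[OF r] by blast
  have "heis_coord r x = restrict c (noncentral CARD('n) r)" using x unfolding c heis_coset_eq_coord[OF r] by blast
  then show "C = heis_coset r (heis_coord r x)" unfolding c by (auto intro!: heis_coset_cong)
qed

section \<open>The quotient Borel structure\<close>

lemma space_coset_borel: "space (coset_borel Q) = Q"
  unfolding coset_borel_def by (rule space_measure_of) auto

lemma sets_coset_borel: "sets (coset_borel Q) = sigma_sets Q {A. A \<subseteq> Q \<and> \<Union>A \<in> sets borel}"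
  unfolding coset_borel_def by (rule sets_measure_of) auto

lemma M_grp_borel:
  assumes "1 \<le> r" "2 * r \<le> CARD('n)"
  shows "(M_grp r :: ('n::{finite,linorder}) sqmat set) \<in> sets borel"
  unfolding M_grp_eq[OF assms] using closed_pattern_group by (rule borel_closed)

text \<open>A set of cosets with Borel union is measurable, and the union of the preimage of
  \<open>A\<close> under \<open>f\<close> is the preimage of \<open>A\<close> under the lift
  \<Phi>.\<close>

lemma measurable_from_coset_borel:
  assumes r: "1 \<le> r" "2 * r \<le> CARD('n)"
    and \<Phi>: "\<Phi> \<in> measurable (restrict_space borel (M_grp r)) N"
    and f: "\<And>C (x :: ('n::{finite,linorder}) sqmat). C \<in> left_cosets (M_grp r) (Z_grp r) \<Longrightarrow> x \<in> C \<Longrightarrow> f C = \<Phi> x"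
  shows "f \<in> measurable (coset_borel (left_cosets (M_grp r) (Z_grp r))) N"
proof (rule measurableI; unfold space_coset_borel)
  let ?Q = "left_cosets (M_grp r) (Z_grp r) :: 'n sqmat set set"
  have nonempty: "\<exists>x. x \<in> C" if "C \<in> ?Q" for C
    using that mexp_heis_mat_in_coset[OF r] left_cosets_eq[OF r] by blast
  show "f C \<in> space N" if C: "C \<in> ?Q" for C
  proof -
    obtain x where x: "x \<in> C" using nonempty[OF C] by blast
    then have "x \<in> space (restrict_space borel (M_grp r))"
      using coset_in_left_cosets(1)[OF r C] by (simp add: space_restrict_space)
    then show ?thesis using f[OF C x] measurable_space[OF \<Phi>] by simp
  qed
  fix A assume A: "A \<in> sets N"
  let ?A = "f -` A \<inter> ?Q"
  have "\<Union>?A = \<Phi> -` A \<inter> M_grp r"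
  proof (intro equalityI subsetI)
    fix x assume "x \<in> \<Union>?A"
    then obtain C where "C \<in> ?Q" "f C \<in> A" "x \<in> C" by auto
    then show "x \<in> \<Phi> -` A \<inter> M_grp r" using f coset_in_left_cosets(1)[OF r] by auto
  next
    fix x assume x: "x \<in> \<Phi> -` A \<inter> M_grp r"
    then obtain C where "C \<in> ?Q" "x \<in> C" using Union_left_cosets[OF r] by blast
    then show "x \<in> \<Union>?A" using f x by auto
  qed
  also have "\<dots> \<in> sets borel"
    using measurable_sets[OF \<Phi> A] M_grp_borel[OF r]
    by (simp add: space_restrict_space sets_restrict_space_iff)
  finally show "?A \<in> sets (coset_borel ?Q)"
    unfolding sets_coset_borel by (intro sigma_sets.Basic) auto
qed

lemma measurable_mexp_heis_mat:
  assumes r: "1 \<le> r" "2 * r \<le> CARD('n)"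
  shows "(\<lambda>c. mexp (heis_mat r c) :: ('n::{finite,linorder}) sqmat) \<in> borel_measurable (lebesgue_prod (noncentral CARD('n) r))"
proof -
  have comp: "(\<lambda>c. c p) \<in> borel_measurable (lebesgue_prod (noncentral CARD('n) r))" if "p \<in> noncentral CARD('n) r" for p
    using measurable_component_singleton[OF that, of "\<lambda>_. lborel"] by simp
  have "(\<lambda>c. heis_form CARD('n) r c c / 2) \<in> borel_measurable (lebesgue_prod (noncentral CARD('n) r))"
    unfolding heis_form_def
    by (intro borel_measurable_divide borel_measurable_sum borel_measurable_times comp) (auto simp: noncentral_def)
  moreover have "(\<lambda>c. heis_mat r c :: 'n sqmat) \<in> borel_measurable (lebesgue_prod (noncentral CARD('n) r))"
    unfolding heis_mat_def split_beta by (intro borel_measurable_sum borel_measurable_scaleR comp) auto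
  ultimately show ?thesis
    unfolding mexp_heis_mat[OF r] by (intro borel_measurable_add borel_measurable_scaleR) auto
qed

text \<open>The exponential picks a point of each coset, so a set of cosets and its union have the
  same preimage in coordinates.\<close>

lemma measurable_heis_coset:
  assumes r: "1 \<le> r" "2 * r \<le> CARD('n)"
  shows "(heis_coset r :: _ \<Rightarrow> ('n::{finite,linorder}) sqmat set) \<in>
    measurable (lebesgue_prod (noncentral CARD('n) r)) (coset_borel (left_cosets (M_grp r) (Z_grp r)))"
  unfolding coset_borel_def
proof (rule measurable_measure_of)
  let ?Q = "left_cosets (M_grp r) (Z_grp r) :: 'n sqmat set set"
  let ?M = "lebesgue_prod (noncentral CARD('n) r)"
  show "heis_coset r \<in> space ?M \<rightarrow> ?Q" by (auto simp: left_cosets_eq[OF r])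
  fix A assume "A \<in> {A. A \<subseteq> ?Q \<and> \<Union>A \<in> sets borel}"
  then have A: "A \<subseteq> ?Q" "\<Union>A \<in> sets borel" by auto
  have "heis_coset r -` A \<inter> space ?M = (\<lambda>c. mexp (heis_mat r c)) -` \<Union>A \<inter> space ?M"
  proof (intro equalityI subsetI)
    fix c assume "c \<in> heis_coset r -` A \<inter> space ?M"
    then show "c \<in> (\<lambda>c. mexp (heis_mat r c)) -` \<Union>A \<inter> space ?M"
      using mexp_heis_mat_in_coset[OF r] by blast
  next
    fix c assume c: "c \<in> (\<lambda>c. mexp (heis_mat r c)) -` \<Union>A \<inter> space ?M"
    then obtain C where C: "C \<in> A" "mexp (heis_mat r c) \<in> C" by blast
    then have "C = heis_coset r (heis_coord r (mexp (heis_mat r c) :: 'n sqmat))"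
      using coset_in_left_cosets(2)[OF r] A(1) by blast
    also have "heis_coord r (mexp (heis_mat r c) :: 'n sqmat) = restrict c (noncentral CARD('n) r)"
      unfolding mexp_heis_mat[OF r] by (rule heis_coord_affine[OF r])
    also have "heis_coset r (restrict c (noncentral CARD('n) r)) = (heis_coset r c :: 'n sqmat set)" by (rule heis_coset_cong) simp
    finally show "c \<in> heis_coset r -` A \<inter> space ?M" using C c by auto
  qed
  also have "\<dots> \<in> sets ?M" using measurable_mexp_heis_mat[OF r] A(2) by (rule measurable_sets)
  finally show "heis_coset r -` A \<inter> space ?M \<in> sets ?M" .
qed auto

lemma MZ_measure_eq:
  "MZ_measure r = distr (lebesgue_prod (noncentral CARD('n) r))
    (coset_borel (left_cosets (M_grp r) (Z_grp r))) (heis_coset r :: _ \<Rightarrow> ('n::{finite,linorder}) sqmat set)"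
  unfolding MZ_measure_def heis_coset_def heis_mat_def by simp

lemma sets_MZ_measure: "sets (MZ_measure r :: ('n::{finite,linorder}) sqmat set measure) = sets (coset_borel (left_cosets (M_grp r) (Z_grp r)))"
  by (simp add: MZ_measure_eq)

lemma space_MZ_measure: "space (MZ_measure r :: ('n::{finite,linorder}) sqmat set measure) = left_cosets (M_grp r) (Z_grp r)"
  by (simp add: MZ_measure_eq space_coset_borel)

text \<open>The inverse of \<open>heis_coset\<close>; all elements of a coset have the same
  coordinates.\<close>

definition coset_coord :: "nat \<Rightarrow> ('n::{finite,linorder}) sqmat set \<Rightarrow> nat \<times> nat \<Rightarrow> real" where
  "coset_coord r C = heis_coord r (SOME x. x \<in> C)"

lemma coset_coord:
  assumes r: "1 \<le> r" "2 * r \<le> CARD('n)" and C: "C \<in> left_cosets (M_grp r) (Z_grp r)"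
    and x: "(x :: ('n::{finite,linorder}) sqmat) \<in> C"
  shows "coset_coord r C = heis_coord r x"
proof -
  obtain c where c: "C = heis_coset r c" using C left_cosets_eq[OF r] by blast
  have *: "heis_coord r y = restrict c (noncentral CARD('n) r)" if "y \<in> C" for y
    using that unfolding c heis_coset_eq_coord[OF r] by blast
  have "(SOME x. x \<in> C) \<in> C" using x by (rule someI)
  then show ?thesis unfolding coset_coord_def using * x by metis
qed

lemma measurable_coset_coord:
  assumes r: "1 \<le> r" "2 * r \<le> CARD('n)"
  shows "(coset_coord r :: ('n::{finite,linorder}) sqmat set \<Rightarrow> _) \<in> measurable (MZ_measure r) (lebesgue_prod (noncentral CARD('n) r))"
proof -
  have "(\<lambda>x::'n sqmat. \<lambda>p\<in>noncentral CARD('n) r. E (fst p) (snd p) \<bullet> x) \<in> measurable (restrict_space borel (M_grp r)) (lebesgue_prod (noncentral CARD('n) r))"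
    by (intro measurable_restrict) (simp, intro measurable_restrict_space1 borel_measurable_continuous_onI continuous_intros)
  then have "heis_coord r \<in> measurable (restrict_space borel (M_grp r :: 'n sqmat set)) (lebesgue_prod (noncentral CARD('n) r))"
    unfolding heis_coord_def[abs_def] .
  then have "coset_coord r \<in> measurable (coset_borel (left_cosets (M_grp r) (Z_grp r :: 'n sqmat set))) (lebesgue_prod (noncentral CARD('n) r))"
    by (rule measurable_from_coset_borel[OF r]) (rule coset_coord[OF r])
  then show ?thesis by (simp add: measurable_cong_sets[OF sets_MZ_measure refl])
qed

lemma coset_coord_heis_coset:
  assumes r: "1 \<le> r" "2 * r \<le> CARD('n)"
  shows "coset_coord r (heis_coset r c :: ('n::{finite,linorder}) sqmat set) = restrict c (noncentral CARD('n) r)"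
proof -
  have "coset_coord r (heis_coset r c :: 'n sqmat set) = heis_coord r (mexp (heis_mat r c) :: 'n sqmat)"
    using mexp_heis_mat_in_coset[OF r] by (intro coset_coord[OF r]) (auto simp: left_cosets_eq[OF r])
  then show ?thesis unfolding mexp_heis_mat[OF r] heis_coord_affine[OF r] .
qed

text \<open>The image under \<open>coset_coord\<close> is Lebesgue measure, and sigma-finiteness
  passes from an image measure back to its source.\<close>

lemma sigma_finite_MZ_measure:
  assumes r: "1 \<le> r" "2 * r \<le> CARD('n)"
  shows "sigma_finite_measure (MZ_measure r :: ('n::{finite,linorder}) sqmat set measure)"
proof (rule sigma_finite_measure_distr[OF _ measurable_coset_coord[OF r]])
  let ?M = "lebesgue_prod (noncentral CARD('n) r)"
  have "distr (MZ_measure r) ?M coset_coord' = distr ?M ?M (coset_coord' \<circ> heis_coset r)"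
    if "coset_coord' = (coset_coord r :: 'n sqmat set \<Rightarrow> _)" for coset_coord'
    using measurable_coset_coord[OF r] unfolding that MZ_measure_eq
    by (subst distr_distr) (simp_all add: measurable_heis_coset[OF r])
  then have "distr (MZ_measure r) ?M (coset_coord r :: 'n sqmat set \<Rightarrow> _) = distr ?M ?M (\<lambda>c. restrict c (noncentral CARD('n) r))"
    by (simp add: comp_def coset_coord_heis_coset[OF r])
  also have "\<dots> = distr ?M ?M (\<lambda>c. c)"
    by (rule distr_cong) (auto simp: space_PiM PiE_restrict)
  finally have "distr (MZ_measure r) ?M (coset_coord r :: 'n sqmat set \<Rightarrow> _) = ?M" by (simp add: distr_id)
  then show "sigma_finite_measure (distr (MZ_measure r) ?M (coset_coord r :: 'n sqmat set \<Rightarrow> _))"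
    using sigma_finite_lebesgue_prod[OF finite_noncentral] by simp
qed

text \<open>Coordinates followed by the exponential. Relations stated for all sections bear on the
  representation itself only once a section exists.\<close>

lemma borel_section_exists:
  assumes r: "1 \<le> r" "2 * r \<le> CARD('n)"
  shows "\<exists>s :: ('n::{finite,linorder}) sqmat set \<Rightarrow> 'n sqmat. borel_section r s"
proof (intro exI)
  let ?s = "\<lambda>C :: 'n sqmat set. mexp (heis_mat r (coset_coord r C)) :: 'n sqmat"
  show "borel_section r ?s"
    unfolding borel_section_def
  proof (intro conjI ballI)
    show "?s \<in> borel_measurable (MZ_measure r)"
      by (rule measurable_compose[OF measurable_coset_coord[OF r] measurable_mexp_heis_mat[OF r]])
    fix C :: "'n sqmat set" assume "C \<in> left_cosets (M_grp r) (Z_grp r)"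
    then obtain c where C: "C = heis_coset r c" using left_cosets_eq[OF r] by blast
    have "heis_mat r (restrict c (noncentral CARD('n) r)) = (heis_mat r c :: 'n sqmat)" by (rule heis_mat_cong) simp
    then show "?s C \<in> C"
      unfolding C coset_coord_heis_coset[OF r] using mexp_heis_mat_in_coset[OF r] by simp
  qed
qed

lemma nn_integral_MZ_measure:
  assumes r: "1 \<le> r" "2 * r \<le> CARD('n)" and f: "f \<in> borel_measurable (MZ_measure r)"
  shows "(\<integral>\<^sup>+C. f C \<partial>MZ_measure r) =
    (\<integral>\<^sup>+c. f (heis_coset r c :: ('n::{finite,linorder}) sqmat set) \<partial>lebesgue_prod (noncentral CARD('n) r))"
  unfolding MZ_measure_eq using f
  by (intro nn_integral_distr measurable_heis_coset[OF r]) (simp add: measurable_cong_sets[OF sets_MZ_measure refl])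

section \<open>Representations of the Heisenberg groups\<close>

lemma unitary_rep_isometry: "unitary_rep G H \<pi> \<Longrightarrow> x \<in> G \<Longrightarrow> isometry_on H (\<pi> x)"
  unfolding unitary_rep_def isometry_on_def by blast

lemma unitary_rep_mult: "unitary_rep G H \<pi> \<Longrightarrow> x \<in> G \<Longrightarrow> y \<in> G \<Longrightarrow> u \<in> H \<Longrightarrow> \<pi> (x ** y) u = \<pi> x (\<pi> y u)"
  unfolding unitary_rep_def by blast

lemma unitary_rep_csubspace: "unitary_rep G H \<pi> \<Longrightarrow> csubspace H"
  by (simp add: unitary_rep_def closed_csubspace_def)

lemma unitary_rep_continuous: "unitary_rep G H \<pi> \<Longrightarrow> u \<in> H \<Longrightarrow> continuous_on G (\<lambda>x. \<pi> x u)"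
  unfolding unitary_rep_def by blast

text \<open>\<open>unitary_rep\<close> postulates no unit law. It follows because
  \<open>\<pi> (mat 1)\<close> is an idempotent isometry, hence idempotent and injective.\<close>

lemma unitary_rep_one:
  assumes "unitary_rep G H \<pi>" "mat 1 \<in> G" "u \<in> H"
  shows "\<pi> (mat 1) u = u"
proof -
  note iso = unitary_rep_isometry[OF assms(1,2)]
  have in_H: "\<pi> (mat 1) u \<in> H" using isometry_on_in[OF iso assms(3)] .
  have "\<pi> (mat 1) (\<pi> (mat 1) u - u) = \<pi> (mat 1 ** mat 1) u - \<pi> (mat 1) u"
    using isometry_on_diff[OF iso unitary_rep_csubspace[OF assms(1)] in_H assms(3)]
      unitary_rep_mult[OF assms(1,2,2,3)] by (simp only:)
  then have "norm (\<pi> (mat 1) u - u) = 0"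
    using isometry_on_norm[OF iso csubspace_diff[OF unitary_rep_csubspace[OF assms(1)] in_H assms(3)]] by simp
  then show ?thesis by simp
qed

lemma unitary_rep_coeff_continuous:
  assumes "unitary_rep G H \<pi>" "v \<in> H"
  shows "continuous_on G (\<lambda>x. cinner u (\<pi> x v))"
  using unitary_rep_continuous[OF assms] tendsto_cinner[OF tendsto_const]
  unfolding continuous_on_def by blast

lemma unitary_rep_coeff_measurable:
  assumes "unitary_rep G H \<pi>" "v \<in> H"
  shows "(\<lambda>x. cinner u (\<pi> x v)) \<in> borel_measurable (restrict_space borel G)"
  using unitary_rep_coeff_continuous[OF assms] by (rule borel_measurable_continuous_on_restrict)

text \<open>The bracket pairs \<open>E\<^bsub>r,s\<^esub>\<close> with \<open>E\<^bsub>s,\<ell>-r+1\<^esub>\<close>.\<close>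

lemma heisenberg_weyl_system:
  assumes r: "1 \<le> r" "2 * r \<le> CARD('n)" and l: "l \<noteq> 0"
    and rep: "heisenberg_rep r l H (\<pi> :: ('n::{finite,linorder}) sqmat \<Rightarrow> 'h::complex_hilbert_space \<Rightarrow> 'h)"
  shows "weyl_system (noncentral CARD('n) r)
    (\<lambda>(i, j). if i = r then (j, CARD('n) - r + 1) else (r, i)) (\<lambda>(i, j). if i = r then 1 else -1) l H
    (\<lambda>c. \<pi> (mexp (heis_mat r c)))"
proof -
  let ?J = "noncentral CARD('n) r" and ?k = "CARD('n) - r + 1"
  let ?e = "\<lambda>c. mexp (heis_mat r c) :: 'n sqmat" and ?z = "\<lambda>t. mexp (t *\<^sub>R E_central r) :: 'n sqmat"
  have irr: "irreducible_unitary_rep (M_grp r) H \<pi>"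
    and central: "\<And>t u. u \<in> H \<Longrightarrow> \<pi> (?z t) u = cis (2 * pi * (l * t)) *\<^sub>C u"
    using rep by (auto simp: heisenberg_rep_def)
  then have U: "unitary_rep (M_grp r) H \<pi>" by (simp add: irreducible_unitary_rep_def)
  have sub: "csubspace H" using U by (rule unitary_rep_csubspace)
  have e_in: "?e c \<in> M_grp r" for c unfolding mexp_heis_mat[OF r] M_grp_eq_affine[OF r] by blast
  have z_in: "?z t \<in> M_grp r" for t
    by (rule mexp_central_in_M_grp[OF r])
  have e0: "?e (\<lambda>_. 0) = mat 1"
    unfolding mexp_heis_mat[OF r] by (simp add: heis_mat_def heis_form_def split_beta)
  have one: "mat 1 \<in> (M_grp r :: 'n sqmat set)" using e_in[of "\<lambda>_. 0"] by (simp add: e0)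
  show ?thesis
  proof
    show "finite ?J" by (rule finite_noncentral)
    show "l \<noteq> 0" by fact
    show "closed_csubspace H" using U by (simp add: unitary_rep_def)
    show "H \<noteq> {0}" using irr by (simp add: irreducible_unitary_rep_def)
    show "isometry_on H (\<pi> (?e x))" for x using unitary_rep_isometry[OF U e_in] .
    show "\<pi> (?e x) = \<pi> (?e y)" if "\<And>j. j \<in> ?J \<Longrightarrow> x j = y j" for x y
      using heis_mat_cong[of r x y, where 'n = 'n] that by simp
    show "\<pi> (?e (\<lambda>_. 0)) u = u" if "u \<in> H" for u
      unfolding e0 using unitary_rep_one[OF U one that] .
    show "(\<lambda>x. cinner u (\<pi> (?e x) v)) \<in> borel_measurable (lebesgue_prod ?J)" if "u \<in> H" "v \<in> H" for u v
      by (rule measurable_compose[OF measurable_restrict_space2[OF _ measurable_mexp_heis_mat[OF r]] unitary_rep_coeff_measurable[OF U that(2)]])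
        (use e_in in auto)
  next
    fix u v :: 'h and x :: "nat \<times> nat \<Rightarrow> real" assume uv: "u \<in> H" "v \<in> H"
    have form: "heis_form CARD('n) r (\<lambda>p. s * x p) (\<lambda>p. s * x p) = s\<^sup>2 * heis_form CARD('n) r x x" for s
      by (simp add: heis_form_def sum_distrib_left power2_eq_square mult_ac)
    \<comment> \<open>Along a ray the exponential is a quadratic polynomial in \<open>s\<close>, so
      strong continuity of \<pi> gives the limit.\<close>
    have e: "?e (\<lambda>p. s * x p) = mat 1 + s *\<^sub>R heis_mat r x + (s\<^sup>2 * heis_form CARD('n) r x x / 2) *\<^sub>R E_central r" for s
      unfolding mexp_heis_mat[OF r] unfolding form heis_mat_scale ..
    have "continuous_on UNIV (\<lambda>s. ?e (\<lambda>p. s * x p))" unfolding e by (intro continuous_intros) simp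
    then have "continuous_on UNIV (\<lambda>s. cinner u (\<pi> (?e (\<lambda>p. s * x p)) v))"
      by (rule continuous_on_compose2[OF unitary_rep_coeff_continuous[OF U uv(2)]]) (use e_in in blast)
    then have "((\<lambda>s. cinner u (\<pi> (?e (\<lambda>p. s * x p)) v)) \<longlongrightarrow> cinner u (\<pi> (?e (\<lambda>p. 0 * x p)) v)) (at 0)"
      unfolding continuous_on_def by (rule bspec) simp
    then show "((\<lambda>s. cinner u (\<pi> (?e (\<lambda>p. s * x p)) v)) \<longlongrightarrow> cinner u v) (at 0)"
      using unitary_rep_one[OF U one uv(2)] by (simp add: e0)
  next
    fix V assume V: "closed_csubspace V" "V \<subseteq> H" "\<And>x u. u \<in> V \<Longrightarrow> \<pi> (?e x) u \<in> V"
    \<comment> \<open>The Weyl operators leave out the central direction, but the centre acts by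
      scalars, which preserve every complex subspace.\<close>
    have "\<pi> x ` V \<subseteq> V" if "x \<in> M_grp r" for x
    proof -
      obtain c t where x: "x = ?e c ** ?z t" using \<open>x \<in> M_grp r\<close> unfolding M_grp_eq_mexp[OF r] by blast
      have "\<pi> x u \<in> V" if u: "u \<in> V" for u
      proof -
        have "\<pi> x u = \<pi> (?e c) (cis (2 * pi * (l * t)) *\<^sub>C u)"
          unfolding x using u V(2) by (simp add: unitary_rep_mult[OF U e_in z_in] central subsetD)
        moreover have "cis (2 * pi * (l * t)) *\<^sub>C u \<in> V"
          using V(1) u by (simp add: closed_csubspace_def csubspace_scaleC)
        ultimately show ?thesis using V(3) by simp
      qed
      then show ?thesis by auto
    qed
    then show "V = {0} \<or> V = H" using irr V(1,2) by (simp add: irreducible_unitary_rep_def)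
  next
    fix u :: 'h and x y :: "nat \<times> nat \<Rightarrow> real" assume u: "u \<in> H"
    \<comment> \<open>The bracket term of the multiplication rule. Its factor 1/2 turns the 2 pi of
      the central character into the pi of \<open>W_mult\<close>.\<close>
    let ?t = "(heis_form CARD('n) r x y - heis_form CARD('n) r y x) / 2"
    let ?S = "\<Sum>j\<in>?J. (case j of (i, j) \<Rightarrow> if i = r then 1 else - 1) * x j * y (case j of (i, j) \<Rightarrow> if i = r then (j, ?k) else (r, i))"
    have S: "?S = 2 * ?t"
    proof -
      have "(\<Sum>s=r+1..CARD('n)-r. (case (s, ?k) of (i, j) \<Rightarrow> if i = r then 1 else - 1) * x (s, ?k) * y (case (s, ?k) of (i, j) \<Rightarrow> if i = r then (j, ?k) else (r, i)))
        = - heis_form CARD('n) r y x"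
        unfolding heis_form_def sum_negf[symmetric] by (intro sum.cong) auto
      then show ?thesis unfolding sum_noncentral by (simp add: heis_form_def)
    qed
    have "\<pi> (?e x) (\<pi> (?e y) u) = \<pi> (?e (\<lambda>p. x p + y p) ** ?z ?t) u"
      using unitary_rep_mult[OF U e_in e_in u, of x y] mexp_heis_mat_mult[OF r, of x y] by simp
    also have "\<dots> = \<pi> (?e (\<lambda>p. x p + y p)) (cis (2 * pi * (l * ?t)) *\<^sub>C u)"
      by (simp only: unitary_rep_mult[OF U e_in z_in u] central[OF u])
    also have "\<dots> = cis (2 * pi * (l * ?t)) *\<^sub>C \<pi> (?e (\<lambda>p. x p + y p)) u"
      by (rule isometry_on_scaleC[OF unitary_rep_isometry[OF U e_in] u])
    also have "2 * pi * (l * ?t) = pi * l * ?S" unfolding S by simp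
    finally show "\<pi> (?e x) (\<pi> (?e y) u) = cis (pi * l * ?S) *\<^sub>C \<pi> (?e (\<lambda>p. x p + y p)) u" .
  qed (auto simp: noncentral_def split: if_splits)
qed

lemma heisenberg_coset_coeff:
  assumes r: "1 \<le> r" "2 * r \<le> CARD('n)"
    and rep: "heisenberg_rep r l H (\<pi> :: ('n::{finite,linorder}) sqmat \<Rightarrow> 'h::complex_hilbert_space \<Rightarrow> 'h)"
    and v: "v \<in> H" and x: "x \<in> heis_coset r c"
  shows "cmod (cinner u (\<pi> x v)) = cmod (cinner u (\<pi> (mexp (heis_mat r c)) v))"
proof -
  have U: "unitary_rep (M_grp r) H \<pi>" and central: "\<And>t u. u \<in> H \<Longrightarrow> \<pi> (mexp (t *\<^sub>R E_central r)) u = cis (2 * pi * (l * t)) *\<^sub>C u"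
    using rep by (auto simp: heisenberg_rep_def irreducible_unitary_rep_def)
  obtain t where t: "x = mexp (heis_mat r c) ** mexp (t *\<^sub>R E_central r)" using x by (auto simp: heis_coset_eq[OF r])
  have e_in: "mexp (heis_mat r c) \<in> (M_grp r :: 'n sqmat set)" unfolding mexp_heis_mat[OF r] M_grp_eq_affine[OF r] by blast
  have z_in: "mexp (t *\<^sub>R E_central r) \<in> (M_grp r :: 'n sqmat set)"
    by (rule mexp_central_in_M_grp[OF r])
  have "\<pi> x v = cis (2 * pi * (l * t)) *\<^sub>C \<pi> (mexp (heis_mat r c)) v"
    unfolding t unitary_rep_mult[OF U e_in z_in v] central[OF v] isometry_on_scaleC[OF unitary_rep_isometry[OF U e_in] v] ..
  then show ?thesis by (simp add: cinner_scaleC_right norm_mult)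
qed

text \<open>Any choice \<open>s\<close> of representatives is allowed: the modulus is constant on
  cosets and measurable as a function of them. This covers both the \<open>SOME\<close> in
  \<open>formal_degree\<close> and Borel sections.\<close>

lemma heisenberg_coeff_nn_integral:
  assumes r: "1 \<le> r" "2 * r \<le> CARD('n)" and l: "l \<noteq> 0"
    and rep: "heisenberg_rep r l H (\<pi> :: ('n::{finite,linorder}) sqmat \<Rightarrow> 'h::complex_hilbert_space \<Rightarrow> 'h)"
    and uv: "u \<in> H" "v \<in> H" and s: "\<And>C. C \<in> left_cosets (M_grp r) (Z_grp r) \<Longrightarrow> s C \<in> C"
  shows "(\<lambda>C. (cmod (cinner u (\<pi> (s C) v)))\<^sup>2) \<in> borel_measurable (MZ_measure r)" (is "?f \<in> _")
    and "(\<integral>\<^sup>+C. ennreal ((cmod (cinner u (\<pi> (s C) v)))\<^sup>2) \<partial>MZ_measure r) =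
       ennreal (1 / \<bar>l\<bar> ^ (CARD('n) - 2 * r) * (norm u)\<^sup>2 * (norm v)\<^sup>2)"
proof -
  interpret weyl_system "noncentral CARD('n) r" "\<lambda>(i, j). if i = r then (j, CARD('n) - r + 1) else (r, i)"
    "\<lambda>(i, j). if i = r then 1 else -1" l H "\<lambda>c. \<pi> (mexp (heis_mat r c))"
    by (rule heisenberg_weyl_system[OF r l rep])
  have U: "unitary_rep (M_grp r) H \<pi>" using rep by (auto simp: heisenberg_rep_def irreducible_unitary_rep_def)
  have coeff: "cmod (cinner u (\<pi> (s C) v)) = cmod (cinner u (\<pi> x v))" if C: "C \<in> left_cosets (M_grp r) (Z_grp r)" "x \<in> C" for C x
  proof -
    obtain c where "C = heis_coset r c" using C left_cosets_eq[OF r] by blast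
    then show ?thesis using heisenberg_coset_coeff[OF r rep uv(2)] s[OF C(1)] C(2) by metis
  qed
  have "?f \<in> borel_measurable (coset_borel (left_cosets (M_grp r) (Z_grp r)))"
  proof (rule measurable_from_coset_borel[OF r])
    show "(\<lambda>x. (cmod (cinner u (\<pi> x v)))\<^sup>2) \<in> borel_measurable (restrict_space borel (M_grp r))"
      using unitary_rep_coeff_measurable[OF U uv(2)] by measurable
  qed (simp add: coeff)
  then show meas: "?f \<in> borel_measurable (MZ_measure r)"
    by (simp add: measurable_cong_sets[OF sets_MZ_measure refl])
  have "(\<integral>\<^sup>+C. ennreal (?f C) \<partial>MZ_measure r) = (\<integral>\<^sup>+c. ennreal (?f (heis_coset r c)) \<partial>lebesgue_prod (noncentral CARD('n) r))"
    by (intro nn_integral_MZ_measure[OF r] measurable_compose[OF meas measurable_ennreal])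
  also have "\<dots> = (\<integral>\<^sup>+c. ennreal ((cmod (cinner u (\<pi> (mexp (heis_mat r c)) v)))\<^sup>2) \<partial>lebesgue_prod (noncentral CARD('n) r))"
  proof (rule nn_integral_cong)
    fix c
    have "heis_coset r c \<in> left_cosets (M_grp r) (Z_grp r :: 'n sqmat set)" by (simp add: left_cosets_eq[OF r])
    then show "ennreal (?f (heis_coset r c)) = ennreal ((cmod (cinner u (\<pi> (mexp (heis_mat r c)) v)))\<^sup>2)"
      using coeff mexp_heis_mat_in_coset[OF r] by metis
  qed
  also have "\<dots> = ennreal (1 / \<bar>l\<bar> ^ (CARD('n) - 2 * r) * (norm u)\<^sup>2 * (norm v)\<^sup>2)"
    using weyl_schur_relation uv unfolding schur_relation_def card_noncentral by simp
  finally show "(\<integral>\<^sup>+C. ennreal (?f C) \<partial>MZ_measure r) = ennreal (1 / \<bar>l\<bar> ^ (CARD('n) - 2 * r) * (norm u)\<^sup>2 * (norm v)\<^sup>2)" .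
qed

lemma measurable_section:
  assumes r: "1 \<le> r" "2 * r \<le> CARD('n)" and s: "borel_section r (s :: ('n::{finite,linorder}) sqmat set \<Rightarrow> 'n sqmat)"
  shows "s \<in> measurable (MZ_measure r) (restrict_space borel (M_grp r))"
proof (rule measurable_restrict_space2)
  show "s \<in> space (MZ_measure r) \<rightarrow> M_grp r"
    using s coset_in_left_cosets(1)[OF r] unfolding borel_section_def space_MZ_measure by blast
  show "s \<in> borel_measurable (MZ_measure r)" using s by (simp add: borel_section_def)
qed

text \<open>The coefficient itself, unlike its modulus, depends on the representative through a
  phase; its measurability comes from the section being Borel.\<close>

lemma heisenberg_schur_relation:
  assumes r: "1 \<le> r" "2 * r \<le> CARD('n)" and l: "l \<noteq> 0"
    and rep: "heisenberg_rep r l H (\<pi> :: ('n::{finite,linorder}) sqmat \<Rightarrow> 'h::complex_hilbert_space \<Rightarrow> 'h)"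
    and s: "borel_section r s"
  shows "schur_relation (MZ_measure r) (\<lambda>C. \<pi> (s C)) H (1 / \<bar>l\<bar> ^ (CARD('n) - 2 * r))"
  unfolding schur_relation_def
proof (intro ballI conjI)
  fix u v assume uv: "u \<in> H" "v \<in> H"
  have U: "unitary_rep (M_grp r) H \<pi>" using rep by (auto simp: heisenberg_rep_def irreducible_unitary_rep_def)
  show "(\<lambda>C. cinner u (\<pi> (s C) v)) \<in> borel_measurable (MZ_measure r)"
    by (rule measurable_compose[OF measurable_section[OF r s] unitary_rep_coeff_measurable[OF U uv(2)]])
  show "(\<integral>\<^sup>+C. ennreal ((cmod (cinner u (\<pi> (s C) v)))\<^sup>2) \<partial>MZ_measure r) =
       ennreal (1 / \<bar>l\<bar> ^ (CARD('n) - 2 * r) * (norm u)\<^sup>2 * (norm v)\<^sup>2)"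
    using s by (intro heisenberg_coeff_nn_integral(2)[OF r l rep uv]) (auto simp: borel_section_def)
qed

text \<open>Uniqueness in the definite description comes from a nonzero vector paired with
  itself.\<close>

lemma formal_degree_heisenberg:
  assumes r: "1 \<le> r" "2 * r \<le> CARD('n)" and l: "l \<noteq> 0"
    and rep: "heisenberg_rep r l H (\<pi> :: ('n::{finite,linorder}) sqmat \<Rightarrow> 'h::complex_hilbert_space \<Rightarrow> 'h)"
  shows "formal_degree r H \<pi> = \<bar>l\<bar> ^ (CARD('n) - 2 * r)"
proof -
  let ?d = "\<bar>l\<bar> ^ (CARD('n) - 2 * r)"
  let ?f = "\<lambda>u v C. (cmod (matrix_coeff \<pi> u v (SOME x. x \<in> C)))\<^sup>2"
  have s: "(SOME x. x \<in> C) \<in> C" if C: "C \<in> left_cosets (M_grp r) (Z_grp r :: 'n sqmat set)" for C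
  proof -
    obtain c where "C = heis_coset r c" using C left_cosets_eq[OF r] by blast
    then show ?thesis using mexp_heis_mat_in_coset[OF r] by (metis someI)
  qed
  have int: "integrable (MZ_measure r) (?f u v) \<and> (LINT C|MZ_measure r. ?f u v C) = (norm u)\<^sup>2 * (norm v)\<^sup>2 / ?d"
    if uv: "u \<in> H" "v \<in> H" for u v
  proof -
    note * = heisenberg_coeff_nn_integral[OF r l rep uv s, folded matrix_coeff_def]
    have i: "integrable (MZ_measure r) (?f u v)"
      using *(1) by (intro integrableI_nonneg) (auto simp: *(2))
    then show ?thesis using nn_integral_eq_integral[OF i] *(2) by (simp add: ennreal_inj)
  qed
  show ?thesis unfolding formal_degree_def
  proof (rule the_equality)
    show "?d > 0 \<and> (\<forall>u\<in>H. \<forall>v\<in>H. integrable (MZ_measure r) (?f u v) \<and> (LINT C|MZ_measure r. ?f u v C) = (norm u)\<^sup>2 * (norm v)\<^sup>2 / ?d)"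
      using int l by simp
    fix d assume d: "d > 0 \<and> (\<forall>u\<in>H. \<forall>v\<in>H. integrable (MZ_measure r) (?f u v) \<and> (LINT C|MZ_measure r. ?f u v C) = (norm u)\<^sup>2 * (norm v)\<^sup>2 / d)"
    have "H \<noteq> {0}" and U: "unitary_rep (M_grp r) H \<pi>"
      using rep by (simp_all add: heisenberg_rep_def irreducible_unitary_rep_def)
    then obtain u where u: "u \<in> H" "u \<noteq> 0"
      using csubspace_0[OF unitary_rep_csubspace[OF U]] by blast
    have "(norm u)\<^sup>2 * (norm u)\<^sup>2 / d = (norm u)\<^sup>2 * (norm u)\<^sup>2 / ?d"
      using int[OF u(1) u(1)] d u(1) by metis
    then show "d = ?d" using u(2) d l by (simp add: field_simps)
  qed
qed

section \<open>The stepwise construction\<close>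

lemma (in product_sigma_finite) distr_insert:
  assumes I: "finite I" "i \<notin> I"
  shows "distr (Pi\<^sub>M I M \<Otimes>\<^sub>M M i) (Pi\<^sub>M (insert i I) M) (\<lambda>(x, y). x(i := y)) = Pi\<^sub>M (insert i I) M"
proof (rule measure_eqI)
  interpret I: sigma_finite_measure "Pi\<^sub>M I M" by (rule sigma_finite[OF I(1)])
  interpret P: pair_sigma_finite "Pi\<^sub>M I M" "M i" by standard
  have m[measurable]: "(\<lambda>(x, y). x(i := y)) \<in> measurable (Pi\<^sub>M I M \<Otimes>\<^sub>M M i) (Pi\<^sub>M (insert i I) M)"
    by (rule measurable_add_dim)
  fix A assume "A \<in> sets (distr (Pi\<^sub>M I M \<Otimes>\<^sub>M M i) (Pi\<^sub>M (insert i I) M) (\<lambda>(x, y). x(i := y)))"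
  then have A[measurable]: "A \<in> sets (Pi\<^sub>M (insert i I) M)" by simp
  have "emeasure (distr (Pi\<^sub>M I M \<Otimes>\<^sub>M M i) (Pi\<^sub>M (insert i I) M) (\<lambda>(x, y). x(i := y))) A
      = (\<integral>\<^sup>+ z. indicator A z \<partial>distr (Pi\<^sub>M I M \<Otimes>\<^sub>M M i) (Pi\<^sub>M (insert i I) M) (\<lambda>(x, y). x(i := y)))" by simp
  also have "\<dots> = (\<integral>\<^sup>+ z. indicator A (case z of (x, y) \<Rightarrow> x(i := y)) \<partial>(Pi\<^sub>M I M \<Otimes>\<^sub>M M i))"
    by (rule nn_integral_distr) auto
  also have "\<dots> = (\<integral>\<^sup>+ x. \<integral>\<^sup>+ y. indicator A (x(i := y)) \<partial>M i \<partial>Pi\<^sub>M I M)"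
    by (subst sigma_finite_measure.nn_integral_fst[OF sigma_finite_measures, symmetric]) auto
  also have "\<dots> = (\<integral>\<^sup>+ z. indicator A z \<partial>Pi\<^sub>M (insert i I) M)"
    by (rule product_nn_integral_insert[OF I, symmetric]) simp
  finally show "emeasure (distr (Pi\<^sub>M I M \<Otimes>\<^sub>M M i) (Pi\<^sub>M (insert i I) M) (\<lambda>(x, y). x(i := y))) A = emeasure (Pi\<^sub>M (insert i I) M) A"
    by simp
qed simp

text \<open>The old factors are integrated first because the tensor step evaluates that integral at
  each fixed value of the new factor. Presenting the product as an image of a binary product reduces
  the claim to Fubini's theorem.\<close>

lemma (in product_sigma_finite) product_integral_insert_rev:
  fixes f :: "_ \<Rightarrow> _::{banach, second_countable_topology}"
  assumes I: "finite I" "i \<notin> I" and f: "integrable (Pi\<^sub>M (insert i I) M) f"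
  shows "integral\<^sup>L (Pi\<^sub>M (insert i I) M) f = (\<integral>y. \<integral>x. f (x(i := y)) \<partial>Pi\<^sub>M I M \<partial>M i)"
proof -
  interpret I: sigma_finite_measure "Pi\<^sub>M I M" by (rule sigma_finite[OF I(1)])
  interpret P: pair_sigma_finite "Pi\<^sub>M I M" "M i" by standard
  have m[measurable]: "(\<lambda>(x, y). x(i := y)) \<in> measurable (Pi\<^sub>M I M \<Otimes>\<^sub>M M i) (Pi\<^sub>M (insert i I) M)"
    by (rule measurable_add_dim)
  have f'[measurable]: "f \<in> borel_measurable (Pi\<^sub>M (insert i I) M)" using f by auto
  have "integrable (Pi\<^sub>M I M \<Otimes>\<^sub>M M i) (\<lambda>z. f (case z of (x, y) \<Rightarrow> x(i := y)))"
    using f by (subst integrable_distr_eq[OF m f', symmetric]) (simp add: distr_insert[OF I])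
  then have i: "integrable (Pi\<^sub>M I M \<Otimes>\<^sub>M M i) (case_prod (\<lambda>x y. f (x(i := y))))"
    by (simp add: case_prod_unfold)
  have "integral\<^sup>L (Pi\<^sub>M (insert i I) M) f = integral\<^sup>L (Pi\<^sub>M I M \<Otimes>\<^sub>M M i) (\<lambda>z. f (case z of (x, y) \<Rightarrow> x(i := y)))"
    by (subst integral_distr[OF m f', symmetric]) (simp add: distr_insert[OF I])
  also have "\<dots> = integral\<^sup>L (Pi\<^sub>M I M \<Otimes>\<^sub>M M i) (case_prod (\<lambda>x y. f (x(i := y))))"
    by (simp add: case_prod_unfold)
  also have "\<dots> = (\<integral>y. \<integral>x. f (x(i := y)) \<partial>Pi\<^sub>M I M \<partial>M i)"
    by (rule P.integral_snd[OF i, symmetric])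
  finally show ?thesis .
qed

section \<open>Ordered products of section values\<close>

lemma matrix_group_N_grp:
  assumes "2 * r \<le> CARD('n)"
  shows "matrix_group (N_grp r :: ('n::{finite,linorder}) sqmat set)"
  unfolding N_grp_eq[OF assms] by (intro matrix_group_pattern_group strict_n_pattern assms)

lemma M_grp_subset_N_grp:
  assumes "1 \<le> k" "k \<le> r" "2 * r \<le> CARD('n)"
  shows "M_grp k \<subseteq> (N_grp r :: ('n::{finite,linorder}) sqmat set)"
proof -
  have "m_pattern CARD('n) k \<subseteq> n_pattern CARD('n) r" using assms by (auto simp: n_pattern_def)
  then show ?thesis using assms by (auto simp: M_grp_eq N_grp_eq pattern_group_def)
qed

lemma N_grp_mono:
  assumes "k \<le> r" "2 * r \<le> CARD('n)"
  shows "N_grp k \<subseteq> (N_grp r :: ('n::{finite,linorder}) sqmat set)"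
proof -
  have "n_pattern CARD('n) k \<subseteq> n_pattern CARD('n) r"
    unfolding n_pattern_def using assms by (intro UN_mono) auto
  then show ?thesis using assms by (auto simp: N_grp_eq pattern_group_def)
qed

lemma N_grp_0: "N_grp 0 = {mat 1 :: ('n::{finite,linorder}) sqmat}"
proof -
  have "N_grp 0 = (pattern_group {} :: 'n sqmat set)" by (subst N_grp_eq) (simp_all add: n_pattern_def)
  also have "\<dots> = {mat 1}" by (auto simp: pattern_group_def mat_def vec_eq_iff)
  finally show ?thesis .
qed

lemma N_grp_1: "N_grp 1 = (M_grp 1 :: ('n::{finite,linorder}) sqmat set)"
  by (simp add: N_grp_def M_grp_def n_lie_def m_lie_def span_span)

lemma ordered_prod_cong: "(\<And>k. 1 \<le> k \<Longrightarrow> k \<le> r \<Longrightarrow> x k = y k) \<Longrightarrow> ordered_prod x r = ordered_prod y r"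
  by (induction r) auto

lemma ordered_prod_in_N_grp:
  assumes "2 * r \<le> CARD('n)" "\<And>k. 1 \<le> k \<Longrightarrow> k \<le> r \<Longrightarrow> x k \<in> M_grp k"
  shows "ordered_prod x r \<in> (N_grp r :: ('n::{finite,linorder}) sqmat set)"
  using assms
proof (induction r)
  case (Suc r)
  have "2 * r \<le> CARD('n)" using Suc.prems(1) by simp
  then have "ordered_prod x r \<in> N_grp r" using Suc.IH Suc.prems(2) by simp
  then have "ordered_prod x r \<in> N_grp (Suc r)"
    using N_grp_mono[where 'n = 'n, of r "Suc r"] Suc.prems(1) by auto
  moreover have "x (Suc r) \<in> N_grp (Suc r)" using Suc.prems M_grp_subset_N_grp[where 'n = 'n, of "Suc r" "Suc r"] by auto
  ultimately show ?case using matrix_group_N_grp[OF Suc.prems(1)] by (simp add: matrix_group_def)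
qed (simp add: N_grp_0)

lemma borel_measurable_matrix_mult:
  assumes "f \<in> borel_measurable M" "g \<in> borel_measurable M"
  shows "(\<lambda>x. f x ** g x :: ('n::finite) sqmat) \<in> borel_measurable M"
proof (rule borel_measurable_continuous_Pair[OF assms])
  show "continuous_on UNIV (\<lambda>x. fst x ** snd x :: 'n sqmat)"
    unfolding matrix_matrix_mult_def by (intro continuous_intros)
qed

lemma borel_measurable_ordered_prod:
  assumes "\<And>k. 1 \<le> k \<Longrightarrow> k \<le> r \<Longrightarrow> (\<lambda>x. f x k) \<in> borel_measurable M"
  shows "(\<lambda>x. ordered_prod (f x) r) \<in> borel_measurable M"
  using assms by (induction r) (auto intro!: borel_measurable_matrix_mult)

lemma section_in_M_grp:
  assumes "1 \<le> k" "2 * k \<le> CARD('n)" "borel_section k s" "C \<in> space (MZ_measure k)"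
  shows "s C \<in> (M_grp k :: ('n::{finite,linorder}) sqmat set)"
  using measurable_space[OF measurable_section[OF assms(1-3)] assms(4)] by (simp add: space_restrict_space)

lemma measurable_ordered_prod_sections:
  assumes r: "2 * r \<le> CARD('n)" and s: "\<And>k. 1 \<le> k \<Longrightarrow> k \<le> r \<Longrightarrow> borel_section k (s k)"
  shows "(\<lambda>C. ordered_prod (\<lambda>k. s k (C k)) r) \<in> measurable (\<Pi>\<^sub>M k\<in>{1..r}. MZ_measure k)
    (restrict_space borel (N_grp r :: ('n::{finite,linorder}) sqmat set))"
proof (rule measurable_restrict_space2)
  show "(\<lambda>C. ordered_prod (\<lambda>k. s k (C k)) r) \<in> borel_measurable (\<Pi>\<^sub>M k\<in>{1..r}. MZ_measure k)"
  proof (rule borel_measurable_ordered_prod)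
    fix k assume k: "1 \<le> k" "k \<le> r"
    have "s k \<in> borel_measurable (MZ_measure k)" using s[OF k] by (simp add: borel_section_def)
    then show "(\<lambda>C. s k (C k)) \<in> borel_measurable (\<Pi>\<^sub>M k\<in>{1..r}. MZ_measure k)"
      using k by (intro measurable_compose[OF measurable_component_singleton]) auto
  qed
  show "(\<lambda>C. ordered_prod (\<lambda>k. s k (C k)) r) \<in> space (\<Pi>\<^sub>M k\<in>{1..r}. MZ_measure k) \<rightarrow> N_grp r"
  proof
    fix C assume C: "C \<in> space (\<Pi>\<^sub>M k\<in>{1..r}. (MZ_measure k :: 'n sqmat set measure))"
    show "ordered_prod (\<lambda>k. s k (C k)) r \<in> N_grp r"
      using C r s by (intro ordered_prod_in_N_grp[OF r] section_in_M_grp) (auto simp: space_PiM)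
  qed
qed

lemma hilbert_tensor_cinner:
  "hilbert_tensor K H K' t \<Longrightarrow> a \<in> K \<Longrightarrow> a' \<in> K \<Longrightarrow> b \<in> H \<Longrightarrow> b' \<in> H \<Longrightarrow>
    cinner (t a b) (t a' b') = cinner a a' * cinner b b'"
  by (simp add: hilbert_tensor_def)

text \<open>\<open>A\<close> stands for the earlier representation along the sections,
  \<open>B\<close> for the new Heisenberg factor and \<open>R\<close> for the extension at the new
  section value. Integrating over \<open>x\<close> at fixed \<open>y\<close> leaves \<open>R\<close>
  only in inner products of its values, where it cancels.\<close>

lemma tensor_schur_relation:
  fixes M :: "nat \<Rightarrow> 'x measure" and K H K' :: "'h::complex_hilbert_space set"
  assumes M: "product_sigma_finite M" and I: "finite I" "i \<notin> I"
    and K: "csubspace K" and H: "csubspace H" and K': "csubspace K'" and tensor: "hilbert_tensor K H K' t"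
    and A: "schur_relation (Pi\<^sub>M I M) A K p" "p \<ge> 0" "\<And>x. x \<in> space (Pi\<^sub>M I M) \<Longrightarrow> isometry_on K (A x)"
    and B: "schur_relation (M i) B H q" "q \<ge> 0" "\<And>y. y \<in> space (M i) \<Longrightarrow> isometry_on H (B y)"
    and R: "\<And>y. y \<in> space (M i) \<Longrightarrow> isometry_on K (R y)"
    and V: "\<And>z. z \<in> space (Pi\<^sub>M (insert i I) M) \<Longrightarrow> isometry_on K' (V z)"
    and V_measurable: "\<And>u v. u \<in> K' \<Longrightarrow> v \<in> K' \<Longrightarrow> (\<lambda>z. cinner u (V z v)) \<in> borel_measurable (Pi\<^sub>M (insert i I) M)"
    and V_tensor: "\<And>x y a b. x \<in> space (Pi\<^sub>M I M) \<Longrightarrow> y \<in> space (M i) \<Longrightarrow> a \<in> K \<Longrightarrow> b \<in> H \<Longrightarrow>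
      V (x(i := y)) (t a b) = t (A x (R y a)) (B y b)"
  shows "schur_relation (Pi\<^sub>M (insert i I) M) V K' (p * q)"
proof (rule schur_relation_generators[OF K' V, where T = "{t a b | a b. a \<in> K \<and> b \<in> H}"])
  interpret product_sigma_finite M by fact
  let ?T = "{t a b | a b. a \<in> K \<and> b \<in> H}" and ?N = "Pi\<^sub>M (insert i I) M"
  have closure: "K' = closure (csubspace hull ?T)" using tensor unfolding hilbert_tensor_def by blast
  show T: "?T \<subseteq> K'" unfolding closure using closure_subset hull_subset by (rule order_trans[rotated])
  show "K' \<subseteq> closure (csubspace hull ?T)" using closure by simp
  show "0 \<le> p * q" using A B by simp
  show "(\<lambda>z. cinner u (V z v)) \<in> borel_measurable ?N" if "u \<in> ?T" "v \<in> ?T" for u v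
    using V_measurable T that by blast
  have R_in: "R y a \<in> K" if "a \<in> K" "y \<in> space (M i)" for a y
    using isometry_on_in[OF R] that by blast
  have coeff: "cinner (t a b) (V (x(i := y)) (t c d)) = cinner a (A x (R y c)) * cinner b (B y d)"
    if "x \<in> space (Pi\<^sub>M I M)" "y \<in> space (M i)" "a \<in> K" "b \<in> H" "c \<in> K" "d \<in> H" for a b c d x y
    using that V_tensor hilbert_tensor_cinner[OF tensor] isometry_on_in[OF A(3)] isometry_on_in[OF B(3)] R_in by simp
  \<comment> \<open>Tonelli's theorem for squares comes first; the polarised integrands are then
    dominated by sums of squares, and Fubini's theorem applies to them.\<close>
  have square: "integrable ?N (\<lambda>z. (cmod (cinner (t a b) (V z (t c d))))\<^sup>2)"
    if abcd: "a \<in> K" "b \<in> H" "c \<in> K" "d \<in> H" for a b c d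
  proof (rule integrableI_nonneg)
    have tab: "t a b \<in> K'" "t c d \<in> K'" using T abcd by blast+
    note V_measurable[OF tab, measurable]
    have mB[measurable]: "(\<lambda>y. cinner b (B y d)) \<in> borel_measurable (M i)"
      by (rule schur_relation_measurable[OF B(1) abcd(2,4)])
    show "(\<lambda>z. (cmod (cinner (t a b) (V z (t c d))))\<^sup>2) \<in> borel_measurable ?N" by measurable
    have "(\<integral>\<^sup>+z. ennreal ((cmod (cinner (t a b) (V z (t c d))))\<^sup>2) \<partial>?N)
      = (\<integral>\<^sup>+y. \<integral>\<^sup>+x. ennreal ((cmod (cinner (t a b) (V (x(i := y)) (t c d))))\<^sup>2) \<partial>Pi\<^sub>M I M \<partial>M i)"
      by (rule product_nn_integral_insert_rev[OF I]) measurable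
    also have "\<dots> = (\<integral>\<^sup>+y. ennreal (p * (norm a)\<^sup>2 * (norm c)\<^sup>2) * ennreal ((cmod (cinner b (B y d)))\<^sup>2) \<partial>M i)"
    proof (rule nn_integral_cong)
      fix y assume y: "y \<in> space (M i)"
      have m: "(\<lambda>x. cinner a (A x (R y c))) \<in> borel_measurable (Pi\<^sub>M I M)"
        by (rule schur_relation_measurable[OF A(1) abcd(1) R_in[OF abcd(3) y]])
      have "(\<integral>\<^sup>+x. ennreal ((cmod (cinner (t a b) (V (x(i := y)) (t c d))))\<^sup>2) \<partial>Pi\<^sub>M I M)
        = (\<integral>\<^sup>+x. ennreal ((cmod (cinner a (A x (R y c))))\<^sup>2) * ennreal ((cmod (cinner b (B y d)))\<^sup>2) \<partial>Pi\<^sub>M I M)"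
        using abcd y by (intro nn_integral_cong) (simp add: coeff norm_mult power_mult_distrib ennreal_mult)
      also have "\<dots> = (\<integral>\<^sup>+x. ennreal ((cmod (cinner a (A x (R y c))))\<^sup>2) \<partial>Pi\<^sub>M I M) * ennreal ((cmod (cinner b (B y d)))\<^sup>2)"
        using m by (intro nn_integral_multc) measurable
      also have "(\<integral>\<^sup>+x. ennreal ((cmod (cinner a (A x (R y c))))\<^sup>2) \<partial>Pi\<^sub>M I M) = ennreal (p * (norm a)\<^sup>2 * (norm c)\<^sup>2)"
        using A(1) abcd R_in[OF abcd(3) y] isometry_on_norm[OF R[OF y] abcd(3)] by (simp add: schur_relation_def)
      finally show "(\<integral>\<^sup>+x. ennreal ((cmod (cinner (t a b) (V (x(i := y)) (t c d))))\<^sup>2) \<partial>Pi\<^sub>M I M)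
        = ennreal (p * (norm a)\<^sup>2 * (norm c)\<^sup>2) * ennreal ((cmod (cinner b (B y d)))\<^sup>2)" .
    qed
    also have "\<dots> = ennreal (p * (norm a)\<^sup>2 * (norm c)\<^sup>2) * (\<integral>\<^sup>+y. ennreal ((cmod (cinner b (B y d)))\<^sup>2) \<partial>M i)"
      by (rule nn_integral_cmult) measurable
    also have "\<dots> < \<infinity>"
      using B(1) abcd by (simp add: schur_relation_def ennreal_mult_less_top)
    finally show "(\<integral>\<^sup>+z. ennreal ((cmod (cinner (t a b) (V z (t c d))))\<^sup>2) \<partial>?N) < \<infinity>" .
  qed simp
  fix u u' v v' assume "u \<in> ?T" "u' \<in> ?T" "v \<in> ?T" "v' \<in> ?T"
  then obtain a b a' b' c d c' d' where eqs: "u = t a b" "u' = t a' b'" "v = t c d" "v' = t c' d'"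
    and in_K: "a \<in> K" "a' \<in> K" "c \<in> K" "c' \<in> K" and in_H: "b \<in> H" "b' \<in> H" "d \<in> H" "d' \<in> H" by blast
  have in_K': "u \<in> K'" "u' \<in> K'" "v \<in> K'" "v' \<in> K'" using T in_K in_H unfolding eqs by blast+
  let ?f = "\<lambda>z. cinner u (V z v) * cnj (cinner u' (V z v'))"
  have int: "integrable ?N ?f"
  proof (rule Bochner_Integration.integrable_bound)
    show "integrable ?N (\<lambda>z. (cmod (cinner u (V z v)))\<^sup>2 + (cmod (cinner u' (V z v')))\<^sup>2)"
      unfolding eqs by (intro Bochner_Integration.integrable_add square in_K in_H)
    show "?f \<in> borel_measurable ?N"
      by (intro borel_measurable_times measurable_compose[OF _ borel_measurable_cnj] V_measurable in_K')
    have "x * y \<le> x\<^sup>2 + y\<^sup>2" for x y :: real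
      using zero_le_power2[of "x - y"] zero_le_power2[of "x + y"] by (simp add: power2_eq_square algebra_simps)
    then show "AE z in ?N. norm (?f z) \<le> norm ((cmod (cinner u (V z v)))\<^sup>2 + (cmod (cinner u' (V z v')))\<^sup>2)"
      by (simp add: norm_mult)
  qed
  have "integral\<^sup>L ?N ?f = (\<integral>y. \<integral>x. ?f (x(i := y)) \<partial>Pi\<^sub>M I M \<partial>M i)"
    by (rule product_integral_insert_rev[OF I int])
  also have "\<dots> = (\<integral>y. (of_real p * cinner a a' * cinner c' c) * (cinner b (B y d) * cnj (cinner b' (B y d'))) \<partial>M i)"
  proof (rule Bochner_Integration.integral_cong[OF refl])
    fix y assume y: "y \<in> space (M i)"
    have "(\<integral>x. ?f (x(i := y)) \<partial>Pi\<^sub>M I M)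
      = (\<integral>x. (cinner a (A x (R y c)) * cnj (cinner a' (A x (R y c')))) * (cinner b (B y d) * cnj (cinner b' (B y d'))) \<partial>Pi\<^sub>M I M)"
      unfolding eqs using in_K in_H y by (intro Bochner_Integration.integral_cong) (simp_all add: coeff)
    also have "\<dots> = (\<integral>x. cinner a (A x (R y c)) * cnj (cinner a' (A x (R y c'))) \<partial>Pi\<^sub>M I M) * (cinner b (B y d) * cnj (cinner b' (B y d')))"
      by (rule integral_mult_left_zero)
    also have "(\<integral>x. cinner a (A x (R y c)) * cnj (cinner a' (A x (R y c'))) \<partial>Pi\<^sub>M I M) = of_real p * cinner a a' * cinner (R y c') (R y c)"
      using schur_relation_product[OF K A(3,2,1) in_K(1,2) R_in[OF in_K(3) y] R_in[OF in_K(4) y]]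
      unfolding schur_product_def by (rule has_bochner_integral_integral_eq)
    \<comment> \<open>The dependence on \<open>y\<close> through the extension disappears
      here.\<close>
    also have "cinner (R y c') (R y c) = cinner c' c"
      by (rule isometry_on_cinner[OF R[OF y] K in_K(4,3)])
    finally show "(\<integral>x. ?f (x(i := y)) \<partial>Pi\<^sub>M I M) = (of_real p * cinner a a' * cinner c' c) * (cinner b (B y d) * cnj (cinner b' (B y d')))" .
  qed
  also have "\<dots> = (of_real p * cinner a a' * cinner c' c) * (\<integral>y. cinner b (B y d) * cnj (cinner b' (B y d')) \<partial>M i)"
    by (rule integral_mult_right_zero)
  also have "(\<integral>y. cinner b (B y d) * cnj (cinner b' (B y d')) \<partial>M i) = of_real q * cinner b b' * cinner d' d"
    using schur_relation_product[OF H B(3,2,1) in_H]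
    unfolding schur_product_def by (rule has_bochner_integral_integral_eq)
  finally show "schur_product ?N V (p * q) u u' v v'"
    unfolding schur_product_def has_bochner_integral_iff using int
    by (simp add: eqs hilbert_tensor_cinner[OF tensor] in_K in_H)
qed

text \<open>Every closed subspace is invariant, so irreducibility makes \<open>K\<close>
  one-dimensional and the Cauchy-Schwarz inequality an equality. This is the Schur relation over the
  empty product.\<close>

lemma irreducible_trivial_group:
  assumes irr: "irreducible_unitary_rep {mat 1} K \<rho>" and z: "z \<in> K" and w: "w \<in> K"
  shows "cmod (cinner z w) = norm z * norm w"
proof (cases "w = 0")
  case False
  have U: "unitary_rep {mat 1} K \<rho>" using irr by (simp add: irreducible_unitary_rep_def)
  have K: "closed_csubspace K" "csubspace K" using U unitary_rep_csubspace[OF U] by (auto simp: unitary_rep_def)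
  \<comment> \<open>The orthogonal complement of \<open>w\<close>. Being invariant and different
    from \<open>K\<close> it is zero, so \<open>K\<close> is spanned by \<open>w\<close>.\<close>
  define V where "V = {v \<in> K. cinner v w = 0}"
  have "closed_csubspace V"
    unfolding closed_csubspace_def
  proof
    show "csubspace V"
      using K(2) by (auto simp: V_def csubspace_def cinner_add_left cinner_scaleC_left)
    show "closed V"
      unfolding closed_sequential_limits
    proof (intro allI impI, elim conjE)
      fix x v assume x: "\<forall>n. x n \<in> V" "x \<longlonglongrightarrow> v"
      have "v \<in> K"
        using K(1) x closed_sequentially[of K x v] by (auto simp: V_def closed_csubspace_def)
      moreover have "(\<lambda>n. cinner (x n) w) \<longlonglongrightarrow> cinner v w" using x(2) by (intro tendsto_cinner tendsto_const)
      then have "(\<lambda>n::nat. 0) \<longlonglongrightarrow> cinner v w" using x(1) by (simp add: V_def)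
      then have "cinner v w = 0" using LIMSEQ_unique tendsto_const by blast
      ultimately show "v \<in> V" by (simp add: V_def)
    qed
  qed
  moreover have "\<rho> (mat 1) ` V \<subseteq> V" using unitary_rep_one[OF U] by (auto simp: V_def)
  moreover have "w \<notin> V" using False by (simp add: V_def cinner_self)
  then have "V \<noteq> K" using w by blast
  moreover have "V \<subseteq> K" by (auto simp: V_def)
  ultimately have V0: "V = {0}" using irr by (auto simp: irreducible_unitary_rep_def)
  define c where "c = cinner z w / cinner w w"
  have "z - c *\<^sub>C w \<in> V"
    using False z w K(2) by (simp add: V_def csubspace_diff csubspace_scaleC c_def cinner_diff_left cinner_scaleC_left cinner_self)
  then have z: "z = c *\<^sub>C w" using V0 by simp
  show ?thesis
    unfolding z by (simp add: cinner_scaleC_left norm_mult cinner_self norm_scaleC power2_eq_square)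
qed simp

lemma ordered_prod_update:
  assumes "i = Suc r"
  shows "ordered_prod (\<lambda>k. s k ((x(i := y)) k)) i = ordered_prod (\<lambda>k. s k (x k)) r ** s i y"
  using assms ordered_prod_cong[of r "\<lambda>k. s k ((x(i := y)) k)" "\<lambda>k. s k (x k)"] by simp

text \<open>The product locale wants all factors to be sigma-finite, so those of index outside \<open>1, \<dots>, m\<close> are replaced.\<close>

lemma PiM_MZ_measure_cong:
  assumes "2 * r \<le> CARD('n)"
  shows "(\<Pi>\<^sub>M k\<in>{1..r}. (MZ_measure k :: ('n::{finite,linorder}) sqmat set measure)) =
    (\<Pi>\<^sub>M k\<in>{1..r}. if 1 \<le> k \<and> 2 * k \<le> CARD('n) then MZ_measure k else count_space {})"
  using assms by (intro PiM_cong) auto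

lemma product_sigma_finite_MZ_measure:
  "product_sigma_finite (\<lambda>k. if 1 \<le> k \<and> 2 * k \<le> CARD('n) then MZ_measure k :: ('n::{finite,linorder}) sqmat set measure else count_space {})"
  by (rule product_sigma_finite.intro)
    (auto simp: sigma_finite_MZ_measure intro: sigma_finite_measure_count_space_finite)

lemma section_isometry:
  assumes r: "2 * r \<le> CARD('n)" and s: "\<And>k. 1 \<le> k \<Longrightarrow> k \<le> r \<Longrightarrow> borel_section k (s k)"
    and U: "unitary_rep (N_grp r) K (\<rho> :: ('n::{finite,linorder}) sqmat \<Rightarrow> 'h::complex_hilbert_space \<Rightarrow> 'h)"
    and C: "C \<in> space (\<Pi>\<^sub>M k\<in>{1..r}. MZ_measure k)"
  shows "isometry_on K (\<rho> (ordered_prod (\<lambda>k. s k (C k)) r))"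
  using measurable_space[OF measurable_ordered_prod_sections[OF r s] C]
  by (intro unitary_rep_isometry[OF U]) (simp add: space_restrict_space)

lemma hilbert_tensor_nonzero:
  assumes "hilbert_tensor K H K' t" "csubspace K" "csubspace H" "K \<noteq> {0}" "H \<noteq> {0}"
  shows "K' \<noteq> {0}"
proof -
  obtain a b where ab: "a \<in> K" "a \<noteq> 0" "b \<in> H" "b \<noteq> 0"
    using assms csubspace_0 by blast
  have "cinner a a * cinner b b \<noteq> 0" using ab by (simp add: cinner_self)
  then have "t a b \<noteq> 0"
    using hilbert_tensor_cinner[OF assms(1) ab(1,1,3,3)] by auto
  moreover have "t a b \<in> K'"
  proof -
    have "t a b \<in> csubspace hull {t a b | a b. a \<in> K \<and> b \<in> H}" using ab by (intro hull_inc) auto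
    then show ?thesis using assms(1) closure_subset unfolding hilbert_tensor_def by blast
  qed
  ultimately show ?thesis by auto
qed

text \<open>Induction along the construction. Unitarity and \<open>K \<noteq> {0}\<close> are
  carried along with the relation, since from these three facts irreducibility is recovered at the
  end.\<close>

lemma stepwise_schur_relation:
  fixes l :: "nat \<Rightarrow> real" and H :: "nat \<Rightarrow> 'h::complex_hilbert_space set"
    and \<pi> :: "nat \<Rightarrow> ('n::{finite,linorder}) sqmat \<Rightarrow> 'h \<Rightarrow> 'h"
  assumes l: "\<And>k. 1 \<le> k \<Longrightarrow> 2 * k \<le> CARD('n) \<Longrightarrow> l k \<noteq> 0"
    and rep: "\<And>k. 1 \<le> k \<Longrightarrow> 2 * k \<le> CARD('n) \<Longrightarrow> heisenberg_rep k (l k) (H k) (\<pi> k)"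
    and step: "stepwise_rep l H \<pi> r K \<rho>" and r: "2 * r \<le> CARD('n)"
    and s: "\<And>k. 1 \<le> k \<Longrightarrow> 2 * k \<le> CARD('n) \<Longrightarrow> borel_section k (s k)"
  shows "unitary_rep (N_grp r) K \<rho> \<and> K \<noteq> {0} \<and>
    schur_relation (\<Pi>\<^sub>M k\<in>{1..r}. MZ_measure k) (\<lambda>C. \<rho> (ordered_prod (\<lambda>k. s k (C k)) r)) K
      (\<Prod>k=1..r. 1 / \<bar>l k\<bar> ^ (CARD('n) - 2 * k))"
  using step r
proof (induction rule: stepwise_rep.induct)
  case (trivial K \<rho>)
  then have U: "unitary_rep {mat 1} K \<rho>" and irr: "irreducible_unitary_rep {mat 1} K \<rho>" and "K \<noteq> {0}"
    by (simp_all add: N_grp_0 irreducible_unitary_rep_def)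
  \<comment> \<open>Over the empty index set the product measure is a unit mass at one point, and
    the ordered product is the unit matrix.\<close>
  moreover have "schur_relation (\<Pi>\<^sub>M k\<in>{}. MZ_measure k :: 'n sqmat set measure) (\<lambda>C. \<rho> (mat 1)) K 1"
    unfolding schur_relation_def
    using irreducible_trivial_group[OF irr] unitary_rep_one[OF U]
    by (simp add: PiM_empty nn_integral_count_space_finite power_mult_distrib ennreal_mult)
  ultimately show ?case by (simp add: N_grp_0)
next
  case first
  then have r1: "1 \<le> (1::nat)" "2 * 1 \<le> CARD('n)" by auto
  define M where "M = (\<lambda>k. if 1 \<le> k \<and> 2 * k \<le> CARD('n) then MZ_measure k :: 'n sqmat set measure else count_space {})"
  interpret product_sigma_finite M unfolding M_def by (rule product_sigma_finite_MZ_measure)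
  have M1: "M 1 = MZ_measure 1" using r1 by (simp add: M_def)
  have U: "unitary_rep (N_grp 1) (H 1) (\<pi> 1)" and "H 1 \<noteq> {0}"
    using rep[OF r1] unfolding N_grp_1 by (simp_all add: heisenberg_rep_def irreducible_unitary_rep_def)
  have S: "schur_relation (MZ_measure 1) (\<lambda>C. \<pi> 1 (s 1 C)) (H 1) (1 / \<bar>l 1\<bar> ^ (CARD('n) - 2 * 1))"
    by (rule heisenberg_schur_relation[OF r1 l[OF r1] rep[OF r1] s[OF r1]])
  have "schur_relation (Pi\<^sub>M {1} M) (\<lambda>C. \<pi> 1 (s 1 (C 1))) (H 1) (1 / \<bar>l 1\<bar> ^ (CARD('n) - 2 * 1))"
    unfolding schur_relation_def
  proof (intro ballI conjI)
    fix u v assume uv: "u \<in> H 1" "v \<in> H 1"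
    have m: "(\<lambda>C. cinner u (\<pi> 1 (s 1 C) v)) \<in> borel_measurable (MZ_measure 1)"
      by (rule schur_relation_measurable[OF S uv])
    then have m': "(\<lambda>C. cinner u (\<pi> 1 (s 1 C) v)) \<in> borel_measurable (M 1)"
      by (simp only: M1)
    show "(\<lambda>C. cinner u (\<pi> 1 (s 1 (C 1)) v)) \<in> borel_measurable (Pi\<^sub>M {1} M)"
      by (rule measurable_compose[OF measurable_component_singleton[of 1 "{1}" M] m']) simp
    have "(\<integral>\<^sup>+C. ennreal ((cmod (cinner u (\<pi> 1 (s 1 (C 1)) v)))\<^sup>2) \<partial>(Pi\<^sub>M {1} M))
      = (\<integral>\<^sup>+C. ennreal ((cmod (cinner u (\<pi> 1 (s 1 C) v)))\<^sup>2) \<partial>(M 1))"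
      using m' by (intro product_nn_integral_singleton[where f = "\<lambda>C. ennreal ((cmod (cinner u (\<pi> 1 (s 1 C) v)))\<^sup>2)"]) measurable
    also have "\<dots> = (\<integral>\<^sup>+C. ennreal ((cmod (cinner u (\<pi> 1 (s 1 C) v)))\<^sup>2) \<partial>MZ_measure 1)"
      by (simp only: M1)
    finally show "(\<integral>\<^sup>+C. ennreal ((cmod (cinner u (\<pi> 1 (s 1 (C 1)) v)))\<^sup>2) \<partial>(Pi\<^sub>M {1} M))
      = ennreal (1 / \<bar>l 1\<bar> ^ (CARD('n) - 2 * 1) * (norm u)\<^sup>2 * (norm v)\<^sup>2)"
      using S uv by (simp add: schur_relation_def)
  qed
  then have "schur_relation (\<Pi>\<^sub>M k\<in>{1..1}. MZ_measure k) (\<lambda>C. \<pi> 1 (s 1 (C 1))) (H 1) (1 / \<bar>l 1\<bar> ^ (CARD('n) - 2 * 1))"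
    unfolding PiM_MZ_measure_cong[OF r1(2)] M_def by simp
  then show ?case using U \<open>H 1 \<noteq> {0}\<close> by simp
next
  case (step r K \<rho> \<rho>' K' t \<sigma>)
  define i where "i = r + 1"
  define M where "M = (\<lambda>k. if 1 \<le> k \<and> 2 * k \<le> CARD('n) then MZ_measure k :: 'n sqmat set measure else count_space {})"
  have i: "1 \<le> i" "2 * i \<le> CARD('n)" and r: "2 * r \<le> CARD('n)" using step.prems by (simp_all add: i_def)
  have insert: "{1..i} = insert i {1..r}" "i \<notin> {1..r}" by (auto simp: i_def)
  have Mi: "M i = MZ_measure i" using i by (simp add: M_def)
  have PiM_r: "(\<Pi>\<^sub>M k\<in>{1..r}. MZ_measure k) = Pi\<^sub>M {1..r} M" unfolding M_def by (rule PiM_MZ_measure_cong[OF r])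
  have PiM_i: "(\<Pi>\<^sub>M k\<in>{1..i}. MZ_measure k) = Pi\<^sub>M (insert i {1..r}) M"
    unfolding M_def insert(1)[symmetric] by (rule PiM_MZ_measure_cong[OF i(2)])
  have s_r: "borel_section k (s k)" if "1 \<le> k" "k \<le> r" for k using that r by (intro s) auto
  have s_i: "borel_section k (s k)" if "1 \<le> k" "k \<le> i" for k using that i by (intro s) auto
  have U: "unitary_rep (N_grp r) K \<rho>" and K0: "K \<noteq> {0}"
    and A: "schur_relation (Pi\<^sub>M {1..r} M) (\<lambda>C. \<rho> (ordered_prod (\<lambda>k. s k (C k)) r)) K (\<Prod>k=1..r. 1 / \<bar>l k\<bar> ^ (CARD('n) - 2 * k))"
    using step.IH[OF r] unfolding PiM_r by auto
  have U': "unitary_rep (N_grp i) K \<rho>'"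
    using step.hyps(3) by (simp add: kirillov_rep_def irreducible_unitary_rep_def N_grp_def i_def)
  have UH: "unitary_rep (M_grp i) (H i) (\<pi> i)" and H0: "H i \<noteq> {0}"
    using rep[OF i] by (simp_all add: heisenberg_rep_def irreducible_unitary_rep_def)
  have U\<sigma>: "unitary_rep (N_grp i) K' \<sigma>" using step.hyps(6) by (simp add: i_def)
  have tensor: "hilbert_tensor K (H i) K' t" using step.hyps(5) by (simp add: i_def)
  have n_in: "ordered_prod (\<lambda>k. s k (x k)) r \<in> N_grp r" if "x \<in> space (Pi\<^sub>M {1..r} M)" for x
    using measurable_space[OF measurable_ordered_prod_sections[OF r s_r], unfolded PiM_r, OF _ _ that]
    by (simp add: space_restrict_space)
  have y_in: "s i y \<in> M_grp i" if "y \<in> space (M i)" for y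
    using section_in_M_grp[OF i s[OF i]] that Mi by simp
  have MN: "M_grp i \<subseteq> (N_grp i :: 'n sqmat set)" using i by (intro M_grp_subset_N_grp) auto
  have NN: "N_grp r \<subseteq> (N_grp i :: 'n sqmat set)" using i by (intro N_grp_mono) (auto simp: i_def)
  have "schur_relation (Pi\<^sub>M (insert i {1..r}) M) (\<lambda>C. \<sigma> (ordered_prod (\<lambda>k. s k (C k)) i)) K'
     ((\<Prod>k=1..r. 1 / \<bar>l k\<bar> ^ (CARD('n) - 2 * k)) * (1 / \<bar>l i\<bar> ^ (CARD('n) - 2 * i)))"
  proof (rule tensor_schur_relation[where R = "\<lambda>y. \<rho>' (s i y)" and B = "\<lambda>y. \<pi> i (s i y)" and t = t and H = "H i"])
    show "product_sigma_finite M" unfolding M_def by (rule product_sigma_finite_MZ_measure)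
    show "csubspace K" "csubspace (H i)" "csubspace K'" using U UH U\<sigma> by (auto intro: unitary_rep_csubspace)
    show "hilbert_tensor K (H i) K' t" by fact
    show "schur_relation (Pi\<^sub>M {1..r} M) (\<lambda>C. \<rho> (ordered_prod (\<lambda>k. s k (C k)) r)) K (\<Prod>k=1..r. 1 / \<bar>l k\<bar> ^ (CARD('n) - 2 * k))" by fact
    show "schur_relation (M i) (\<lambda>y. \<pi> i (s i y)) (H i) (1 / \<bar>l i\<bar> ^ (CARD('n) - 2 * i))"
      unfolding Mi by (rule heisenberg_schur_relation[OF i l[OF i] rep[OF i] s[OF i]])
    show "isometry_on K (\<rho> (ordered_prod (\<lambda>k. s k (x k)) r))" if "x \<in> space (Pi\<^sub>M {1..r} M)" for x
      using n_in[OF that] by (rule unitary_rep_isometry[OF U])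
    show "isometry_on (H i) (\<pi> i (s i y))" if "y \<in> space (M i)" for y
      using y_in[OF that] by (rule unitary_rep_isometry[OF UH])
    show "isometry_on K (\<rho>' (s i y))" if "y \<in> space (M i)" for y
      using y_in[OF that] MN by (intro unitary_rep_isometry[OF U']) auto
    show "isometry_on K' (\<sigma> (ordered_prod (\<lambda>k. s k (z k)) i))" if "z \<in> space (Pi\<^sub>M (insert i {1..r}) M)" for z
      using that unfolding PiM_i[symmetric] by (intro section_isometry[OF i(2) _ U\<sigma>] s_i)
    show "(\<lambda>z. cinner u (\<sigma> (ordered_prod (\<lambda>k. s k (z k)) i) v)) \<in> borel_measurable (Pi\<^sub>M (insert i {1..r}) M)"
      if "u \<in> K'" "v \<in> K'" for u v
      unfolding PiM_i[symmetric]
      by (intro measurable_compose[OF measurable_ordered_prod_sections[OF i(2)] unitary_rep_coeff_measurable[OF U\<sigma> that(2)]] s_i)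
    fix x y a b assume x: "x \<in> space (Pi\<^sub>M {1..r} M)" and y: "y \<in> space (M i)" and a: "a \<in> K" and b: "b \<in> H i"
    let ?n = "ordered_prod (\<lambda>k. s k (x k)) r"
    have "\<rho>' (s i y) a \<in> K"
      using isometry_on_in[OF unitary_rep_isometry[OF U'] a] y_in[OF y] MN by blast
    \<comment> \<open>\<open>\<rho>'\<close> is multiplicative on \<open>N_grp i\<close> and agrees
      with \<open>\<rho>\<close> on \<open>N_grp r\<close>, so the earlier representation splits off
      on the left.\<close>
    then have "\<rho>' (?n ** s i y) a = \<rho> ?n (\<rho>' (s i y) a)"
      using unitary_rep_mult[OF U' _ _ a, of ?n "s i y"] n_in[OF x] y_in[OF y] MN NN step.hyps(4) by auto
    moreover have "\<sigma> (?n ** s i y) (t a b) = t (\<rho>' (?n ** s i y) a) (\<pi> i (s i y) b)"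
      using step.hyps(7) n_in[OF x] y_in[OF y] a b unfolding i_def by blast
    ultimately show "\<sigma> (ordered_prod (\<lambda>k. s k ((x(i := y)) k)) i) (t a b) = t (\<rho> ?n (\<rho>' (s i y) a)) (\<pi> i (s i y) b)"
      by (subst ordered_prod_update[of i r]) (simp_all add: i_def)
  qed (use insert in \<open>auto intro!: prod_nonneg\<close>)
  moreover have "(\<Prod>k=1..i. 1 / \<bar>l k\<bar> ^ (CARD('n) - 2 * k)) = (\<Prod>k=1..r. 1 / \<bar>l k\<bar> ^ (CARD('n) - 2 * k)) * (1 / \<bar>l i\<bar> ^ (CARD('n) - 2 * i))"
    using insert by (simp add: mult.commute)
  moreover have "K' \<noteq> {0}"
    by (rule hilbert_tensor_nonzero[OF tensor unitary_rep_csubspace[OF U] unitary_rep_csubspace[OF UH] K0 H0])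
  ultimately show ?case using U\<sigma> unfolding i_def[symmetric] PiM_i by simp
qed

text \<open>
  An invariant subspace and its orthogonal complement have vanishing mutual coefficients, so a Schur
  relation with a positive constant rules out proper invariant subspaces.
\<close>

lemma schur_relation_irreducible:
  assumes U: "unitary_rep G K \<rho>" and K: "K \<noteq> {0}" and S: "schur_relation M (\<lambda>C. \<rho> (x C)) K c"
    and c: "c > 0" and x: "\<And>C. C \<in> space M \<Longrightarrow> x C \<in> G"
  shows "irreducible_unitary_rep G K \<rho>"
  unfolding irreducible_unitary_rep_def
proof (intro conjI allI impI U K)
  fix W assume W: "closed_csubspace W \<and> W \<subseteq> K \<and> (\<forall>x\<in>G. \<rho> x ` W \<subseteq> W)"
  show "W = {0} \<or> W = K"
  proof (rule ccontr)
    assume "\<not> (W = {0} \<or> W = K)"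
    then obtain u where u: "u \<in> K" "u \<notin> W" using W by blast
    have W0: "0 \<in> W" using W by (simp add: closed_csubspace_def csubspace_def)
    then obtain w where w: "w \<in> W" "w \<noteq> 0" using \<open>\<not> (W = {0} \<or> W = K)\<close> by blast
    obtain p where p: "p \<in> W" "u - p \<noteq> 0" "\<And>v. v \<in> W \<Longrightarrow> cinner (u - p) v = 0"
      using orthogonal_vector_exists[of W u] W u(2) by blast
    have in_K: "u - p \<in> K" "w \<in> K"
      using csubspace_diff[OF unitary_rep_csubspace[OF U] u(1)] p(1) w(1) W by blast+
    have "\<rho> (x C) w \<in> W" if "C \<in> space M" for C using x[OF that] W w(1) by blast
    then have "(\<integral>\<^sup>+C. ennreal ((cmod (cinner (u - p) (\<rho> (x C) w)))\<^sup>2) \<partial>M) = 0"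
      using p(3) by (simp cong: nn_integral_cong)
    then have "c * (norm (u - p))\<^sup>2 * (norm w)\<^sup>2 \<le> 0"
      using S in_K by (simp add: schur_relation_def ennreal_eq_0_iff)
    moreover have "0 < c * (norm (u - p))\<^sup>2 * (norm w)\<^sup>2"
      using c p(2) w(2) by (intro mult_pos_pos) simp_all
    ultimately show False by linarith
  qed
qed

theorem theorem3p8:
  fixes l :: "nat \<Rightarrow> real"
    and H :: "nat \<Rightarrow> 'h::complex_hilbert_space set"
    and \<pi> :: "nat \<Rightarrow> ('n::{finite,linorder}) sqmat \<Rightarrow> 'h \<Rightarrow> 'h"
    and K :: "'h set"
    and \<rho> :: "'n sqmat \<Rightarrow> 'h \<Rightarrow> 'h"
  assumes "\<forall>r\<in>{1..CARD('n) div 2}. l r \<noteq> 0"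
    and "\<forall>r\<in>{1..CARD('n) div 2}. heisenberg_rep r (l r) (H r) (\<pi> r)"
    and "stepwise_rep l H \<pi> (CARD('n) div 2) K \<rho>"
  shows "irreducible_unitary_rep unipotent_group K \<rho> \<and>
    (\<forall>s. (\<forall>r\<in>{1..CARD('n) div 2}. borel_section r (s r)) \<longrightarrow>
      (\<forall>z\<in>K. \<forall>w\<in>K.
        in_L2 NS_measure (on_NS s (matrix_coeff \<rho> z w)) \<and>
        (L2_norm NS_measure (on_NS s (matrix_coeff \<rho> z w)))\<^sup>2
          = (norm z)\<^sup>2 * (norm w)\<^sup>2 / stepwise_degree H \<pi> \<and>
        (norm z)\<^sup>2 * (norm w)\<^sup>2 / stepwise_degree H \<pi>
          = (norm z)\<^sup>2 * (norm w)\<^sup>2 / (\<Prod>r=1..CARD('n) div 2. \<bar>l r\<bar> ^ (CARD('n) - 2 * r))))"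
proof -
  let ?m = "CARD('n) div 2"
  let ?D = "\<Prod>r=1..?m. \<bar>l r\<bar> ^ (CARD('n) - 2 * r)"
  have l: "l k \<noteq> 0" and rep: "heisenberg_rep k (l k) (H k) (\<pi> k)" if "1 \<le> k" "2 * k \<le> CARD('n)" for k
    using assms(1,2) that by auto
  have m: "2 * ?m \<le> CARD('n)" by simp
  have D_pos: "?D > 0" using assms(1) by (intro prod_pos) auto
  have c: "(\<Prod>k=1..?m. 1 / \<bar>l k\<bar> ^ (CARD('n) - 2 * k)) = 1 / ?D"
    by (simp add: prod_dividef)
  have degree: "stepwise_degree H \<pi> = ?D"
    unfolding stepwise_degree_def using l rep by (intro prod.cong refl formal_degree_heisenberg) auto
  have main: "unitary_rep (N_grp ?m) K \<rho> \<and> K \<noteq> {0} \<and>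
      schur_relation NS_measure (\<lambda>C. \<rho> (ordered_prod (\<lambda>k. s k (C k)) ?m)) K (1 / ?D)"
    if s: "\<forall>r\<in>{1..?m}. borel_section r (s r)" for s
    unfolding NS_measure_def c[symmetric]
    using s by (intro stepwise_schur_relation[OF l rep assms(3) m]) auto
  \<comment> \<open>Irreducibility does not mention sections but is deduced from the relations, so
    one family of sections is fixed for it.\<close>
  have "\<forall>r\<in>{1..?m}. \<exists>s :: 'n sqmat set \<Rightarrow> 'n sqmat. borel_section r s"
    using borel_section_exists[where 'n = 'n] by auto
  then obtain s0 :: "nat \<Rightarrow> 'n sqmat set \<Rightarrow> 'n sqmat" where s0: "\<forall>r\<in>{1..?m}. borel_section r (s0 r)" by metis
  have "irreducible_unitary_rep (N_grp ?m) K \<rho>"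
  proof (rule schur_relation_irreducible)
    show "unitary_rep (N_grp ?m) K \<rho>" "K \<noteq> {0}" using main[OF s0] by auto
    show "schur_relation NS_measure (\<lambda>C. \<rho> (ordered_prod (\<lambda>k. s0 k (C k)) ?m)) K (1 / ?D)" using main[OF s0] by auto
    show "0 < 1 / ?D" using D_pos by simp
    fix C :: "nat \<Rightarrow> 'n sqmat set" assume "C \<in> space NS_measure"
    then have "ordered_prod (\<lambda>k. s0 k (C k)) ?m \<in> space (restrict_space borel (N_grp ?m))"
      unfolding NS_measure_def using s0 by (intro measurable_space[OF measurable_ordered_prod_sections[OF m]]) auto
    then show "ordered_prod (\<lambda>k. s0 k (C k)) ?m \<in> N_grp ?m" by (simp add: space_restrict_space)
  qed
  then have "irreducible_unitary_rep unipotent_group K \<rho>" by (simp add: N_grp_unipotent)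
  moreover have "in_L2 NS_measure (on_NS s (matrix_coeff \<rho> z w)) \<and>
      (L2_norm NS_measure (on_NS s (matrix_coeff \<rho> z w)))\<^sup>2 = (norm z)\<^sup>2 * (norm w)\<^sup>2 / ?D"
    if s: "\<forall>r\<in>{1..?m}. borel_section r (s r)" and zw: "z \<in> K" "w \<in> K" for s z w
  proof -
    have f: "on_NS s (matrix_coeff \<rho> z w) = (\<lambda>C. cinner z (\<rho> (ordered_prod (\<lambda>k. s k (C k)) ?m) w))"
      by (simp add: on_NS_def matrix_coeff_def)
    have S: "schur_relation NS_measure (\<lambda>C. \<rho> (ordered_prod (\<lambda>k. s k (C k)) ?m)) K (1 / ?D)" using main[OF s] by simp
    have D: "0 \<le> 1 / ?D" using D_pos by simp
    have "in_L2 NS_measure (on_NS s (matrix_coeff \<rho> z w))"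
      unfolding in_L2_def f using schur_relation_measurable[OF S zw] schur_relation_integral(1)[OF S D zw] by simp
    moreover have "(L2_norm NS_measure (on_NS s (matrix_coeff \<rho> z w)))\<^sup>2 = (norm z)\<^sup>2 * (norm w)\<^sup>2 / ?D"
      unfolding L2_norm_def f schur_relation_integral(2)[OF S D zw] using D_pos
      by (subst real_sqrt_pow2) auto
    ultimately show ?thesis ..
  qed
  ultimately show ?thesis unfolding degree by blast
qed

end
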